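(* Assume the hypotheses of the existence theorem below, and let $u$ be the mild solution it produces. Let $\mathcal D\subset\mathbb R^{n-1}$ have positive measure. (A) If $f,V,b$ are non-negative (resp. non-positive) on $\partial\mathbb R^n_+$ and $f$ is positive (resp. negative) on $\mathcal D$, then $u$ is positive (resp. negative) in $\mathbb R^n_+$. (B) If $V$ and $b$ are radially symmetric on $\mathbb R^{n-1}$ and $f$ is symmetric (resp. antisymmetric) under the action of $\mathcal A$, then $u$ is symmetric (resp. antisymmetric) under the action of $\mathcal A$. Existence theorem referred to: let $n\ge3$, $\frac{n-1}{n-2}<\rho<\infty$, $\omega=\frac{(n-1)(\rho-1)}{\rho}$, $1<p<\omega$, $\lambda=(n-1)(\rho-1)$, $1<r<\mu<\infty$, $1<q<\lambda$ with $\frac r\mu=\frac q\lambda=\frac p\omega$, $\frac1r=\frac{n-1}{\omega}-\frac{n-1}{\mu}$, $\mu<\lambda$, $1<\ell_1,\ell_2\le n-1$, $V\in\mathcal M^{n-1}_{\ell_1\infty}(\partial\mathbb R^n_+)$, $b\in\mathcal M^{n-1}_{\ell_2\infty}(\partial\mathbb R^n_+)$ with sufficiently small norms, and $f\in\mathcal M^{\omega}_{p\infty}(\partial\mathbb R^n_+)$ with sufficiently small norm; then $-\Delta u=0$ in $\mathbb R^n_+$, $\partial u/\partial\nu=Vu+b|u|^{\rho-1}u+f$ on $\partial\mathbb R^n_+$ has a unique mild solution $u$ in a small closed ball of $A^{1\infty}_{rq}$, obtained as the limit in $A^{1\infty}_{rq}$ of the Picard iteration $u_1=Nf$, $u_{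k+1}=u_1+N(V\,u_k|_0)+N(b|u_k|_0|^{\rho-1}u_k|_0)$.
   Context: $\mathbb R^n_+=\{(x',x_n):x_n>0\}$, $\partial\mathbb R^n_+\cong\mathbb R^{n-1}$, $\nu=(0,\dots,0,-1)$, $u|_0(x')=u(x',0)$. $(Nf)(x)=C_n\int_{\mathbb R^{n-1}}\frac{f(y)}{(|x'-y|^2+x_n^2)^{(n-2)/2}}dy$, $C_n>0$. Weak Morrey spaces: with $f^*$ the decreasing rearrangement, $\|f\|_{L^{q\infty}(Q)}=\sup_tt^{1/q}f^*(t)$ and $\|f\|_{\mathcal M^{\lambda}_{q\infty}(\Omega)}:=\sup_{Q}|Q|^{\frac1\lambda-\frac1q}\|f\|_{L^{q\infty}(Q)}$ over $Q=B\cap\Omega$, $B$ a ball. $A^{1\infty}_{rq}$: functions $u$ on $\mathbb R^n_+$ with $\|u\|_{A^{1\infty}_{rq}}:=\|\,|\nabla u|\,\|_{\mathcal M^{\mu}_{r\infty}(\mathbb R^n_+)}+\|u|_0\|_{\mathcal M^{\lambda}_{q\infty}(\partial\mathbb R^n_+)}<\infty$; a mild solution is $u\in A^{1\infty}_{rq}$ with $u=Nf+N(V\,u|_0)+N(b|u|_0|^{\rho-1}u|_0)$. $\mathcal A$ is a set of maps of the form $T(x',x_n)=(T'x',x_n)$ with $T'\in O(n-1)$ (rotations about the $x_n$-axis). A function $g$ is symmetric (resp. antisymmetric) under $\mathcal A$ if $g(Tx)=g(x)$ (resp. $g(Tx)=-g(x)$) for all $T\in\mathcal A$; for functions on $\mathbb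 R^{n-1}$, $T$ acts through $T'$. *)

theory Defs
  imports "HOL-Analysis.Analysis"
begin

text \<open>Convention: R^{n-1} is real^'m (so n = CARD('m) + 1); a point of R^n is a pair
  (x', x_n) :: (real^'m) \<times> real.  Lebesgue measure and Euclidean balls on both spaces
  are the library's ones (the product metric on real^'m \<times> real is Euclidean).\<close>

definition half_space :: "((real^'m) \<times> real) set" where
  "half_space = {x. snd x > 0}"

text \<open>Decreasing rearrangement of f restricted to Q:
  f*(t) = inf { s \<ge> 0 : |{x \<in> Q. |f x| > s}| \<le> t }  (inf of the empty set = \<infinity>).\<close>
definition decr_rearr :: "('a::euclidean_space \<Rightarrow> real) \<Rightarrow> 'a set \<Rightarrow> real \<Rightarrow> ennreal" where
  "decr_rearr f Q t =
     Inf (ennreal ` {s. s \<ge> 0 \<and> emeasure lebesgue {x\<in>Q. \<bar>f x\<bar> > s} \<le> ennreal t})"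

definition weak_L_norm :: "real \<Rightarrow> ('a::euclidean_space \<Rightarrow> real) \<Rightarrow> 'a set \<Rightarrow> ennreal" where
  "weak_L_norm q f Q = (SUP t\<in>{0<..}. ennreal (t powr (1/q)) * decr_rearr f Q t)"

definition weak_morrey_norm ::
    "real \<Rightarrow> real \<Rightarrow> ('a::euclidean_space \<Rightarrow> real) \<Rightarrow> 'a set \<Rightarrow> ennreal" where
  "weak_morrey_norm lam q f \<Omega> =
     (SUP x. SUP R\<in>{0<..}.
        ennreal (measure lebesgue (ball x R \<inter> \<Omega>) powr (1/lam - 1/q))
        * weak_L_norm q f (ball x R \<inter> \<Omega>))"

definition trace0 :: "((real^'m) \<times> real \<Rightarrow> real) \<Rightarrow> real^'m \<Rightarrow> real" where
  "trace0 u x' = u (x', 0)"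

definition grad_norm :: "((real^'m) \<times> real \<Rightarrow> real) \<Rightarrow> (real^'m) \<times> real \<Rightarrow> real" where
  "grad_norm u x = onorm (frechet_derivative u (at x))"

definition A_norm :: "real \<Rightarrow> real \<Rightarrow> real \<Rightarrow> real \<Rightarrow> ((real^'m) \<times> real \<Rightarrow> real) \<Rightarrow> ennreal" where
  "A_norm mu lam r q u =
     weak_morrey_norm mu r (grad_norm u) half_space + weak_morrey_norm lam q (trace0 u) UNIV"

definition in_A :: "real \<Rightarrow> real \<Rightarrow> real \<Rightarrow> real \<Rightarrow> ((real^'m) \<times> real \<Rightarrow> real) \<Rightarrow> bool" where
  "in_A mu lam r q u \<longleftrightarrow>
     (\<forall>x\<in>half_space. u differentiable (at x)) \<and>
     set_borel_measurable lebesgue half_space (grad_norm u) \<and>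
     trace0 u \<in> borel_measurable lebesgue \<and>
     A_norm mu lam r q u < \<infinity>"

text \<open>Kernel of N: C_n (|x'-y|^2 + x_n^2)^{-(n-2)/2} with n - 2 = CARD('m) - 1.\<close>
definition N_kernel :: "real \<Rightarrow> (real^'m) \<times> real \<Rightarrow> real^'m \<Rightarrow> real" where
  "N_kernel C x y = C / ((norm (fst x - y))\<^sup>2 + (snd x)\<^sup>2) powr ((real CARD('m) - 1) / 2)"

definition N_op :: "real \<Rightarrow> (real^'m \<Rightarrow> real) \<Rightarrow> (real^'m) \<times> real \<Rightarrow> real" where
  "N_op C g x = (LINT y|lebesgue. N_kernel C x y * g y)"

definition N_integrable :: "real \<Rightarrow> (real^'m \<Rightarrow> real) \<Rightarrow> (real^'m) \<times> real \<Rightarrow> bool" where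
  "N_integrable C g x \<longleftrightarrow> integrable lebesgue (\<lambda>y. N_kernel C x y * g y)"

definition nonlin :: "real \<Rightarrow> (real^'m \<Rightarrow> real) \<Rightarrow> (real^'m \<Rightarrow> real) \<Rightarrow> real^'m \<Rightarrow> real" where
  "nonlin \<rho> b w y = b y * \<bar>w y\<bar> powr (\<rho> - 1) * w y"

definition mild_rhs ::
  "real \<Rightarrow> real \<Rightarrow> (real^'m \<Rightarrow> real) \<Rightarrow> (real^'m \<Rightarrow> real) \<Rightarrow> (real^'m \<Rightarrow> real)
     \<Rightarrow> ((real^'m) \<times> real \<Rightarrow> real) \<Rightarrow> (real^'m) \<times> real \<Rightarrow> real" where
  "mild_rhs C \<rho> f V b u x =
     N_op C f x + N_op C (\<lambda>y. V y * trace0 u y) x + N_op C (nonlin \<rho> b (trace0 u)) x"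

definition mild_solution ::
  "real \<Rightarrow> real \<Rightarrow> real \<Rightarrow> real \<Rightarrow> real \<Rightarrow> real \<Rightarrow> (real^'m \<Rightarrow> real) \<Rightarrow> (real^'m \<Rightarrow> real)
     \<Rightarrow> (real^'m \<Rightarrow> real) \<Rightarrow> ((real^'m) \<times> real \<Rightarrow> real) \<Rightarrow> bool" where
  "mild_solution mu lam r q C \<rho> f V b u \<longleftrightarrow>
     in_A mu lam r q u \<and>
     (\<forall>x\<in>half_space.
        N_integrable C f x \<and> N_integrable C (\<lambda>y. V y * trace0 u y) x \<and>
        N_integrable C (nonlin \<rho> b (trace0 u)) x \<and>
        u x = mild_rhs C \<rho> f V b u x) \<and>
     (AE x' in lebesgue. u (x', 0) = mild_rhs C \<rho> f V b u (x', 0))"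

text \<open>Picard iteration; index 0 is u_1 = N f.\<close>
fun picard ::
  "real \<Rightarrow> real \<Rightarrow> (real^'m \<Rightarrow> real) \<Rightarrow> (real^'m \<Rightarrow> real) \<Rightarrow> (real^'m \<Rightarrow> real)
     \<Rightarrow> nat \<Rightarrow> (real^'m) \<times> real \<Rightarrow> real" where
  "picard C \<rho> f V b 0 = N_op C f"
| "picard C \<rho> f V b (Suc k) = mild_rhs C \<rho> f V b (picard C \<rho> f V b k)"

text \<open>Symmetry under a set \<A> of maps T(x',x_n) = (T'x', x_n), T' \<in> O(n-1);
  we store the T'.\<close>
definition rot_family :: "(real^'m \<Rightarrow> real^'m) set \<Rightarrow> bool" where
  "rot_family \<A> \<longleftrightarrow> (\<forall>T\<in>\<A>. orthogonal_transformation T)"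

definition radial :: "(real^'m \<Rightarrow> real) \<Rightarrow> bool" where
  "radial g \<longleftrightarrow> (\<forall>y z. norm y = norm z \<longrightarrow> g y = g z)"

end

theory Submission
  imports Defs "HOL-Probability.Probability" "HOL-Real_Asymp.Real_Asymp"
begin

text \<open>Convergence in \<open>A_norm\<close> forces the traces of the Picard iterates to converge in measure on
  balls. Sign (for non-negative data) and symmetry are preserved by every iterate, hence hold for the
  trace of \<open>u\<close> almost everywhere, and the integral equation carries them into the half-space.

  For non-positive data this breaks down, since \<open>V u\<^sub>1 \<ge> 0\<close> and the iterates may change sign.
  Here \<open>- u\<close> is on the boundary a multiple of the potential \<open>U = |x|\<^sup>1\<^sup>-\<^sup>m * h\<close>, \<open>m = n - 1\<close>, of a density
  \<open>h\<close> that is non-negative wherever \<open>U < 0\<close>, and such a potential is non-negative. Indeed, if \<open>P\<^sub>s\<close> is the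
  Poisson semigroup, then \<open>U - P\<^sub>s U = c s h + o(s)\<close>, so that the negative part satisfies
  \<open>U\<^sup>- \<le> P\<^sub>s U\<^sup>- + o(s)\<close> (Kato). Iterating, \<open>U\<^sup>- \<le> P\<^sub>T U\<^sup>-\<close>, and
  \<open>P\<^sub>T U\<^sup>- \<le> P\<^sub>T (|x|\<^sup>1\<^sup>-\<^sup>m * |h|)\<close> tends to \<open>0\<close> as \<open>T\<close> grows.\<close>

section \<open>Subordination: Gaussians, the Poisson kernel and the potential kernel\<close>

text \<open>Up to a constant, |x|^(1-m) is the kernel of the inverse square root of -\<Delta> on
  R^m, so the claim about non-negative potentials is a maximum principle for that operator. The
  obstacle is regularity: h is only measurable with an absolutely convergent potential at every
  interior point, so a pointwise half-Laplacian or an energy argument with the negative part of U is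
  not directly at hand. The semigroup replaces the operator by a difference quotient whose error is
  small only in a weighted L^1 sense. Hence Kato's inequality is not iterated pointwise: it is
  integrated against a weight, P_s is moved onto the weight by symmetry, and only the weight
  evolves. This calls for weights that P_s merely shifts in time, and so for the exact identity P_s
  (pot t) = pot (s + t), down to the singular case t = 0. Subordination proves it and lets the
  normalising constant remain an unevaluated integral: mass one is read off from the same identity
  as t grows.\<close>

lemma exists_erf:
  obtains \<Phi> :: "real \<Rightarrow> real" where "\<And>z. (\<Phi> has_real_derivative exp (- z\<^sup>2)) (at z)" "\<Phi> 0 = 0"
    "(\<Phi> \<longlongrightarrow> sqrt pi / 2) at_top" "(\<Phi> \<longlongrightarrow> - (sqrt pi / 2)) at_bot"
proof -
  obtain F :: "real \<Rightarrow> real" where F: "\<And>z. (F has_real_derivative exp (- z\<^sup>2)) (at z)"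
    using einterval_antiderivative[of "-\<infinity>" \<infinity> "\<lambda>z::real. exp (- z\<^sup>2)"]
    by (auto simp: has_real_derivative_iff_has_vector_derivative)
  define \<Phi> where "\<Phi> z = F z - F 0" for z
  have D: "(\<Phi> has_real_derivative exp (- z\<^sup>2)) (at z)" for z
    unfolding \<Phi>_def by (auto intro!: derivative_eq_intros F)
  have top: "(\<Phi> \<longlongrightarrow> sqrt pi / 2) at_top"
  proof (rule Lim_transform_eventually)
    show "((\<lambda>z. \<integral>x. indicator {..z} x *\<^sub>R (indicator {0..} x *\<^sub>R exp (- x\<^sup>2)) \<partial>lborel) \<longlongrightarrow> sqrt pi / 2) at_top"
      by (rule tendsto_integral_at_top[OF sets_lborel
            has_bochner_integral_iff[THEN iffD1, THEN conjunct1, OF gaussian_moment_0],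
            unfolded has_bochner_integral_integral_eq[OF gaussian_moment_0]])
    show "\<forall>\<^sub>F z in at_top. (\<integral>x. indicator {..z} x *\<^sub>R (indicator {0..} x *\<^sub>R exp (- x\<^sup>2)) \<partial>lborel) = \<Phi> z"
      using eventually_ge_at_top[of 0]
    proof eventually_elim
      case (elim z)
      have "(\<integral>x. exp (- x\<^sup>2) * indicator {0..z} x \<partial>lborel) = \<Phi> z - \<Phi> 0"
        using elim by (intro integral_FTC_Icc_real D) auto
      moreover have "(\<integral>x. indicator {..z} x *\<^sub>R (indicator {0..} x *\<^sub>R exp (- x\<^sup>2)) \<partial>lborel)
         = (\<integral>x. exp (- x\<^sup>2) * indicator {0..z} x \<partial>lborel)"
        by (intro Bochner_Integration.integral_cong) (auto simp: indicator_def)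
      ultimately show ?case by (simp add: \<Phi>_def)
    qed
  qed
  have odd: "\<Phi> (- z) = - \<Phi> z" for z
  proof -
    have "((\<lambda>z. \<Phi> z + \<Phi> (- z)) has_real_derivative 0) (at z)" for z
      using DERIV_add[OF D[of z] DERIV_chain2[where f=\<Phi> and g=uminus, OF D[of "-z"] DERIV_minus[OF DERIV_ident]]]
      by simp
    then have "\<Phi> z + \<Phi> (- z) = \<Phi> 0 + \<Phi> (- 0)"
      by (rule DERIV_isconst_all[rule_format]) 
    then show ?thesis by (simp add: \<Phi>_def)
  qed
  have "((\<lambda>z. - \<Phi> z) \<longlongrightarrow> - (sqrt pi / 2)) at_top"
    by (intro tendsto_intros top)
  then have bot: "(\<Phi> \<longlongrightarrow> - (sqrt pi / 2)) at_bot"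
    by (simp add: filterlim_at_bot_mirror odd)
  show ?thesis using that[OF D _ top bot] by (simp add: \<Phi>_def)
qed

text \<open>The first-passage identity of Brownian motion: the passage density to level \<open>s\<close> convolved with
  the heat kernel at \<open>t\<close> is the heat kernel at \<open>s + t\<close>. With \<open>A, B = s R \<mp> t / R\<close>,
  \<open>R = sqrt ((c - a) / a)\<close>, an antiderivative in \<open>a\<close> is a combination of error functions.\<close>

lemma levy_convolution:
  fixes s t c :: real
  assumes s: "s > 0" and t: "t \<ge> 0" and c: "c > 0"
  shows "(\<integral>\<^sup>+a. ennreal (s * a powr (-3/2) * (c - a) powr (-1/2) * exp (- s\<^sup>2 / (4*a)) * exp (- t\<^sup>2 / (4*(c-a))))
            * indicator {0<..<c} a \<partial>lborel)
         = ennreal (2 * sqrt pi * c powr (-1/2) * exp (- (s+t)\<^sup>2 / (4*c)))"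
proof -
  obtain \<Phi> :: "real \<Rightarrow> real" where \<Phi>: "\<And>z. (\<Phi> has_real_derivative exp (- z\<^sup>2)) (at z)" "\<Phi> 0 = 0"
    "(\<Phi> \<longlongrightarrow> sqrt pi / 2) at_top" "(\<Phi> \<longlongrightarrow> - (sqrt pi / 2)) at_bot"
    using exists_erf by blast
  define f where "f a = s * a powr (-3/2) * (c - a) powr (-1/2) * exp (- s\<^sup>2 / (4*a)) * exp (- t\<^sup>2 / (4*(c-a)))" for a
  define R where "R a = sqrt ((c - a) / a)" for a
  define A where "A a = (s * R a - t / R a) / (2 * sqrt c)" for a
  define B where "B a = (s * R a + t / R a) / (2 * sqrt c)" for a
  define E where "E = exp (- (s+t)\<^sup>2 / (4*c))"
  define F where "F a = - (2 / sqrt c) * E * (\<Phi> (A a) + exp (s*t/c) * \<Phi> (B a))" for a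
  have R: "R a > 0" "(R a)\<^sup>2 = (c - a) / a" if "0 < a" "a < c" for a
    using that by (auto simp: R_def)
  have DR: "(R has_real_derivative - c / (a\<^sup>2 * (2 * R a))) (at a)" if a: "0 < a" "a < c" for a
    unfolding R_def using a
    by (auto intro!: derivative_eq_intros simp: field_simps power2_eq_square)
  have DF: "(F has_real_derivative f a) (at a)" if a: "0 < a" "a < c" for a
  proof -
    define r where "r = R a"
    have r: "r > 0" "r\<^sup>2 = (c - a) / a" using R[OF a] by (auto simp: r_def)
    define D where "D = - c / (a\<^sup>2 * (2 * r))"
    have DA: "(A has_real_derivative (s + t / r\<^sup>2) * D / (2 * sqrt c)) (at a)"
      unfolding A_def using r c DR[OF a] unfolding r_def[symmetric] D_def[symmetric]
      by (auto intro!: derivative_eq_intros simp: r_def[symmetric] field_simps power2_eq_square)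
    have DB: "(B has_real_derivative (s - t / r\<^sup>2) * D / (2 * sqrt c)) (at a)"
      unfolding B_def using r c DR[OF a] unfolding r_def[symmetric] D_def[symmetric]
      by (auto intro!: derivative_eq_intros simp: r_def[symmetric] field_simps power2_eq_square)
    have "(F has_real_derivative - (2 / sqrt c) * E *
        (exp (- (A a)\<^sup>2) * ((s + t / r\<^sup>2) * D / (2 * sqrt c)) +
         exp (s*t/c) * (exp (- (B a)\<^sup>2) * ((s - t / r\<^sup>2) * D / (2 * sqrt c))))) (at a)"
      unfolding F_def by (intro DERIV_cmult DERIV_add DERIV_chain2[OF \<Phi>(1)] DA DB)
    \<comment> \<open>\<open>B\<^sup>2 - A\<^sup>2 = s*t/c\<close>: the weight
      \<open>exp (s*t/c)\<close> in \<open>F\<close> is chosen so that both error functions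
      contribute the same Gaussian factor. The chain-rule terms with \<open>t / r\<^sup>2\<close>
      then cancel and only \<open>s\<close> survives.\<close>
    moreover have "exp (s*t/c) * exp (- (B a)\<^sup>2) = exp (- (A a)\<^sup>2)"
    proof -
      have A2: "(A a)\<^sup>2 = (s\<^sup>2 * r\<^sup>2 - 2 * s * t + t\<^sup>2 / r\<^sup>2) / (4 * c)"
        using r(1) c unfolding A_def r_def[symmetric] by (simp add: power_divide power_mult_distrib power2_diff)
      have B2: "(B a)\<^sup>2 = (s\<^sup>2 * r\<^sup>2 + 2 * s * t + t\<^sup>2 / r\<^sup>2) / (4 * c)"
        using r(1) c unfolding B_def r_def[symmetric] by (simp add: power_divide power_mult_distrib power2_sum)
      have "s*t/c - (B a)\<^sup>2 = - (A a)\<^sup>2"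
        unfolding A2 B2 using c by (simp add: add_divide_distrib diff_divide_distrib)
      then show ?thesis by (simp flip: exp_add)
    qed
    moreover have e: "E * exp (- (A a)\<^sup>2) = exp (- s\<^sup>2 / (4*a)) * exp (- t\<^sup>2 / (4*(c-a)))"
    proof -
      have "(A a)\<^sup>2 = (s\<^sup>2 * r\<^sup>2 - 2 * s * t + t\<^sup>2 / r\<^sup>2) / (4 * c)"
        using r(1) c unfolding A_def r_def[symmetric] by (simp add: power_divide power_mult_distrib power2_diff)
      also have "\<dots> = s\<^sup>2 / (4*a) + t\<^sup>2 / (4*(c-a)) - (s+t)\<^sup>2 / (4*c)"
        using a c unfolding r(2) by (simp add: divide_simps power2_eq_square) (simp add: algebra_simps)
      finally show ?thesis by (simp add: E_def flip: exp_add)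
    qed
    moreover have "- (2 / sqrt c) * (((s + t / r\<^sup>2) * D / (2 * sqrt c)) + ((s - t / r\<^sup>2) * D / (2 * sqrt c)))
        = s * a powr (-3/2) * (c - a) powr (-1/2)"
    proof -
      have "- (2 / sqrt c) * (((s + t / r\<^sup>2) * D / (2 * sqrt c)) + ((s - t / r\<^sup>2) * D / (2 * sqrt c)))
         = - 2 * s * D / (sqrt c * sqrt c)"
      proof -
        have "(s + x) * D / (2 * q) + (s - x) * D / (2 * q) = s * D / q" if "q > 0" for x q :: real
          using that by (simp add: field_simps)
        then show ?thesis using c by simp
      qed
      also have "\<dots> = s / (a\<^sup>2 * r)" using c r a by (simp add: D_def)
      also have "a\<^sup>2 * r = a powr (3/2) * (c - a) powr (1/2)"
      proof -
        have "a\<^sup>2 = a powr (3/2) * a powr (1/2)" using a by (simp flip: powr_add)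
        moreover have "r = (c - a) powr (1/2) / a powr (1/2)"
          using a by (simp add: r_def R_def real_sqrt_divide powr_half_sqrt)
        ultimately show ?thesis using a by simp
      qed
      finally show ?thesis by (simp add: powr_minus divide_simps)
    qed
    ultimately show ?thesis unfolding f_def 
      by (smt (verit, ccfv_SIG) ab_semigroup_mult_class.mult_ac(1) distrib_left mult.commute mult.left_commute)
  qed
  have lim0: "(F \<longlongrightarrow> - (2 / sqrt c) * E * (sqrt pi / 2 + exp (s*t/c) * (sqrt pi / 2))) (at_right 0)"
  proof -
    have "filterlim A at_top (at_right 0)" unfolding A_def R_def using s t c by real_asymp
    moreover have "filterlim B at_top (at_right 0)" unfolding B_def R_def using s t c by real_asymp
    ultimately show ?thesis unfolding F_def
      by (intro tendsto_intros filterlim_compose[OF \<Phi>(3)])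
  qed
  have limc: "(F \<longlongrightarrow> - (2 / sqrt c) * E * (- (sqrt pi / 2) + exp (s*t/c) * (sqrt pi / 2))) (at_left c)" if "t > 0"
  proof -
    have "filterlim A at_bot (at_left c)" unfolding A_def R_def using s that c by real_asymp
    moreover have "filterlim B at_top (at_left c)" unfolding B_def R_def using s that c by real_asymp
    ultimately show ?thesis unfolding F_def
      by (intro tendsto_intros filterlim_compose[OF \<Phi>(3)] filterlim_compose[OF \<Phi>(4)])
  qed
  \<comment> \<open>For \<open>t > 0\<close> the arguments \<open>A\<close> and \<open>B\<close> run
    to minus and plus infinity at \<open>c\<close>; for \<open>t = 0\<close> they coincide and tend
    to 0, where \<Phi> vanishes. This boundary case later covers the singular kernel
    \<open>pot 0\<close>.\<close>
  have limc0: "(F \<longlongrightarrow> - (2 / sqrt c) * E * (0 + exp (s*t/c) * 0)) (at_left c)" if "t = 0"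
  proof -
    have "(A \<longlongrightarrow> 0) (at_left c)" unfolding A_def R_def that using s c by real_asymp
    moreover have "(B \<longlongrightarrow> 0) (at_left c)" unfolding B_def R_def that using s c by real_asymp
    moreover have "isCont \<Phi> 0" using \<Phi>(1) DERIV_isCont by blast
    note *  = isCont_tendsto_compose[OF this, unfolded \<Phi>(2)]
    ultimately show ?thesis unfolding F_def
      by (intro tendsto_intros *)
  qed
  have "\<exists>L. (F \<longlongrightarrow> L) (at_left c) \<and> L - (- (2 / sqrt c) * E * (sqrt pi / 2 + exp (s*t/c) * (sqrt pi / 2)))
      = 2 * sqrt pi * c powr (-1/2) * E"
  proof (cases "t = 0")
    case True
    then show ?thesis using limc0 c
      by (intro exI[of _ "- (2 / sqrt c) * E * (0 + exp (s*t/c) * 0)"])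
         (simp add: powr_minus powr_half_sqrt field_simps)
  next
    case False
    then show ?thesis using limc t c
      by (intro exI[of _ "- (2 / sqrt c) * E * (- (sqrt pi / 2) + exp (s*t/c) * (sqrt pi / 2))"])
         (simp add: powr_minus powr_half_sqrt field_simps)
  qed
  then obtain L where L: "(F \<longlongrightarrow> L) (at_left c)"
    "L - (- (2 / sqrt c) * E * (sqrt pi / 2 + exp (s*t/c) * (sqrt pi / 2))) = 2 * sqrt pi * c powr (-1/2) * E" by blast
  have nn: "f a \<ge> 0" for a using s by (simp add: f_def)
  have cont: "isCont f a" if "0 < a" "a < c" for a
    unfolding f_def using that by (auto intro!: continuous_intros)
  have "set_integrable lborel (einterval 0 c) f"
    "(LBINT x=0..c. f x) = L - (- (2 / sqrt c) * E * (sqrt pi / 2 + exp (s*t/c) * (sqrt pi / 2)))"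
    using c DF nn cont lim0 L(1)
    by (intro interval_integral_FTC_nonneg; simp add: zero_ereal_def ereal_tendsto_simps del: ereal_eq_0)+
  then have "set_integrable lborel {0<..<c} f" "(LINT x:{0<..<c}|lborel. f x) = 2 * sqrt pi * c powr (-1/2) * E"
    using c L(2) by (auto simp: interval_lebesgue_integral_def zero_ereal_def)
  then have "(\<integral>\<^sup>+a. ennreal (indicator {0<..<c} a * f a) \<partial>lborel) = ennreal (2 * sqrt pi * c powr (-1/2) * E)"
    unfolding set_integrable_def set_lebesgue_integral_def using nn
    by (subst nn_integral_eq_integral) auto
  then show ?thesis
    unfolding E_def f_def[symmetric]
    by (simp add: ennreal_mult' nn ennreal_indicator mult.commute)
qed

section \<open>Affine changes of variables and Gaussian convolution\<close>

lemma nn_integral_lborel_shift: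
  fixes f :: "'a::euclidean_space \<Rightarrow> ennreal"
  assumes [measurable]: "f \<in> borel_measurable borel"
  shows "(\<integral>\<^sup>+y. f (c + y) \<partial>lborel) = (\<integral>\<^sup>+y. f y \<partial>lborel)"
  by (subst (2) lborel_distr_plus[of c, symmetric]) (simp add: nn_integral_distr)

lemma nn_integral_lborel_reflect:
  fixes f :: "'a::euclidean_space \<Rightarrow> ennreal"
  assumes [measurable]: "f \<in> borel_measurable borel"
  shows "(\<integral>\<^sup>+y. f (c - y) \<partial>lborel) = (\<integral>\<^sup>+y. f y \<partial>lborel)"
  by (subst (2) lborel_affine[of "-1" c]) (simp_all add: nn_integral_density nn_integral_distr)

lemma nn_integral_lborel_scale:
  fixes f :: "'a::euclidean_space \<Rightarrow> ennreal"
  assumes [measurable]: "f \<in> borel_measurable borel" and c: "c > 0"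
  shows "(\<integral>\<^sup>+y. f y \<partial>lborel) = ennreal (c ^ DIM('a)) * (\<integral>\<^sup>+y. f (c *\<^sub>R y) \<partial>lborel)"
  by (subst lborel_affine[of c 0]) (use c in \<open>simp_all add: nn_integral_density nn_integral_distr nn_integral_cmult\<close>)

lemma nn_integral_exp_norm_sq:
  assumes a: "a > 0"
  shows "(\<integral>\<^sup>+y. ennreal (exp (- (norm (y::'a::euclidean_space))\<^sup>2 / (4*a))) \<partial>lborel)
     = ennreal ((4 * pi * a) powr (DIM('a) / 2))"
proof -
  have 1: "(\<integral>\<^sup>+x. ennreal (exp (- x\<^sup>2 / (4*a))) \<partial>lborel) = ennreal (sqrt (4 * pi * a))"
  proof -
    have "(\<integral>\<^sup>+x. ennreal (normal_density 0 (sqrt (2 * a)) x) \<partial>lborel) = 1"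
      using a by (subst nn_integral_eq_integral) (auto simp: normal_density_nonneg)
    moreover have "normal_density 0 (sqrt (2 * a)) x = (1 / sqrt (4 * pi * a)) * exp (- x\<^sup>2 / (4*a))" for x
      using a by (simp add: normal_density_def mult_ac)
    ultimately have "ennreal (1 / sqrt (4 * pi * a)) * (\<integral>\<^sup>+x. ennreal (exp (- x\<^sup>2 / (4*a))) \<partial>lborel) = 1"
      using a by (subst nn_integral_cmult[symmetric]) (simp_all flip: ennreal_mult')
    then have "ennreal (sqrt (4 * pi * a)) * (ennreal (1 / sqrt (4 * pi * a)) * (\<integral>\<^sup>+x. ennreal (exp (- x\<^sup>2 / (4*a))) \<partial>lborel)) = ennreal (sqrt (4 * pi * a))"
      by simp
    then show ?thesis using a by (simp add: mult.assoc[symmetric] ennreal_mult'[symmetric])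
  qed
  have "exp (- (norm (y::'a))\<^sup>2 / (4*a)) = (\<Prod>b\<in>Basis. exp (- (y \<bullet> b)\<^sup>2 / (4*a)))" for y
  proof -
    have "(norm y)\<^sup>2 = (\<Sum>b\<in>Basis. (y \<bullet> b)\<^sup>2)"
      unfolding power2_norm_eq_inner by (subst euclidean_inner) (simp add: power2_eq_square)
    then show ?thesis by (simp add: exp_sum[symmetric] sum_negf sum_divide_distrib)
  qed
  then have "(\<integral>\<^sup>+y. ennreal (exp (- (norm (y::'a))\<^sup>2 / (4*a))) \<partial>lborel)
     = (\<integral>\<^sup>+y. (\<Prod>b\<in>Basis. ennreal (exp (- ((y::'a) \<bullet> b)\<^sup>2 / (4*a)))) \<partial>lborel)"
    by (simp add: prod_ennreal)
  also have "\<dots> = (\<Prod>b\<in>(Basis::'a set). \<integral>\<^sup>+x. ennreal (exp (- x\<^sup>2 / (4*a))) \<partial>lborel)"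
    by (intro nn_integral_lborel_prod) auto
  also have "\<dots> = ennreal (sqrt (4 * pi * a) ^ DIM('a))"
    unfolding 1 using a by (simp add: ennreal_power)
  also have "sqrt (4 * pi * a) ^ DIM('a) = (4 * pi * a) powr (DIM('a) / 2)"
    using a by (simp add: powr_half_sqrt[symmetric] powr_realpow[symmetric] powr_powr)
  finally show ?thesis .
qed

text \<open>The heat kernel at time \<open>a\<close> without its factor
  \<open>(4 * pi) powr (- DIM('a) / 2)\<close>. Dropping it lets the power of \<open>a\<close> merge
  with the powers in the subordination weights; the price is the constant in
  \<open>gauss_convolution\<close>.\<close>

definition gauss :: "real \<Rightarrow> 'a::euclidean_space \<Rightarrow> real" where
  "gauss a x = a powr (- (DIM('a) / 2)) * exp (- (norm x)\<^sup>2 / (4*a))"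

lemma gauss_measurable [measurable]:
  "(\<lambda>p. gauss (fst p) (snd p :: 'a::euclidean_space)) \<in> borel_measurable (borel \<Otimes>\<^sub>M borel)"
  unfolding gauss_def by measurable

lemma gauss_measurable' [measurable (raw)]:
  assumes "f \<in> borel_measurable M" "g \<in> borel_measurable M"
  shows "(\<lambda>x. gauss (f x) (g x :: 'a::euclidean_space)) \<in> borel_measurable M"
  using measurable_compose[OF measurable_Pair[OF assms] gauss_measurable] by simp

lemma gauss_nonneg [simp]: "gauss a x \<ge> 0"
  by (simp add: gauss_def)

lemma gauss_convolution:
  fixes x :: "'a::euclidean_space"
  assumes a: "a > 0" and b: "b > 0"
  shows "(\<integral>\<^sup>+y. ennreal (gauss a (x - y) * gauss b y) \<partial>lborel)
     = ennreal ((4 * pi) powr (DIM('a) / 2) * gauss (a + b) x)"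
proof -
  \<comment> \<open>Completing the square in \<open>y\<close>: the product of the two Gaussians is a
    Gaussian in \<open>y\<close> with time \<open>c\<close> and centre \<open>- z\<close>, times the
    Gaussian of time \<open>a + b\<close> in \<open>x\<close>.\<close>
  define c where "c = a * b / (a + b)"
  define z where "z = (- (b / (a + b))) *\<^sub>R x"
  let ?h = "real DIM('a) / 2"
  have c: "c > 0" using a b by (simp add: c_def)
  have e: "gauss a (x - y) * gauss b y
      = ((a*b) powr (- ?h) * exp (- (norm x)\<^sup>2 / (4*(a+b)))) * exp (- (norm (z + y))\<^sup>2 / (4*c))" for y
  proof -
    have "(norm (x - y))\<^sup>2 / (4*a) + (norm y)\<^sup>2 / (4*b) = (norm x)\<^sup>2 / (4*(a+b)) + (norm (z + y))\<^sup>2 / (4*c)"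
    proof -
      define X Y Z where "X = x \<bullet> x" "Y = y \<bullet> y" "Z = x \<bullet> y"
      define t where "t = b / (a + b)"
      have z: "z = (- t) *\<^sub>R x" by (simp add: z_def t_def)
      have 1: "(norm (x - y))\<^sup>2 = X - 2 * Z + Y" "(norm y)\<^sup>2 = Y" "(norm x)\<^sup>2 = X"
        "(norm (z + y))\<^sup>2 = t * t * X - 2 * t * Z + Y"
        by (simp_all add: power2_norm_eq_inner X_Y_Z_def z inner_diff inner_add inner_commute[of y x] algebra_simps)
      have t': "1 - t = a / (a + b)" using a b by (simp add: t_def field_simps)
      have 2: "b = t * (a + b)" "a = (1 - t) * (a + b)" "c = t * (1 - t) * (a + b)"
        unfolding t' using a b by (simp_all add: t_def c_def)
      have t: "t > 0" "1 - t > 0" "a + b > 0" using a b by (auto simp: t_def)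
      have "(X - 2 * Z + Y) / (4*((1 - t) * s)) + Y / (4*(t * s)) = X / (4 * s) + (t * t * X - 2 * t * Z + Y) / (4*(t * (1 - t) * s))"
        if "s > 0" for s
        using t that by (simp add: divide_simps) (simp add: algebra_simps)
      from this[OF t(3)] show ?thesis unfolding 1 2(1,2)[symmetric] 2(3)[symmetric] by simp
    qed
    then have "exp (- (norm (x - y))\<^sup>2 / (4*a)) * exp (- (norm y)\<^sup>2 / (4*b))
       = exp (- (norm x)\<^sup>2 / (4*(a+b))) * exp (- (norm (z + y))\<^sup>2 / (4*c))"
      by (simp flip: exp_add)
    then show ?thesis using a b by (simp add: gauss_def powr_mult mult_ac)
  qed
  have "(\<integral>\<^sup>+y. ennreal (gauss a (x - y) * gauss b y) \<partial>lborel)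
     = ennreal ((a*b) powr (- ?h) * exp (- (norm x)\<^sup>2 / (4*(a+b)))) * (\<integral>\<^sup>+y. ennreal (exp (- (norm (z + y))\<^sup>2 / (4*c))) \<partial>lborel)"
    unfolding e by (subst nn_integral_cmult[symmetric]) (auto simp: ennreal_mult')
  also have "(\<integral>\<^sup>+y. ennreal (exp (- (norm (z + y))\<^sup>2 / (4*c))) \<partial>lborel) = ennreal ((4 * pi * c) powr ?h)"
    by (subst nn_integral_lborel_shift[of "\<lambda>y. ennreal (exp (- (norm y)\<^sup>2 / (4*c)))"])
       (use nn_integral_exp_norm_sq[OF c, where 'a='a] in auto)
  also have "ennreal ((a*b) powr (- ?h) * exp (- (norm x)\<^sup>2 / (4*(a+b)))) * \<dots>
      = ennreal (((a*b) powr (- ?h) * (4 * pi * c) powr ?h) * exp (- (norm x)\<^sup>2 / (4*(a+b))))"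
    by (simp add: ennreal_mult'[symmetric] mult_ac)
  also have "(a*b) powr (- ?h) * (4 * pi * c) powr ?h = (4 * pi) powr ?h * (a + b) powr (- ?h)"
    using a b by (simp add: c_def powr_mult powr_divide powr_minus field_simps)
  finally show ?thesis by (simp add: gauss_def mult_ac)
qed

text \<open>An inverse gamma integral, left unevaluated: only its scaling behaviour matters.\<close>

definition inv_gamma :: "real \<Rightarrow> ennreal" where
  "inv_gamma k = (\<integral>\<^sup>+a. ennreal (a powr (- 1 - k) * exp (- 1 / (4*a))) * indicator {0<..} a \<partial>lborel)"

lemma inv_gamma_scale:
  assumes c: "c > 0"
  shows "(\<integral>\<^sup>+a. ennreal (a powr (- 1 - k) * exp (- c / (4*a))) * indicator {0<..} a \<partial>lborel)
     = ennreal (c powr (- k)) * inv_gamma k"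
proof -
  have "(\<integral>\<^sup>+a. ennreal (a powr (- 1 - k) * exp (- c / (4*a))) * indicator {0<..} a \<partial>lborel)
      = ennreal c * (\<integral>\<^sup>+a. ennreal ((c*a) powr (- 1 - k) * exp (- c / (4*(c*a)))) * indicator {0<..} (c*a) \<partial>lborel)"
    using c by (subst nn_integral_real_affine[of _ c 0]) auto
  also have "\<dots> = (\<integral>\<^sup>+a. ennreal (c powr (- k)) * (ennreal (a powr (- 1 - k) * exp (- 1 / (4*a))) * indicator {0<..} a) \<partial>lborel)"
  proof (subst nn_integral_cmult[symmetric], measurable, intro nn_integral_cong)
    fix a :: real
    show "ennreal c * (ennreal ((c*a) powr (- 1 - k) * exp (- c / (4*(c*a)))) * indicator {0<..} (c*a))
       = ennreal (c powr (- k)) * (ennreal (a powr (- 1 - k) * exp (- 1 / (4*a))) * indicator {0<..} a)"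
    proof (cases "a > 0")
      case True
      have "c * (c*a) powr (- 1 - k) = c powr (- k) * a powr (- 1 - k)"
        using c True by (simp add: powr_mult powr_diff powr_minus field_simps)
      then show ?thesis using c True
        by (simp add: ennreal_mult'[symmetric] mult.assoc[symmetric])
    qed (use c in \<open>simp add: indicator_def zero_less_mult_iff\<close>)
  qed
  also have "\<dots> = ennreal (c powr (- k)) * inv_gamma k"
    unfolding inv_gamma_def by (intro nn_integral_cmult) measurable
  finally show ?thesis .
qed

lemma inv_gamma_pos_finite:
  assumes k: "k > 0"
  obtains j where "j > 0" "inv_gamma k = ennreal j"
proof -
  have "inv_gamma k \<noteq> 0"
  proof
    assume "inv_gamma k = 0"
    then have "AE a in lborel. ennreal (a powr (- 1 - k) * exp (- 1 / (4*a))) * indicator {0<..} a = 0"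
      unfolding inv_gamma_def by (subst (asm) nn_integral_0_iff_AE) auto
    then have "AE a in lborel. (a::real) \<notin> {0<..<1}"
      by eventually_elim (auto simp: indicator_def)
    then have "{0<..<1::real} \<in> null_sets lborel"
      by (subst AE_iff_null_sets) auto
    then show False by (simp add: null_sets_def)
  qed
  moreover have "inv_gamma k < \<infinity>"
  proof -
    \<comment> \<open>\<open>M\<close> is the maximum of the integrand over \<open>a > 0\<close>,
      attained at \<open>a = 1 / (4 * (1 + k))\<close>, which is \<open>z = 1\<close> below. It
      controls the integral on \<open>(0, 1]\<close>; beyond 1 the exponential is at most 1 and
      \<open>k > 0\<close> makes the power integrable.\<close>
    define M where "M = exp ((1 + k) * (ln (4 * (1 + k)) - 1))"
    have M: "a powr (- 1 - k) * exp (- 1 / (4*a)) \<le> M" if a: "a > 0" for a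
    proof -
      define z where "z = 1 / a / (4 * (1 + k))"
      have z: "z > 0" using a k by (simp add: z_def)
      have "a powr (- 1 - k) * exp (- 1 / (4*a)) = exp ((- 1 - k) * ln a + (- 1 / (4*a)))"
        using a by (simp add: powr_def exp_add[symmetric])
      also have "(- 1 - k) * ln a + (- 1 / (4*a)) = (1 + k) * (ln (4 * (1 + k)) + (ln z - z))"
      proof -
        have "ln z = - ln a - ln (4 * (1 + k))"
          unfolding z_def using a k by (subst ln_div) (auto simp: ln_div)
        moreover have "(1 + k) * z = 1 / (4 * a)"
          unfolding z_def using a k by (simp add: divide_simps)
        ultimately show ?thesis by (simp add: algebra_simps)
      qed
      also have "\<dots> \<le> (1 + k) * (ln (4 * (1 + k)) - 1)"
        using ln_le_minus_one[OF z] k by (intro mult_left_mono) auto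
      finally show ?thesis by (simp add: M_def)
    qed
    have "inv_gamma k \<le> (\<integral>\<^sup>+a. ennreal M * indicator {0..1} a + ennreal (a powr (- 1 - k)) * indicator {1..} a \<partial>lborel)"
      unfolding inv_gamma_def
    proof (intro nn_integral_mono)
      fix a :: real
      show "ennreal (a powr (- 1 - k) * exp (- 1 / (4*a))) * indicator {0<..} a
        \<le> ennreal M * indicator {0..1} a + ennreal (a powr (- 1 - k)) * indicator {1..} a"
      proof (cases "a > 0")
        case True
        show ?thesis
        proof (cases "a \<le> 1")
          case True
          with \<open>a > 0\<close> M[of a] show ?thesis
            by (auto simp: indicator_def intro!: ennreal_leI add_increasing2)
        next
          case False
          then have "a powr (- 1 - k) * exp (- 1 / (4*a)) \<le> a powr (- 1 - k) * 1"
            by (intro mult_left_mono) auto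
          with False show ?thesis by (auto simp: indicator_def intro!: ennreal_leI)
        qed
      qed auto
    qed
    also have "\<dots> = ennreal M * emeasure lborel {0..1::real} + (\<integral>\<^sup>+a. ennreal (a powr (- 1 - k)) * indicator {1..} a \<partial>lborel)"
      by (subst nn_integral_add) (auto simp: nn_integral_cmult)
    also have "(\<integral>\<^sup>+a. ennreal (a powr (- 1 - k)) * indicator {1..} a \<partial>lborel) = ennreal (0 - (- (1 / k) * 1 powr (- k)))"
    proof (rule nn_integral_FTC_atLeast[where F = "\<lambda>a. - (1 / k) * a powr (- k)"])
      show "((\<lambda>a. - (1 / k) * a powr (- k)) has_real_derivative a powr (- 1 - k)) (at a)" if "1 \<le> a" for a
        using that k by (auto intro!: derivative_eq_intros simp: powr_diff powr_minus field_simps)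
      show "((\<lambda>a. - (1 / k) * a powr (- k)) \<longlongrightarrow> 0) at_top" using k by real_asymp
    qed auto
    finally show ?thesis using k by (auto simp: ennreal_mult_less_top intro: le_less_trans)
  qed
  ultimately show ?thesis
    using that[of "enn2real (inv_gamma k)"] by (auto simp: enn2real_positive_iff less_top[symmetric] zero_less_iff_neq_zero)
qed

text \<open>The kernel of \<open>N_op\<close> up to the factor \<open>C\<close>. At the singularity \<open>pot 0 0 = 0\<close>, because
  \<open>0 powr a = 0\<close>; this only affects a null set.\<close>

definition pot :: "real \<Rightarrow> 'a::euclidean_space \<Rightarrow> real" where
  "pot t x = ((norm x)\<^sup>2 + t\<^sup>2) powr (- ((DIM('a) - 1) / 2))"

text \<open>The constant that Gaussian subordination produces; it gives the Poisson kernel total mass one.\<close>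

definition poisson_const :: "nat \<Rightarrow> real" where
  "poisson_const m = enn2real (inv_gamma ((m + 1) / 2)) / ((4 * pi) powr (m / 2) * (2 * sqrt pi))"

definition poisson :: "real \<Rightarrow> 'a::euclidean_space \<Rightarrow> real" where
  "poisson t x = poisson_const DIM('a) * t * ((norm x)\<^sup>2 + t\<^sup>2) powr (- ((DIM('a) + 1) / 2))"

lemma poisson_const_pos: "poisson_const m > 0"
proof -
  have "(real m + 1) / 2 > 0" by simp
  then obtain j where "j > 0" "inv_gamma ((real m + 1) / 2) = ennreal j" by (rule inv_gamma_pos_finite)
  then show ?thesis by (simp add: poisson_const_def add.commute)
qed

lemma pot_nonneg [simp]: "pot t x \<ge> 0"
  by (simp add: pot_def)

lemma poisson_nonneg [simp]: "t \<ge> 0 \<Longrightarrow> poisson t x \<ge> 0"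
  using poisson_const_pos[of "DIM('a)"] by (simp add: poisson_def)

lemma pot_pos: "t > 0 \<Longrightarrow> pot t x > 0"
  by (simp add: pot_def add_nonneg_eq_0_iff)

lemma poisson_pos: "t > 0 \<Longrightarrow> poisson t (x::'a::euclidean_space) > 0"
  using poisson_const_pos[of "DIM('a)"] by (simp add: poisson_def add_nonneg_eq_0_iff)

lemma pot_even: "pot t (y - x) = pot t (x - y)"
  by (simp add: pot_def norm_minus_commute)

lemma poisson_even: "poisson t (y - x) = poisson t (x - y)"
  by (simp add: poisson_def norm_minus_commute)

lemma pot_measurable [measurable (raw)]:
  assumes [measurable]: "f \<in> borel_measurable M" "g \<in> borel_measurable M"
  shows "(\<lambda>x. pot (f x) (g x :: 'a::euclidean_space)) \<in> borel_measurable M"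
  unfolding pot_def by measurable

lemma poisson_measurable [measurable (raw)]:
  assumes [measurable]: "f \<in> borel_measurable M" "g \<in> borel_measurable M"
  shows "(\<lambda>x. poisson (f x) (g x :: 'a::euclidean_space)) \<in> borel_measurable M"
  unfolding poisson_def by measurable

section \<open>Gaussian subordination of the potential and Poisson kernels\<close>

lemma exp_gauss:
  "exp (- t\<^sup>2 / (4*a)) * gauss a (x::'a::euclidean_space)
     = a powr (- (DIM('a) / 2)) * exp (- ((norm x)\<^sup>2 + t\<^sup>2) / (4*a))"
proof -
  have "- ((norm x)\<^sup>2 + t\<^sup>2) / (4*a) = - t\<^sup>2 / (4*a) + (- (norm x)\<^sup>2 / (4*a))"
    by (simp add: add_divide_distrib diff_divide_distrib)
  then show ?thesis unfolding gauss_def by (simp only: exp_add mult_ac)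
qed

text \<open>The weight turns the heat kernel in \<open>x\<close> into a function of
  \<open>|x|\<^sup>2 + t\<^sup>2\<close>, so scaling \<open>a\<close> reduces everything to one
  inverse gamma integral. At the excluded point the left side is infinite while
  \<open>pot 0 0 = 0\<close>.\<close>

lemma pot_subordination:
  fixes x :: "'a::euclidean_space"
  assumes "(norm x)\<^sup>2 + t\<^sup>2 > 0"
  shows "(\<integral>\<^sup>+a. ennreal (a powr (- 1 / 2) * exp (- t\<^sup>2 / (4*a)) * gauss a x) * indicator {0<..} a \<partial>lborel)
    = inv_gamma ((DIM('a) - 1) / 2) * ennreal (pot t x)"
proof -
  have e: "a powr (- 1 / 2) * exp (- t\<^sup>2 / (4*a)) * gauss a x
      = a powr (- 1 - (DIM('a) - 1) / 2) * exp (- ((norm x)\<^sup>2 + t\<^sup>2) / (4*a))" for a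
  proof -
    have "a powr (- 1 / 2) * a powr (- (DIM('a) / 2)) = a powr (- 1 - (DIM('a) - 1) / 2)"
      by (simp add: powr_add[symmetric] of_nat_diff field_simps)
    then show ?thesis by (simp only: mult.assoc exp_gauss) (simp only: mult.assoc[symmetric])
  qed
  show ?thesis
    unfolding e inv_gamma_scale[OF assms] pot_def by (simp add: mult.commute)
qed

text \<open>The weight in \<open>a\<close> is the Brownian first-passage density to level
  \<open>s\<close>, up to the factor \<open>2 * sqrt pi\<close>. This factor and the one missing
  from \<open>gauss\<close> form the denominator of \<open>poisson_const\<close>.\<close>

lemma poisson_subordination:
  fixes x :: "'a::euclidean_space"
  assumes s: "s > 0"
  shows "(\<integral>\<^sup>+a. ennreal (s * a powr (- 3 / 2) * exp (- s\<^sup>2 / (4*a)) * gauss a x) * indicator {0<..} a \<partial>lborel)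
    = ennreal ((4 * pi) powr (DIM('a) / 2) * (2 * sqrt pi) * poisson s x)"
proof -
  have e: "s * a powr (- 3 / 2) * exp (- s\<^sup>2 / (4*a)) * gauss a x
      = s * (a powr (- 1 - (real DIM('a) + 1) / 2) * exp (- ((norm x)\<^sup>2 + s\<^sup>2) / (4*a)))" for a
  proof -
    have "a powr (- 3 / 2) * a powr (- (DIM('a) / 2)) = a powr (- 1 - (real DIM('a) + 1) / 2)"
      by (simp add: powr_add[symmetric] field_simps)
    then show ?thesis by (simp only: mult.assoc exp_gauss) (simp only: mult.assoc[symmetric])
  qed
  have pos: "(norm x)\<^sup>2 + s\<^sup>2 > 0" using s by (simp add: add_nonneg_pos)
  have "(real DIM('a) + 1) / 2 > 0" by simp
  then obtain j where j: "j > 0" "inv_gamma ((real DIM('a) + 1) / 2) = ennreal j" by (rule inv_gamma_pos_finite)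
  have "(\<integral>\<^sup>+a. ennreal (s * a powr (- 3 / 2) * exp (- s\<^sup>2 / (4*a)) * gauss a x) * indicator {0<..} a \<partial>lborel)
    = ennreal s * (\<integral>\<^sup>+a. ennreal (a powr (- 1 - (real DIM('a) + 1) / 2) * exp (- ((norm x)\<^sup>2 + s\<^sup>2) / (4*a))) * indicator {0<..} a \<partial>lborel)"
    unfolding e using s by (subst nn_integral_cmult[symmetric]) (auto simp: ennreal_mult' mult.assoc)
  also have "\<dots> = ennreal (s * ((norm x)\<^sup>2 + s\<^sup>2) powr (- ((real DIM('a) + 1) / 2)) * j)"
    unfolding inv_gamma_scale[OF pos] j(2) using s j by (simp add: ennreal_mult' mult.assoc)
  finally show ?thesis
    using j by (simp add: poisson_def poisson_const_def add.commute mult_ac)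
qed

text \<open>The Poisson semigroup acting on the potential kernels. Both kernels are superpositions of
  Gaussians, which reduces the claim to \<open>levy_convolution\<close>.\<close>

lemma poisson_conv_pot:
  fixes x :: "'a::euclidean_space"
  assumes dim: "DIM('a) \<ge> 2" and s: "s > 0" and t: "t \<ge> 0"
  shows "(\<integral>\<^sup>+y. ennreal (poisson s (x - y) * pot t y) \<partial>lborel) = ennreal (pot (s + t) x)"
proof -
  define G where "G a y = ennreal (gauss a (y::'a))" for a y
  define e where "e a = ennreal (s * a powr (- 3 / 2) * exp (- s\<^sup>2 / (4*a))) * indicator {0<..} a" for a
  define k where "k a = ennreal (a powr (- 1 / 2) * exp (- t\<^sup>2 / (4*a))) * indicator {0<..} a" for a
  define c where "c = (4 * pi) powr (DIM('a) / 2)"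
  have c: "c > 0" by (simp add: c_def)
  have [measurable]: "e \<in> borel_measurable borel" "k \<in> borel_measurable borel"
    unfolding e_def k_def by measurable
  have [measurable (raw)]: "(\<lambda>x. G (f x) (g x)) \<in> borel_measurable M"
    if "f \<in> borel_measurable M" "g \<in> borel_measurable M" for f g and M :: "'b measure"
    using that unfolding G_def by measurable
  have "(real DIM('a) - 1) / 2 > 0" using dim by simp
  then obtain j where j: "j > 0" "inv_gamma ((real DIM('a) - 1) / 2) = ennreal j" by (rule inv_gamma_pos_finite)
  have dm: "real (DIM('a) - 1) = real DIM('a) - 1" using dim by (simp add: of_nat_diff)
  have po: "ennreal (c * (2 * sqrt pi) * poisson s y) = (\<integral>\<^sup>+a. e a * G a y \<partial>lborel)" for y :: 'a
    unfolding c_def poisson_subordination[OF s, symmetric] e_def G_def using s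
    by (intro nn_integral_cong) (simp add: ennreal_mult' mult_ac)
  have pt: "ennreal (j * pot r y) = (\<integral>\<^sup>+a. ennreal (a powr (- 1 / 2) * exp (- r\<^sup>2 / (4*a))) * indicator {0<..} a * G a y \<partial>lborel)"
    if "(norm y)\<^sup>2 + r\<^sup>2 > 0" for y :: 'a and r
  proof -
    have "ennreal (j * pot r y) = inv_gamma (real (DIM('a) - 1) / 2) * ennreal (pot r y)"
      unfolding dm j using j by (simp add: ennreal_mult')
    also have "\<dots> = (\<integral>\<^sup>+a. ennreal (a powr (- 1 / 2) * exp (- r\<^sup>2 / (4*a))) * indicator {0<..} a * G a y \<partial>lborel)"
      unfolding pot_subordination[OF that, symmetric] G_def
      by (intro nn_integral_cong) (simp add: ennreal_mult' mult_ac)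
    finally show ?thesis .
  qed
  \<comment> \<open>Only almost everywhere: for \<open>t = 0\<close> and \<open>y = 0\<close> the
    Gaussian integral diverges, whereas \<open>pot 0 0 = 0\<close>.\<close>
  have ptk: "AE y in lborel. ennreal (j * pot t (y::'a)) = (\<integral>\<^sup>+b. k b * G b y \<partial>lborel)"
    using AE_lborel_singleton[of "0::'a"]
  proof eventually_elim
    case (elim y)
    then show ?case unfolding k_def by (intro pt add_pos_nonneg) auto
  qed
  have GG: "(\<integral>\<^sup>+y. G a (x - y) * G b y \<partial>lborel) = ennreal c * G (a + b) x" if "a > 0" "b > 0" for a b
    using gauss_convolution[OF that, of x] unfolding G_def c_def by (simp add: ennreal_mult')
  have ek: "(\<integral>\<^sup>+a. e a * k (g - a) \<partial>lborel) = ennreal (2 * sqrt pi) *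
      (ennreal (g powr (- 1 / 2) * exp (- (s + t)\<^sup>2 / (4*g))) * indicator {0<..} g)" for g
  proof (cases "g > 0")
    case True
    have "e a * k (g - a) = ennreal (s * a powr (-3/2) * (g - a) powr (-1/2) * exp (- s\<^sup>2 / (4*a)) * exp (- t\<^sup>2 / (4*(g-a))))
            * indicator {0<..<g} a" for a
      using s unfolding e_def k_def
      by (auto simp: indicator_def ennreal_mult'[symmetric] mult_ac)
    then show ?thesis using levy_convolution[OF s t True] True
      by (simp add: ennreal_mult'[symmetric] mult_ac)
  next
    case False
    then have "(\<integral>\<^sup>+a. e a * k (g - a) \<partial>lborel) = (\<integral>\<^sup>+a. 0 \<partial>(lborel :: real measure))"
      by (intro nn_integral_cong) (auto simp: e_def k_def indicator_def)
    then show ?thesis using False by simp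
  qed
  have "ennreal (c * (2 * sqrt pi) * j) * (\<integral>\<^sup>+y. ennreal (poisson s (x - y) * pot t y) \<partial>lborel)
     = (\<integral>\<^sup>+y. ennreal (c * (2 * sqrt pi) * poisson s (x - y)) * ennreal (j * pot t y) \<partial>lborel)"
    using c j s by (subst nn_integral_cmult[symmetric]) (auto simp: ennreal_mult'[symmetric] mult_ac)
  also have "\<dots> = (\<integral>\<^sup>+y. (\<integral>\<^sup>+a. e a * G a (x - y) \<partial>lborel) * (\<integral>\<^sup>+b. k b * G b y \<partial>lborel) \<partial>lborel)"
    using ptk by (intro nn_integral_cong_AE, eventually_elim) (simp add: po)
  also have "\<dots> = (\<integral>\<^sup>+y. (\<integral>\<^sup>+a. (\<integral>\<^sup>+b. e a * G a (x - y) * (k b * G b y) \<partial>lborel) \<partial>lborel) \<partial>lborel)"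
    by (simp add: nn_integral_cmult nn_integral_multc)
  also have "\<dots> = (\<integral>\<^sup>+a. (\<integral>\<^sup>+y. (\<integral>\<^sup>+b. e a * G a (x - y) * (k b * G b y) \<partial>lborel) \<partial>lborel) \<partial>lborel)"
    by (intro lborel_pair.Fubini') measurable
  also have "\<dots> = (\<integral>\<^sup>+a. (\<integral>\<^sup>+b. (\<integral>\<^sup>+y. e a * G a (x - y) * (k b * G b y) \<partial>lborel) \<partial>lborel) \<partial>lborel)"
    by (intro nn_integral_cong lborel_pair.Fubini') measurable
  also have "\<dots> = (\<integral>\<^sup>+a. (\<integral>\<^sup>+b. e a * (k b * (ennreal c * G (a + b) x)) \<partial>lborel) \<partial>lborel)"
  proof (intro nn_integral_cong)
    fix a b :: real
    have "(\<integral>\<^sup>+y. e a * G a (x - y) * (k b * G b y) \<partial>lborel) = e a * (k b * (\<integral>\<^sup>+y. G a (x - y) * G b y \<partial>lborel))"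
      by (subst nn_integral_cmult[symmetric], measurable)+ (simp add: mult_ac)
    also have "\<dots> = e a * (k b * (ennreal c * G (a + b) x))"
      using GG[of a b] by (cases "a > 0"; cases "b > 0") (auto simp: e_def k_def)
    finally show "(\<integral>\<^sup>+y. e a * G a (x - y) * (k b * G b y) \<partial>lborel) = e a * (k b * (ennreal c * G (a + b) x))" .
  qed
  \<comment> \<open>The new variable \<open>g = a + b\<close> is the total Gaussian time. What
    remains in \<open>a\<close> is the one-dimensional convolution of the two weights, evaluated in
    \<open>ek\<close>.\<close>
  also have "\<dots> = (\<integral>\<^sup>+a. (\<integral>\<^sup>+g. e a * (k (g - a) * (ennreal c * G g x)) \<partial>lborel) \<partial>lborel)"
  proof (rule nn_integral_cong)
    fix a :: real
    show "(\<integral>\<^sup>+b. e a * (k b * (ennreal c * G (a + b) x)) \<partial>lborel) = (\<integral>\<^sup>+g. e a * (k (g - a) * (ennreal c * G g x)) \<partial>lborel)"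
      by (subst nn_integral_lborel_shift[of "\<lambda>g. e a * (k (g - a) * (ennreal c * G g x))" a, symmetric]) auto
  qed
  also have "\<dots> = (\<integral>\<^sup>+g. (\<integral>\<^sup>+a. e a * (k (g - a) * (ennreal c * G g x)) \<partial>lborel) \<partial>lborel)"
    by (intro lborel_pair.Fubini') measurable
  also have "\<dots> = (\<integral>\<^sup>+g. ennreal c * G g x * (\<integral>\<^sup>+a. e a * k (g - a) \<partial>lborel) \<partial>lborel)"
    by (subst nn_integral_cmult[symmetric], measurable) (simp add: mult_ac)
  also have "\<dots> = ennreal (c * (2 * sqrt pi)) * (\<integral>\<^sup>+g. ennreal (g powr (- 1 / 2) * exp (- (s + t)\<^sup>2 / (4*g))) * indicator {0<..} g * G g x \<partial>lborel)"
    unfolding ek using c by (subst nn_integral_cmult[symmetric]) (auto simp: ennreal_mult' mult_ac)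
  also have "\<dots> = ennreal (c * (2 * sqrt pi) * j) * ennreal (pot (s + t) x)"
    using c j s t by (subst pt[symmetric]) (auto simp: ennreal_mult'[symmetric] add_nonneg_pos mult_ac)
  finally show ?thesis
    using c j by (subst (asm) ennreal_mult_cancel_left) auto
qed

section \<open>Total mass, scaling and time derivative of the kernels\<close>

text \<open>The constant is not computed. The quotients \<open>pot n y / pot n 0\<close> increase to
  1 as \<open>n\<close> grows, and by \<open>poisson_conv_pot\<close> at the origin the Poisson
  integral of this quotient is \<open>pot (s + n) 0 / pot n 0\<close>, which tends to 1.\<close>

lemma nn_integral_poisson:
  assumes dim: "DIM('a::euclidean_space) \<ge> 2" and s: "s > 0"
  shows "(\<integral>\<^sup>+y. ennreal (poisson s (y::'a)) \<partial>lborel) = 1"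
proof -
  define k where "k = (real DIM('a) - 1) / 2"
  have k: "k > 0" "(DIM('a) - 1) / 2 = k" using dim by (auto simp: k_def of_nat_diff)
  define f where "f n y = poisson s (y::'a) * ((norm y / Suc n)\<^sup>2 + 1) powr (- k)" for n :: nat and y
  have f: "f n y = poisson s y * pot (Suc n) y / ((Suc n)\<^sup>2) powr (- k)" for n y
  proof -
    have "(norm y)\<^sup>2 + (Suc n)\<^sup>2 = (Suc n)\<^sup>2 * ((norm y / Suc n)\<^sup>2 + 1)"
      by (simp add: power_divide field_simps)
    then show ?thesis unfolding f_def pot_def k(2) by (simp add: powr_mult del: of_nat_Suc)
  qed
  have lim: "(\<lambda>n. \<integral>\<^sup>+y. ennreal (f n y) \<partial>lborel) \<longlonglongrightarrow> (\<integral>\<^sup>+y. ennreal (poisson s (y::'a)) \<partial>lborel)"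
  proof (rule nn_integral_LIMSEQ)
    show "incseq (\<lambda>n y. ennreal (f n y))"
    proof (intro incseq_SucI le_funI ennreal_leI)
      fix n and y :: 'a
      have "norm y / Suc (Suc n) \<le> norm y / Suc n" by (intro divide_left_mono) auto
      then have "((norm y / Suc n)\<^sup>2 + 1) powr (- k) \<le> ((norm y / Suc (Suc n))\<^sup>2 + 1) powr (- k)"
        using k by (intro powr_mono2') (auto intro!: add_mono power_mono add_nonneg_pos simp del: of_nat_Suc)
      then show "f n y \<le> f (Suc n) y"
        unfolding f_def using s by (intro mult_left_mono) auto
    qed
    show "(\<lambda>n. ennreal (f n y)) \<longlonglongrightarrow> ennreal (poisson s y)" for y :: 'a
    proof -
      have "(\<lambda>n. norm y / Suc n) \<longlonglongrightarrow> 0"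
        by (intro tendsto_divide_0[OF tendsto_const] filterlim_at_top_imp_at_infinity
            filterlim_compose[OF filterlim_real_sequentially filterlim_Suc])
      then have "(\<lambda>n. poisson s y * ((norm y / Suc n)\<^sup>2 + 1) powr (- k)) \<longlonglongrightarrow> poisson s y * (0\<^sup>2 + 1) powr (- k)"
        by (intro tendsto_intros) auto
      then show ?thesis by (simp add: f_def tendsto_ennrealI)
    qed
    show "(\<lambda>y. ennreal (f n y)) \<in> borel_measurable lborel" for n
      unfolding f_def by measurable
  qed
  have p0: "pot r (0::'a) = (r\<^sup>2) powr (- k)" for r
    unfolding pot_def k(2) by simp
  have int: "(\<integral>\<^sup>+y. ennreal (f n y) \<partial>lborel) = ennreal (((s + Suc n)\<^sup>2 / (Suc n)\<^sup>2) powr (- k))" for n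
  proof -
    have "(\<integral>\<^sup>+y. ennreal (f n y) \<partial>lborel)
       = ennreal (inverse (((Suc n)\<^sup>2) powr (- k))) * (\<integral>\<^sup>+y. ennreal (poisson s (0 - y) * pot (Suc n) (y::'a)) \<partial>lborel)"
    proof (subst nn_integral_cmult[symmetric])
      show "(\<integral>\<^sup>+y. ennreal (f n y) \<partial>lborel) = (\<integral>\<^sup>+y. ennreal (inverse (((Suc n)\<^sup>2) powr (- k)))
          * ennreal (poisson s (0 - y) * pot (Suc n) (y::'a)) \<partial>lborel)"
        by (intro nn_integral_cong, subst ennreal_mult'[symmetric])
           (auto simp: f divide_inverse poisson_even[of s 0, simplified] mult_ac simp del: of_nat_Suc)
    qed measurable
    also have "\<dots> = ennreal (inverse (((Suc n)\<^sup>2) powr (- k)) * ((s + Suc n)\<^sup>2) powr (- k))"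
      using s by (subst poisson_conv_pot[OF dim]) (auto simp: p0 ennreal_mult'[symmetric] simp del: of_nat_Suc)
    finally show ?thesis using s by (simp add: powr_divide field_simps del: of_nat_Suc)
  qed
  have "(\<lambda>n. ennreal (((s + Suc n)\<^sup>2 / (Suc n)\<^sup>2) powr (- k))) \<longlonglongrightarrow> ennreal 1"
    using s k by (intro tendsto_ennrealI) real_asymp
  then show ?thesis using LIMSEQ_unique[OF lim[unfolded int]] by simp
qed

lemma poisson_scale:
  assumes t: "t > 0"
  shows "poisson t (t *\<^sub>R y) = poisson 1 (y::'a::euclidean_space) / t ^ DIM('a)"
proof -
  have "(norm (t *\<^sub>R y))\<^sup>2 + t\<^sup>2 = t\<^sup>2 * ((norm y)\<^sup>2 + 1\<^sup>2)"
    using t by (simp add: power_mult_distrib algebra_simps)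
  moreover have "(t\<^sup>2) powr (- ((real DIM('a) + 1) / 2)) = 1 / (t * t ^ DIM('a))"
  proof -
    have "(t\<^sup>2) powr (- ((real DIM('a) + 1) / 2)) = t powr (- (real (DIM('a) + 1)))"
    proof -
      have "t\<^sup>2 = t powr 2" using t by simp
      then show ?thesis by (simp only: powr_powr) (rule arg_cong[where f = "\<lambda>z. t powr z"], simp add: field_simps)
    qed
    also have "\<dots> = inverse (t ^ (DIM('a) + 1))"
      unfolding powr_minus powr_realpow[OF t] ..
    finally show ?thesis by (simp add: inverse_eq_divide)
  qed
  ultimately show ?thesis using t unfolding poisson_def
    by (simp add: powr_mult add.commute[of "real DIM('a)" 1])
qed

text \<open>Differentiating \<open>pot t\<close> in time produces the factor \<open>m - 1\<close>
  and the unnormalised Poisson kernel; dividing by \<open>poisson_const\<close> compensates for the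
  normalisation of \<open>poisson\<close>.\<close>

definition pot_rate :: "nat \<Rightarrow> real" where
  "pot_rate m = (real m - 1) / poisson_const m"

lemma pot_has_derivative:
  fixes x :: "'a::euclidean_space"
  assumes dim: "DIM('a) \<ge> 2" and x: "x \<noteq> 0 \<or> t > 0"
  shows "((\<lambda>t. pot t x) has_real_derivative - (pot_rate DIM('a) * poisson t x)) (at t)"
proof -
  have pos: "(norm x)\<^sup>2 + t\<^sup>2 > 0" using x by (auto intro: add_pos_nonneg add_nonneg_pos)
  have dm: "real (DIM('a) - 1) = real DIM('a) - 1" using dim by (simp add: of_nat_diff)
  have "((\<lambda>t. pot t x) has_real_derivative
     (- ((real DIM('a) - 1) / 2)) * ((norm x)\<^sup>2 + t\<^sup>2) powr (- ((real DIM('a) - 1) / 2) - 1) * (2 * t)) (at t)"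
    unfolding pot_def dm using pos
    by (auto intro!: derivative_eq_intros simp: powr_diff field_simps)
  also have "- ((real DIM('a) - 1) / 2) - 1 = - ((real DIM('a) + 1) / 2)" by (simp add: field_simps)
  finally show ?thesis using poisson_const_pos[of "DIM('a)"]
    by (simp add: pot_rate_def poisson_def add.commute mult_ac)
qed

lemma pot_rate_nonneg [simp]: "m \<ge> 1 \<Longrightarrow> pot_rate m \<ge> 0"
  using poisson_const_pos[of m] by (simp add: pot_rate_def)

lemma pot_rate_pos: "m \<ge> 2 \<Longrightarrow> pot_rate m > 0"
  using poisson_const_pos[of m] by (simp add: pot_rate_def)

text \<open>Integrated form of the fact that the potential inverts the generator: it lets
  \<open>U - P\<^sub>s U\<close> be read as a constant times the integral of
  \<open>P\<^sub>t h\<close> over \<open>t\<close> in \<open>[0, s]\<close>.\<close>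

lemma nn_integral_poisson_time:
  fixes x :: "'a::euclidean_space"
  assumes dim: "DIM('a) \<ge> 2" and x: "x \<noteq> 0 \<or> a > 0" and a: "0 \<le> a" "a \<le> b"
  shows "(\<integral>\<^sup>+t. ennreal (pot_rate DIM('a) * poisson t x) * indicator {a..b} t \<partial>lborel) = ennreal (pot a x - pot b x)"
proof -
  have "(\<integral>\<^sup>+t. ennreal (pot_rate DIM('a) * poisson t x) * indicator {a..b} t \<partial>lborel) = ennreal (- pot b x - (- pot a x))"
  proof (rule nn_integral_FTC_Icc[where F = "\<lambda>t. - pot t x"])
    show "((\<lambda>t. - pot t x) has_real_derivative pot_rate DIM('a) * poisson t x) (at t)"
      if "t \<in> {a..b}" for t
      using DERIV_minus[OF pot_has_derivative[OF dim, of x t]] x that by auto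
    show "0 \<le> pot_rate DIM('a) * poisson t x" if "t \<in> {a..b}" for t
      using that a dim by simp
  qed (use a in auto)
  then show ?thesis by simp
qed

lemma pot_antimono:
  fixes x :: "'a::euclidean_space"
  assumes x: "x \<noteq> 0 \<or> a > 0" and a: "0 \<le> a" "a \<le> b"
  shows "pot b x \<le> pot a x"
proof -
  have "0 < (norm x)\<^sup>2 + a\<^sup>2" using x by (auto intro: add_pos_nonneg add_nonneg_pos)
  moreover have "a\<^sup>2 \<le> b\<^sup>2" using a by (intro power_mono) auto
  ultimately show ?thesis unfolding pot_def by (intro powr_mono2') auto
qed

lemma pot_strict_antimono:
  fixes x :: "'a::euclidean_space"
  assumes dim: "DIM('a) \<ge> 2" and a: "0 < a" "a < b"
  shows "pot b x < pot a x"
proof -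
  have "0 < (norm x)\<^sup>2 + a\<^sup>2" using a by (auto intro: add_nonneg_pos)
  moreover have "a\<^sup>2 < b\<^sup>2" using a by (intro power_strict_mono) auto
  ultimately show ?thesis unfolding pot_def using dim by (intro powr_less_mono2_neg) auto
qed

lemma poisson_le_pot:
  fixes x :: "'a::euclidean_space"
  assumes dim: "DIM('a) \<ge> 2" and t: "t \<ge> 1"
  shows "poisson t x \<le> poisson_const DIM('a) * t * pot 1 x"
proof -
  have "1 \<le> t\<^sup>2" using t by simp
  then have 1: "(norm x)\<^sup>2 + t\<^sup>2 \<ge> (norm x)\<^sup>2 + 1" "(norm x)\<^sup>2 + (1::real) \<ge> 1" by auto
  have "((norm x)\<^sup>2 + t\<^sup>2) powr (- ((real DIM('a) + 1) / 2)) \<le> ((norm x)\<^sup>2 + 1) powr (- ((real DIM('a) + 1) / 2))"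
    using 1 by (intro powr_mono2') (auto intro: add_nonneg_pos)
  also have "\<dots> \<le> ((norm x)\<^sup>2 + 1) powr (- ((real (DIM('a) - 1)) / 2))"
    using 1 dim by (intro powr_mono) (auto simp: of_nat_diff)
  finally show ?thesis unfolding poisson_def pot_def using t poisson_const_pos[of "DIM('a)"]
    by (auto intro!: mult_left_mono simp: add.commute)
qed

lemma poisson_le_poisson:
  fixes x :: "'a::euclidean_space"
  assumes t: "t > 0" "t \<le> t'" "t' \<le> c * t"
  shows "poisson t' x \<le> c * poisson t x"
proof -
  have "((norm x)\<^sup>2 + t'\<^sup>2) powr (- ((real DIM('a) + 1) / 2)) \<le> ((norm x)\<^sup>2 + t\<^sup>2) powr (- ((real DIM('a) + 1) / 2))"
    using t by (intro powr_mono2') (auto intro!: add_mono power_mono add_nonneg_pos)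
  then have "t' * ((norm x)\<^sup>2 + t'\<^sup>2) powr (- ((real DIM('a) + 1) / 2))
     \<le> (c * t) * ((norm x)\<^sup>2 + t\<^sup>2) powr (- ((real DIM('a) + 1) / 2))"
    using t by (intro mult_mono) auto
  then show ?thesis unfolding poisson_def using poisson_const_pos[of "DIM('a)"]
    by (simp add: add.commute mult_ac)
qed

text \<open>A time integral of Poisson kernels over \<open>[t, t + 1]\<close>. As a weight it is shifted in \<open>t\<close> by the
  Poisson semigroup, like \<open>pot t\<close>, but unlike \<open>pot t\<close> it can be integrated against potentials.\<close>

definition pot_slab :: "real \<Rightarrow> 'a::euclidean_space \<Rightarrow> real" where
  "pot_slab t x = pot t x - pot (t + 1) x"

lemma pot_slab_measurable [measurable (raw)]:
  assumes [measurable]: "f \<in> borel_measurable M" "g \<in> borel_measurable M"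
  shows "(\<lambda>x. pot_slab (f x) (g x :: 'a::euclidean_space)) \<in> borel_measurable M"
  unfolding pot_slab_def by measurable

lemma pot_slab_pos:
  assumes "DIM('a::euclidean_space) \<ge> 2" "t > 0"
  shows "pot_slab t (x::'a) > 0"
  unfolding pot_slab_def using pot_strict_antimono[OF assms, of "t + 1" x] by simp

lemma pot_slab_le_poisson:
  fixes x :: "'a::euclidean_space"
  assumes dim: "DIM('a) \<ge> 2" and t: "t \<ge> 1"
  shows "pot_slab t x \<le> 2 * pot_rate DIM('a) * poisson t x"
proof -
  have "\<exists>z>t. z < t + 1 \<and> pot (t + 1) x - pot t x = (t + 1 - t) * - (pot_rate DIM('a) * poisson z x)"
    using t by (intro MVT2 pot_has_derivative[OF dim]) auto
  then obtain z where z: "z > t" "z < t + 1" "pot_slab t x = pot_rate DIM('a) * poisson z x"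
    by (auto simp: pot_slab_def)
  \<comment> \<open>\<open>z < t + 1\<close> and \<open>t + 1 \<le> 2 * t\<close> because
    \<open>t \<ge> 1\<close>; this is the origin of the factor 2.\<close>
  have "poisson z x \<le> 2 * poisson t x" using z t by (intro poisson_le_poisson) auto
  then show ?thesis using z(3) dim mult_left_mono[of _ _ "pot_rate DIM('a)"] by fastforce
qed

lemma poisson_conv_pot_slab:
  fixes x :: "'a::euclidean_space"
  assumes dim: "DIM('a) \<ge> 2" and s: "s > 0" and t: "t > 0"
  shows "(\<integral>\<^sup>+y. ennreal (poisson s (x - y) * pot_slab t y) \<partial>lborel) = ennreal (pot_slab (s + t) x)"
proof -
  have "(\<integral>\<^sup>+y. ennreal (poisson s (x - y) * pot_slab t y) \<partial>lborel)
      = (\<integral>\<^sup>+y. ennreal (poisson s (x - y) * pot t y) - ennreal (poisson s (x - y) * pot (t + 1) y) \<partial>lborel)"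
    using s by (intro nn_integral_cong, subst ennreal_minus) (auto simp: pot_slab_def algebra_simps)
  also have "\<dots> = (\<integral>\<^sup>+y. ennreal (poisson s (x - y) * pot t y) \<partial>lborel) - (\<integral>\<^sup>+y. ennreal (poisson s (x - y) * pot (t + 1) y) \<partial>lborel)"
  proof (rule nn_integral_diff)
    show "AE y in lborel. ennreal (poisson s (x - y) * pot (t + 1) y) \<le> ennreal (poisson s (x - y) * pot t y)"
      using s t dim by (intro AE_I2 ennreal_leI mult_left_mono pot_antimono) auto
  qed (use poisson_conv_pot[OF dim s, of "t + 1" x] t in auto)
  also have "\<dots> = ennreal (pot_slab (s + t) x)"
    using t by (simp add: poisson_conv_pot[OF dim s] pot_slab_def ennreal_minus add.assoc)
  finally show ?thesis .
qed

section \<open>The Poisson kernel as an approximate identity\<close>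

text \<open>Dominates the L^1 distance between \<open>P\<^sub>t h\<close> and \<open>h\<close> for
  the probability weight \<open>poisson 1\<close>. The absolute value stays inside the
  \<open>y\<close>-integral, so that all later interchanges of integrals concern non-negative
  functions.\<close>

definition poisson_defect :: "real \<Rightarrow> ('a::euclidean_space \<Rightarrow> real) \<Rightarrow> ennreal" where
  "poisson_defect t h = (\<integral>\<^sup>+x. ennreal (poisson 1 x) *
      (\<integral>\<^sup>+y. ennreal (poisson t (x - y)) * ennreal \<bar>h y - h x\<bar> \<partial>lborel) \<partial>lborel)"

lemma nn_integral_poisson_shift:
  fixes x :: "'a::euclidean_space"
  assumes dim: "DIM('a) \<ge> 2" and s: "s > 0"
  shows "(\<integral>\<^sup>+y. ennreal (poisson s (x - y)) \<partial>lborel) = 1"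
  using nn_integral_lborel_reflect[of "\<lambda>y. ennreal (poisson s y)" x] nn_integral_poisson[OF dim s] by simp

text \<open>Moves \<open>t\<close> from the kernel into the argument of \<open>h\<close>; dominated
  convergence can then work with one fixed kernel as \<open>t\<close> tends to 0.\<close>

lemma poisson_defect_rescale:
  fixes h :: "'a::euclidean_space \<Rightarrow> real"
  assumes [measurable]: "h \<in> borel_measurable borel" and t: "t > 0"
  shows "poisson_defect t h = (\<integral>\<^sup>+x. ennreal (poisson 1 x) *
      (\<integral>\<^sup>+y. ennreal (poisson 1 y) * ennreal \<bar>h (x - t *\<^sub>R y) - h x\<bar> \<partial>lborel) \<partial>lborel)"
proof -
  have "(\<integral>\<^sup>+y. ennreal (poisson t (x - y)) * ennreal \<bar>h y - h x\<bar> \<partial>lborel)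
     = (\<integral>\<^sup>+y. ennreal (poisson 1 y) * ennreal \<bar>h (x - t *\<^sub>R y) - h x\<bar> \<partial>lborel)" for x :: 'a
  proof -
    have "(\<integral>\<^sup>+y. ennreal (poisson t (x - y)) * ennreal \<bar>h y - h x\<bar> \<partial>lborel)
      = (\<integral>\<^sup>+y. ennreal (poisson t y) * ennreal \<bar>h (x - y) - h x\<bar> \<partial>lborel)"
      by (subst nn_integral_lborel_reflect[of _ x, symmetric]) auto
    also have "\<dots> = ennreal (t ^ DIM('a)) * (\<integral>\<^sup>+y. ennreal (poisson t (t *\<^sub>R y)) * ennreal \<bar>h (x - t *\<^sub>R y) - h x\<bar> \<partial>lborel)"
      by (rule nn_integral_lborel_scale) (use t in auto)
    also have "\<dots> = (\<integral>\<^sup>+y. ennreal (poisson 1 y) * ennreal \<bar>h (x - t *\<^sub>R y) - h x\<bar> \<partial>lborel)"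
      using t by (subst nn_integral_cmult[symmetric])
        (auto simp: poisson_scale ennreal_mult'[symmetric] mult.assoc[symmetric])
    finally show ?thesis .
  qed
  then show ?thesis unfolding poisson_defect_def by simp
qed

text \<open>The difference of values is at most \<open>2 * M\<close> and both kernels are
  probability densities, so dominated convergence applies first in \<open>y\<close> and then in
  \<open>x\<close>.\<close>

lemma poisson_defect_continuous:
  fixes h :: "'a::euclidean_space \<Rightarrow> real" and t :: "nat \<Rightarrow> real"
  assumes dim: "DIM('a) \<ge> 2" and h: "continuous_on UNIV h" "\<And>x. \<bar>h x\<bar> \<le> M"
    and t: "\<And>n. t n > 0" "t \<longlonglongrightarrow> 0"
  shows "(\<lambda>n. poisson_defect (t n) h) \<longlonglongrightarrow> 0"
proof -
  have [measurable]: "h \<in> borel_measurable borel"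
    using h(1) by (rule borel_measurable_continuous_onI)
  define I where "I n x = (\<integral>\<^sup>+y. ennreal (poisson 1 y) * ennreal \<bar>h (x - t n *\<^sub>R y) - h x\<bar> \<partial>lborel)" for n and x :: 'a
  have bd: "ennreal \<bar>h x - h y\<bar> \<le> ennreal (2 * M)" for x y
    using h(2)[of x] h(2)[of y] by (intro ennreal_leI) linarith
  have w: "(\<integral>\<^sup>+y. ennreal (poisson 1 (y::'a)) * ennreal (2 * M) \<partial>lborel) = ennreal (2 * M)"
    by (simp add: nn_integral_multc nn_integral_poisson[OF dim])
  have [measurable]: "I n \<in> borel_measurable borel" for n
    unfolding I_def by measurable
  have I: "(\<lambda>n. I n x) \<longlonglongrightarrow> 0" for x
  proof -
    have "(\<lambda>n. I n x) \<longlonglongrightarrow> (\<integral>\<^sup>+y. 0 \<partial>(lborel :: 'a measure))"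
      unfolding I_def
    proof (rule nn_integral_dominated_convergence[where w = "\<lambda>y. ennreal (poisson 1 y) * ennreal (2 * M)"])
      show "AE y in lborel. ennreal (poisson 1 y) * ennreal \<bar>h (x - t n *\<^sub>R y) - h x\<bar> \<le> ennreal (poisson 1 y) * ennreal (2 * M)" for n
        by (intro AE_I2 mult_left_mono bd) auto
      show "(\<integral>\<^sup>+y. ennreal (poisson 1 (y::'a)) * ennreal (2 * M) \<partial>lborel) < \<infinity>" unfolding w by simp
      show "AE y in lborel. (\<lambda>n. ennreal (poisson 1 y) * ennreal \<bar>h (x - t n *\<^sub>R y) - h x\<bar>) \<longlonglongrightarrow> 0"
      proof (intro AE_I2)
        fix y :: 'a
        have "(\<lambda>n. x - t n *\<^sub>R y) \<longlonglongrightarrow> x - 0 *\<^sub>R y" by (intro tendsto_intros t)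
        then have "(\<lambda>n. h (x - t n *\<^sub>R y)) \<longlonglongrightarrow> h x"
          using h(1) by (intro continuous_on_tendsto_compose[of UNIV h]) auto
        then have "(\<lambda>n. poisson 1 y * \<bar>h (x - t n *\<^sub>R y) - h x\<bar>) \<longlonglongrightarrow> poisson 1 y * \<bar>h x - h x\<bar>"
          by (intro tendsto_intros)
        then show "(\<lambda>n. ennreal (poisson 1 y) * ennreal \<bar>h (x - t n *\<^sub>R y) - h x\<bar>) \<longlonglongrightarrow> 0"
          by (simp add: ennreal_mult'[symmetric] tendsto_ennrealI[where x=0, simplified])
      qed
    qed auto
    then show ?thesis by simp
  qed
  have Ib: "I n x \<le> ennreal (2 * M)" for n x
    unfolding I_def by (subst w[symmetric]) (intro nn_integral_mono mult_left_mono bd; simp)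
  have "(\<lambda>n. \<integral>\<^sup>+x. ennreal (poisson 1 x) * I n x \<partial>lborel) \<longlonglongrightarrow> (\<integral>\<^sup>+y. 0 \<partial>(lborel :: 'a measure))"
  proof (rule nn_integral_dominated_convergence[where w = "\<lambda>y. ennreal (poisson 1 y) * ennreal (2 * M)"])
    show "AE x in lborel. ennreal (poisson 1 x) * I n x \<le> ennreal (poisson 1 x) * ennreal (2 * M)" for n
      by (intro AE_I2 mult_left_mono Ib) auto
    show "(\<integral>\<^sup>+y. ennreal (poisson 1 (y::'a)) * ennreal (2 * M) \<partial>lborel) < \<infinity>" unfolding w by simp
    show "AE x in lborel. (\<lambda>n. ennreal (poisson 1 x) * I n x) \<longlonglongrightarrow> 0"
    proof (intro AE_I2)
      fix x :: 'a
      show "(\<lambda>n. ennreal (poisson 1 x) * I n x) \<longlonglongrightarrow> 0"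
        using tendsto_mult_ennreal[OF tendsto_const[of "ennreal (poisson 1 x)"] I[of x]] by simp
    qed
  qed auto
  then show ?thesis unfolding I_def by (subst poisson_defect_rescale) (auto simp: t)
qed

lemma nn_integral_poisson_adjoint:
  fixes k :: "'a::euclidean_space \<Rightarrow> ennreal"
  assumes [measurable]: "k \<in> borel_measurable borel" "f \<in> borel_measurable borel"
  shows "(\<integral>\<^sup>+x. f x * (\<integral>\<^sup>+y. ennreal (poisson t (x - y)) * k y \<partial>lborel) \<partial>lborel)
     = (\<integral>\<^sup>+y. k y * (\<integral>\<^sup>+x. ennreal (poisson t (y - x)) * f x \<partial>lborel) \<partial>lborel)"
proof -
  have "(\<integral>\<^sup>+x. f x * (\<integral>\<^sup>+y. ennreal (poisson t (x - y)) * k y \<partial>lborel) \<partial>lborel)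
     = (\<integral>\<^sup>+x. (\<integral>\<^sup>+y. f x * (ennreal (poisson t (x - y)) * k y) \<partial>lborel) \<partial>lborel)"
    by (simp add: nn_integral_cmult)
  also have "\<dots> = (\<integral>\<^sup>+y. (\<integral>\<^sup>+x. f x * (ennreal (poisson t (x - y)) * k y) \<partial>lborel) \<partial>lborel)"
    by (intro lborel_pair.Fubini') measurable
  also have "\<dots> = (\<integral>\<^sup>+y. k y * (\<integral>\<^sup>+x. ennreal (poisson t (y - x)) * f x \<partial>lborel) \<partial>lborel)"
    by (subst nn_integral_cmult[symmetric], measurable)
       (intro nn_integral_cong, simp add: mult_ac poisson_even)
  finally show ?thesis .
qed

text \<open>The weight \<open>pot 1\<close> is superharmonic for the semigroup:
  \<open>P\<^sub>t\<close> moved onto it gives \<open>pot (t + 1) \<le> pot 1\<close>, so the bound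
  is uniform in \<open>t\<close>. The factor 2 counts the contributions of \<open>k y\<close> and of
  \<open>k x\<close>.\<close>

lemma poisson_defect_bound:
  fixes k :: "'a::euclidean_space \<Rightarrow> real"
  assumes dim: "DIM('a) \<ge> 2" and [measurable]: "k \<in> borel_measurable borel" and t: "t > 0"
  shows "poisson_defect t k \<le> ennreal (2 * poisson_const DIM('a)) * (\<integral>\<^sup>+x. ennreal (pot 1 x) * ennreal \<bar>k x\<bar> \<partial>lborel)"
    (is "_ \<le> _ * ?N")
proof -
  have p1: "ennreal (poisson 1 x) \<le> ennreal (poisson_const DIM('a)) * ennreal (pot 1 x)" for x :: 'a
    using poisson_le_pot[OF dim, of 1 x] poisson_const_pos[of "DIM('a)"]
    by (simp add: ennreal_mult'[symmetric] ennreal_leI)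
  have "poisson_defect t k \<le> (\<integral>\<^sup>+x. ennreal (poisson 1 x) *
      (\<integral>\<^sup>+y. ennreal (poisson t (x - y)) * ennreal \<bar>k y\<bar> + ennreal (poisson t (x - y)) * ennreal \<bar>k x\<bar> \<partial>lborel) \<partial>lborel)"
    unfolding poisson_defect_def
    by (intro nn_integral_mono mult_left_mono)
       (auto simp: distrib_left[symmetric] ennreal_plus[symmetric] simp del: ennreal_plus intro!: mult_left_mono ennreal_leI)
  also have "\<dots> = (\<integral>\<^sup>+x. ennreal (poisson 1 x) * (\<integral>\<^sup>+y. ennreal (poisson t (x - y)) * ennreal \<bar>k y\<bar> \<partial>lborel)
       + ennreal (poisson 1 x) * ennreal \<bar>k x\<bar> \<partial>lborel)"
    by (subst nn_integral_add) (auto simp: nn_integral_multc nn_integral_poisson_shift[OF dim t] distrib_left)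
  also have "\<dots> = (\<integral>\<^sup>+x. ennreal (poisson 1 x) * (\<integral>\<^sup>+y. ennreal (poisson t (x - y)) * ennreal \<bar>k y\<bar> \<partial>lborel) \<partial>lborel)
       + (\<integral>\<^sup>+x. ennreal (poisson 1 x) * ennreal \<bar>k x\<bar> \<partial>lborel)"
    by (intro nn_integral_add) measurable
  also have "(\<integral>\<^sup>+x. ennreal (poisson 1 x) * (\<integral>\<^sup>+y. ennreal (poisson t (x - y)) * ennreal \<bar>k y\<bar> \<partial>lborel) \<partial>lborel)
     \<le> (\<integral>\<^sup>+x. (ennreal (poisson_const DIM('a)) * ennreal (pot 1 x)) * (\<integral>\<^sup>+y. ennreal (poisson t (x - y)) * ennreal \<bar>k y\<bar> \<partial>lborel) \<partial>lborel)"
    by (intro nn_integral_mono mult_right_mono p1) auto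
  also have "\<dots> = ennreal (poisson_const DIM('a)) *
      (\<integral>\<^sup>+x. ennreal (pot 1 x) * (\<integral>\<^sup>+y. ennreal (poisson t (x - y)) * ennreal \<bar>k y\<bar> \<partial>lborel) \<partial>lborel)"
    by (simp add: mult.assoc nn_integral_cmult)
  also have "(\<integral>\<^sup>+x. ennreal (pot 1 x) * (\<integral>\<^sup>+y. ennreal (poisson t (x - y)) * ennreal \<bar>k y\<bar> \<partial>lborel) \<partial>lborel)
     = (\<integral>\<^sup>+y. ennreal \<bar>k y\<bar> * ennreal (pot (t + 1) (y::'a)) \<partial>lborel)"
    using t by (subst nn_integral_poisson_adjoint) (auto simp: ennreal_mult'[symmetric] poisson_conv_pot[OF dim t])
  also have "\<dots> \<le> ?N"
    using t dim by (intro nn_integral_mono) (auto simp: mult.commute intro!: mult_left_mono ennreal_leI pot_antimono)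
  also have "(\<integral>\<^sup>+x. ennreal (poisson 1 x) * ennreal \<bar>k x\<bar> \<partial>lborel)
     \<le> (\<integral>\<^sup>+x. (ennreal (poisson_const DIM('a)) * ennreal (pot 1 x)) * ennreal \<bar>k x\<bar> \<partial>lborel)"
    by (intro nn_integral_mono mult_right_mono p1) auto
  also have "\<dots> = ennreal (poisson_const DIM('a)) * ?N"
    by (simp add: mult.assoc nn_integral_cmult)
  finally have "poisson_defect t k \<le> ennreal (poisson_const DIM('a)) * ?N + ennreal (poisson_const DIM('a)) * ?N"
    by (simp add: add_mono mult_left_mono)
  also have "\<dots> = ennreal (2 * poisson_const DIM('a)) * ?N"
    using poisson_const_pos[of "DIM('a)"] by (simp add: distrib_right[symmetric] ennreal_plus[symmetric] del: ennreal_plus)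
  finally show ?thesis .
qed

lemma poisson_defect_triangle:
  fixes h k :: "'a::euclidean_space \<Rightarrow> real"
  assumes [measurable]: "h \<in> borel_measurable borel" "k \<in> borel_measurable borel"
  shows "poisson_defect t h \<le> poisson_defect t k + poisson_defect t (\<lambda>x. h x - k x)"
proof -
  have "poisson_defect t h \<le> (\<integral>\<^sup>+x. ennreal (poisson 1 x) *
      (\<integral>\<^sup>+y. ennreal (poisson t (x - y)) * ennreal \<bar>k y - k x\<bar> + ennreal (poisson t (x - y)) * ennreal \<bar>h y - k y - (h x - k x)\<bar> \<partial>lborel) \<partial>lborel)"
    unfolding poisson_defect_def
    by (intro nn_integral_mono mult_left_mono)
       (auto simp: distrib_left[symmetric] ennreal_plus[symmetric] simp del: ennreal_plus intro!: mult_left_mono ennreal_leI)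
  also have "\<dots> = poisson_defect t k + poisson_defect t (\<lambda>x. h x - k x)"
    unfolding poisson_defect_def
    by (subst nn_integral_add, measurable)+ (subst nn_integral_add[symmetric], auto simp: nn_integral_add distrib_left)
  finally show ?thesis .
qed

lemma borel_AE_limit_continuous:
  fixes h :: "'a::euclidean_space \<Rightarrow> real"
  assumes "h \<in> borel_measurable borel"
  obtains g :: "nat \<Rightarrow> 'a \<Rightarrow> real" where "\<And>n. continuous_on UNIV (g n)"
    "AE x in lborel. (\<lambda>n. g n x) \<longlonglongrightarrow> h x"
proof -
  have "h measurable_on UNIV"
    using assms lebesgue_measurable_imp_measurable_on[of h UNIV] by (simp add: measurable_completion)
  then obtain N g where g: "negligible N" "\<And>n. continuous_on UNIV (g n)"
      "\<And>x. x \<notin> N \<Longrightarrow> (\<lambda>n. g n x) \<longlonglongrightarrow> h x"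
    unfolding measurable_on_def by auto
  have "AE x in lebesgue. (\<lambda>n. g n x) \<longlonglongrightarrow> h x"
    using g by (intro AE_I'[of N]) (auto simp: negligible_iff_null_sets)
  then have "AE x in lborel. (\<lambda>n. g n x) \<longlonglongrightarrow> h x"
    by (simp add: AE_completion_iff)
  with g(2) that show ?thesis by blast
qed

text \<open>Two approximations: \<open>h\<close> is cut off in size and in space, and then the same
  cutoff is applied to continuous functions converging to \<open>h\<close> almost everywhere. The
  cutoff supplies the integrable majorant that the second limit lacks.\<close>

lemma approx_bounded_continuous:
  fixes h :: "'a::euclidean_space \<Rightarrow> real"
  assumes dim: "DIM('a) \<ge> 2" and [measurable]: "h \<in> borel_measurable borel"
    and fin: "(\<integral>\<^sup>+x. ennreal (pot 1 x) * ennreal \<bar>h x\<bar> \<partial>lborel) < \<infinity>" and e: "e > 0"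
  obtains g M where "continuous_on UNIV g" "\<And>x. \<bar>g x\<bar> \<le> M"
    "(\<integral>\<^sup>+x. ennreal (pot 1 x) * ennreal \<bar>h x - g x\<bar> \<partial>lborel) < ennreal e"
proof -
  \<comment> \<open>The spatial cutoff \<open>min 1 (j * poisson 1 x)\<close> is continuous, lies
    between 0 and 1, equals 1 at each fixed point once \<open>j\<close> is large, and is
    integrable.\<close>
  define c where "c j f x = max (- real j) (min (real j) (f x)) * min 1 (real j * poisson 1 (x::'a))" for j :: nat and f x
  have [measurable]: "c j f \<in> borel_measurable borel" if "f \<in> borel_measurable borel" for j f
    using that unfolding c_def by measurable
  have cb: "\<bar>c j f x\<bar> \<le> real j * min 1 (real j * poisson 1 x)" for j f x
    unfolding c_def abs_mult by (intro mult_mono) auto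
  have p1: "pot 1 (x::'a) \<le> 1" for x
    unfolding pot_def using powr_mono2'[of "- ((DIM('a) - 1) / 2)" 1 "(norm x)\<^sup>2 + 1\<^sup>2"] by simp
  have "(\<lambda>j. \<integral>\<^sup>+x. ennreal (pot 1 x) * ennreal \<bar>h x - c j h x\<bar> \<partial>lborel) \<longlonglongrightarrow> (\<integral>\<^sup>+x. 0 \<partial>(lborel::'a measure))"
  proof (rule nn_integral_dominated_convergence[where w = "\<lambda>x. ennreal (pot 1 x) * ennreal \<bar>h x\<bar>"])
    have "\<bar>h x - max (- real j) (min (real j) (h x)) * m\<bar> \<le> \<bar>h x\<bar>" if "0 \<le> m" "m \<le> 1" for j x m
    proof -
      define y where "y = max (- real j) (min (real j) (h x))"
      have "(0 \<le> y \<and> y \<le> h x) \<or> (h x \<le> y \<and> y \<le> 0)" by (auto simp: y_def)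
      moreover have "0 \<le> y \<Longrightarrow> 0 \<le> y * m \<and> y * m \<le> y" "y \<le> 0 \<Longrightarrow> y * m \<le> 0 \<and> y \<le> y * m"
        using that mult_left_mono[of m 1 y] mult_left_mono_neg[of m 1 y] by (auto simp: mult_nonpos_nonneg)
      ultimately show ?thesis unfolding y_def[symmetric] by linarith
    qed
    then show "AE x in lborel. ennreal (pot 1 x) * ennreal \<bar>h x - c j h x\<bar> \<le> ennreal (pot 1 x) * ennreal \<bar>h x\<bar>" for j
      unfolding c_def by (intro AE_I2 mult_left_mono ennreal_leI) auto
    show "AE x in lborel. (\<lambda>j. ennreal (pot 1 x) * ennreal \<bar>h x - c j h x\<bar>) \<longlonglongrightarrow> 0"
    proof (intro AE_I2 tendsto_eventually)
      fix x :: 'a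
      obtain j0 :: nat where j0: "real j0 \<ge> max \<bar>h x\<bar> (1 / poisson 1 x)" by (meson real_arch_simple)
      have "h x - c j h x = 0" if "j \<ge> j0" for j
      proof -
        have j: "real j \<ge> \<bar>h x\<bar>" "real j \<ge> 1 / poisson 1 x" using that j0 by auto
        then have "real j * poisson 1 x \<ge> 1" using poisson_pos[of 1 x] by (simp add: field_simps)
        then show ?thesis using j by (simp add: c_def)
      qed
      then show "\<forall>\<^sub>F j in sequentially. ennreal (pot 1 x) * ennreal \<bar>h x - c j h x\<bar> = 0"
        by (auto intro!: eventually_sequentiallyI[of j0])
    qed
  qed (use fin in auto)
  then have "\<forall>\<^sub>F j in sequentially. (\<integral>\<^sup>+x. ennreal (pot 1 x) * ennreal \<bar>h x - c j h x\<bar> \<partial>lborel) < ennreal (e/2)"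
    using e by (intro order_tendstoD(2)) auto
  then obtain j where j: "(\<integral>\<^sup>+x. ennreal (pot 1 x) * ennreal \<bar>h x - c j h x\<bar> \<partial>lborel) < ennreal (e/2)"
    by (auto simp: eventually_sequentially)
  obtain g where g: "\<And>n. continuous_on UNIV (g n)" "AE x in lborel. (\<lambda>n::nat. g n x) \<longlonglongrightarrow> h x"
    using borel_AE_limit_continuous[of h] by auto
  have [measurable]: "g n \<in> borel_measurable borel" for n
    using g(1) by (rule borel_measurable_continuous_onI)
  have "(\<lambda>n. \<integral>\<^sup>+x. ennreal (pot 1 x) * ennreal \<bar>c j h x - c j (g n) x\<bar> \<partial>lborel) \<longlonglongrightarrow> (\<integral>\<^sup>+x. 0 \<partial>(lborel::'a measure))"
  proof (rule nn_integral_dominated_convergence[where w = "\<lambda>x. ennreal (2 * real j * real j) * ennreal (poisson 1 x)"])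
    show "AE x in lborel. ennreal (pot 1 x) * ennreal \<bar>c j h x - c j (g n) x\<bar> \<le> ennreal (2 * real j * real j) * ennreal (poisson 1 x)" for n
    proof (intro AE_I2)
      fix x :: 'a
      have "\<bar>c j f x\<bar> \<le> real j * (real j * poisson 1 x)" for f
        by (rule order_trans[OF cb]) (intro mult_left_mono; simp)
      from this[of h] this[of "g n"] have "\<bar>c j h x - c j (g n) x\<bar> \<le> 2 * real j * real j * poisson 1 x"
        by linarith
      then have "pot 1 x * \<bar>c j h x - c j (g n) x\<bar> \<le> 1 * (2 * real j * real j * poisson 1 x)"
        using p1 by (intro mult_mono) auto
      then show "ennreal (pot 1 x) * ennreal \<bar>c j h x - c j (g n) x\<bar> \<le> ennreal (2 * real j * real j) * ennreal (poisson 1 x)"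
        by (simp add: ennreal_mult'[symmetric] ennreal_leI)
    qed
    show "(\<integral>\<^sup>+x. ennreal (2 * real j * real j) * ennreal (poisson 1 (x::'a)) \<partial>lborel) < \<infinity>"
      by (subst nn_integral_cmult) (auto simp: nn_integral_poisson[OF dim])
    show "AE x in lborel. (\<lambda>n. ennreal (pot 1 x) * ennreal \<bar>c j h x - c j (g n) x\<bar>) \<longlonglongrightarrow> 0"
      using g(2)
    proof eventually_elim
      case (elim x)
      have "(\<lambda>n. pot 1 x * \<bar>c j h x - c j (g n) x\<bar>) \<longlonglongrightarrow> pot 1 x * \<bar>c j h x - c j h x\<bar>"
        unfolding c_def by (intro tendsto_intros elim)
      then show ?case
        by (simp add: ennreal_mult'[symmetric] tendsto_ennrealI[where x=0, simplified])
    qed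
  qed auto
  then have "\<forall>\<^sub>F n in sequentially. (\<integral>\<^sup>+x. ennreal (pot 1 x) * ennreal \<bar>c j h x - c j (g n) x\<bar> \<partial>lborel) < ennreal (e/2)"
    using e by (intro order_tendstoD(2)) auto
  then obtain n where n: "(\<integral>\<^sup>+x. ennreal (pot 1 x) * ennreal \<bar>c j h x - c j (g n) x\<bar> \<partial>lborel) < ennreal (e/2)"
    by (auto simp: eventually_sequentially)
  have "(\<integral>\<^sup>+x. ennreal (pot 1 x) * ennreal \<bar>h x - c j (g n) x\<bar> \<partial>lborel)
     \<le> (\<integral>\<^sup>+x. ennreal (pot 1 x) * ennreal \<bar>h x - c j h x\<bar> + ennreal (pot 1 x) * ennreal \<bar>c j h x - c j (g n) x\<bar> \<partial>lborel)"
    by (intro nn_integral_mono)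
       (auto simp: distrib_left[symmetric] ennreal_plus[symmetric] simp del: ennreal_plus intro!: mult_left_mono ennreal_leI)
  also have "\<dots> = (\<integral>\<^sup>+x. ennreal (pot 1 x) * ennreal \<bar>h x - c j h x\<bar> \<partial>lborel) + (\<integral>\<^sup>+x. ennreal (pot 1 x) * ennreal \<bar>c j h x - c j (g n) x\<bar> \<partial>lborel)"
    by (intro nn_integral_add) measurable
  also have "\<dots> < ennreal (e/2) + ennreal (e/2)"
    by (intro add_strict_mono j n)
  also have "\<dots> = ennreal e" using e by (simp add: ennreal_plus[symmetric] del: ennreal_plus)
  finally have "(\<integral>\<^sup>+x. ennreal (pot 1 x) * ennreal \<bar>h x - c j (g n) x\<bar> \<partial>lborel) < ennreal e" .
  moreover have "continuous_on UNIV (c j (g n))"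
  proof -
    have "(norm x)\<^sup>2 + 1 \<noteq> 0" for x :: 'a
      by (metis add_pos_nonneg add.commute less_irrefl zero_le_power2 zero_less_one)
    then have "continuous_on UNIV (poisson 1 :: 'a \<Rightarrow> real)"
      unfolding poisson_def by (intro continuous_intros) auto
    then show ?thesis unfolding c_def by (intro continuous_intros g(1))
  qed
  moreover have "\<bar>c j (g n) x\<bar> \<le> real j" for x
    by (rule order_trans[OF cb]) (simp add: mult_left_le)
  ultimately show ?thesis using that by blast
qed

text \<open>Density argument: half of \<open>e\<close> goes to the continuous approximant and half
  to the remainder through the uniform bound with constant \<open>K\<close>, which explains
  \<open>e / (2 * K)\<close>. The proof is by contradiction because the continuous case is stated
  along sequences.\<close>

lemma poisson_defect_tendsto:
  fixes h :: "'a::euclidean_space \<Rightarrow> real"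
  assumes dim: "DIM('a) \<ge> 2" and [measurable]: "h \<in> borel_measurable borel"
    and fin: "(\<integral>\<^sup>+x. ennreal (pot 1 x) * ennreal \<bar>h x\<bar> \<partial>lborel) < \<infinity>" and e: "e > 0"
  obtains d where "d > 0" "\<And>t. 0 < t \<Longrightarrow> t < d \<Longrightarrow> poisson_defect t h \<le> ennreal e"
proof (rule ccontr)
  assume "\<not> thesis"
  then have "\<exists>t. 0 < t \<and> t < 1 / real (Suc n) \<and> \<not> poisson_defect t h \<le> ennreal e" for n
    using that[of "1 / real (Suc n)"] by auto
  then obtain t where t: "\<And>n. 0 < t n" "\<And>n. t n < 1 / real (Suc n)" "\<And>n. poisson_defect (t n) h > ennreal e"
    by (metis not_le)
  have t0: "t \<longlonglongrightarrow> 0"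
    by (rule tendsto_sandwich[OF _ _ tendsto_const LIMSEQ_Suc[OF lim_1_over_n]])
       (use t in \<open>auto intro!: always_eventually less_imp_le\<close>)
  define K where "K = 2 * poisson_const DIM('a)"
  have K: "K > 0" using poisson_const_pos by (simp add: K_def)
  obtain g M where g: "continuous_on UNIV g" "\<And>x. \<bar>g x\<bar> \<le> M"
    "(\<integral>\<^sup>+x. ennreal (pot 1 x) * ennreal \<bar>h x - g x\<bar> \<partial>lborel) < ennreal (e / (2 * K))"
    using approx_bounded_continuous[OF dim assms(2) fin, of "e / (2 * K)"] e K by auto
  have [measurable]: "g \<in> borel_measurable borel"
    using g(1) by (rule borel_measurable_continuous_onI)
  have "\<forall>\<^sub>F n in sequentially. poisson_defect (t n) g < ennreal (e/2)"
    using poisson_defect_continuous[OF dim g(1,2) t(1) t0] e by (intro order_tendstoD(2)) auto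
  then obtain n where n: "poisson_defect (t n) g < ennreal (e/2)"
    by (auto simp: eventually_sequentially)
  have "poisson_defect (t n) (\<lambda>x. h x - g x) \<le> ennreal K * (\<integral>\<^sup>+x. ennreal (pot 1 x) * ennreal \<bar>h x - g x\<bar> \<partial>lborel)"
    unfolding K_def using t(1) by (intro poisson_defect_bound[OF dim]) auto
  also have "\<dots> \<le> ennreal K * ennreal (e / (2 * K))"
    using g(3) by (intro mult_left_mono) auto
  also have "\<dots> = ennreal (e/2)" using K e by (simp add: ennreal_mult'[symmetric])
  finally have 1: "poisson_defect (t n) (\<lambda>x. h x - g x) \<le> ennreal (e/2)" .
  have "poisson_defect (t n) h \<le> poisson_defect (t n) g + poisson_defect (t n) (\<lambda>x. h x - g x)"
    by (rule poisson_defect_triangle) auto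
  also have "\<dots> \<le> ennreal (e/2) + ennreal (e/2)" using n 1 by (intro add_mono) auto
  also have "\<dots> = ennreal e" using e by (simp add: ennreal_plus[symmetric] del: ennreal_plus)
  finally show False using t(3)[of n] by simp
qed

section \<open>The domination principle\<close>

lemma poisson_conv_pot_shift:
  fixes x z :: "'a::euclidean_space"
  assumes dim: "DIM('a) \<ge> 2" and s: "s > 0" and t: "t \<ge> 0"
  shows "(\<integral>\<^sup>+y. ennreal (poisson s (x - y)) * ennreal (pot t (y - z)) \<partial>lborel) = ennreal (pot (s + t) (x - z))"
proof -
  have "(\<integral>\<^sup>+y. ennreal (poisson s (x - y)) * ennreal (pot t (y - z)) \<partial>lborel)
     = (\<integral>\<^sup>+y. ennreal (poisson s (x - (z + y))) * ennreal (pot t (z + y - z)) \<partial>lborel)"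
    by (rule nn_integral_lborel_shift[symmetric]) measurable
  also have "\<dots> = (\<integral>\<^sup>+y. ennreal (poisson s ((x - z) - y) * pot t y) \<partial>lborel)"
    using s by (intro nn_integral_cong) (simp add: ennreal_mult' diff_diff_eq)
  finally show ?thesis by (simp add: poisson_conv_pot[OF dim s t])
qed

lemma ennreal_integral_le_nn_integral:
  fixes f :: "'a \<Rightarrow> real"
  shows "ennreal (integral\<^sup>L M f) \<le> (\<integral>\<^sup>+x. ennreal (f x) \<partial>M)"
proof (cases "integrable M f")
  case True
  then have "integral\<^sup>L M f \<le> enn2real (\<integral>\<^sup>+x. ennreal (f x) \<partial>M)"
    by (subst real_lebesgue_integral_def) auto
  then have "ennreal (integral\<^sup>L M f) \<le> ennreal (enn2real (\<integral>\<^sup>+x. ennreal (f x) \<partial>M))"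
    by (rule ennreal_leI)
  also have "\<dots> \<le> (\<integral>\<^sup>+x. ennreal (f x) \<partial>M)" by (simp add: ennreal_enn2real_if)
  finally show ?thesis .
qed (simp add: not_integrable_integral_eq)

text \<open>Absolute convergence is imposed only for \<open>t > 0\<close>, as this is what
  integrability at interior points of the half-space provides. At the boundary \<open>t = 0\<close>
  it is recovered almost everywhere through \<open>Z\<close>.\<close>

locale finite_potential =
  fixes h :: "'a::euclidean_space \<Rightarrow> real"
  assumes dim: "DIM('a) \<ge> 2"
    and h_meas [measurable]: "h \<in> borel_measurable borel"
    and fin: "\<And>x t. t > 0 \<Longrightarrow> (\<integral>\<^sup>+y. ennreal (pot t (x - y)) * ennreal \<bar>h y\<bar> \<partial>lborel) < \<infinity>"
begin

definition U :: "real \<Rightarrow> 'a \<Rightarrow> real" where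
  "U t x = (\<integral>y. pot t (x - y) * h y \<partial>lborel)"

definition Z :: "'a \<Rightarrow> ennreal" where
  "Z x = (\<integral>\<^sup>+y. ennreal (pot 0 (x - y)) * ennreal \<bar>h y\<bar> \<partial>lborel)"

lemma U_meas [measurable]: "U t \<in> borel_measurable borel"
  unfolding U_def by measurable

lemma Z_meas [measurable]: "Z \<in> borel_measurable borel"
  unfolding Z_def by measurable

lemma poisson_Z:
  assumes s: "s > 0"
  shows "(\<integral>\<^sup>+y. ennreal (poisson s (x - y)) * Z y \<partial>lborel) = (\<integral>\<^sup>+z. ennreal (pot s (x - z)) * ennreal \<bar>h z\<bar> \<partial>lborel)"
proof -
  have "(\<integral>\<^sup>+y. ennreal (poisson s (x - y)) * Z y \<partial>lborel)
     = (\<integral>\<^sup>+y. (\<integral>\<^sup>+z. ennreal (poisson s (x - y)) * (ennreal (pot 0 (y - z)) * ennreal \<bar>h z\<bar>) \<partial>lborel) \<partial>lborel)"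
    unfolding Z_def by (simp add: nn_integral_cmult)
  also have "\<dots> = (\<integral>\<^sup>+z. (\<integral>\<^sup>+y. ennreal (poisson s (x - y)) * (ennreal (pot 0 (y - z)) * ennreal \<bar>h z\<bar>) \<partial>lborel) \<partial>lborel)"
    by (intro lborel_pair.Fubini') measurable
  also have "\<dots> = (\<integral>\<^sup>+z. ennreal (pot s (x - z)) * ennreal \<bar>h z\<bar> \<partial>lborel)"
    using poisson_conv_pot_shift[OF dim s, of 0 x]
    by (simp add: mult.assoc[symmetric] nn_integral_multc)
  finally show ?thesis .
qed

text \<open>The Poisson mean of \<open>Z\<close> at height 1 is an interior potential of
  \<open>|h|\<close>, hence finite, and the Poisson kernel is strictly positive.\<close>

lemma Z_finite: "AE x in lborel. Z x < \<infinity>"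
proof -
  have "(\<integral>\<^sup>+y. ennreal (poisson 1 (0 - y)) * Z y \<partial>lborel) \<noteq> \<infinity>"
    using fin[of 1 0] by (simp only: poisson_Z zero_less_one) simp
  then have "AE y in lborel. ennreal (poisson 1 (0 - y)) * Z y \<noteq> \<infinity>"
    by (intro nn_integral_PInf_AE) auto
  then show ?thesis
  proof eventually_elim
    case (elim y)
    moreover have "ennreal (poisson 1 (0 - y)) \<noteq> 0" using poisson_pos[of 1 "0 - y"] by simp
    ultimately show ?case by (auto simp: ennreal_mult_eq_top_iff less_top)
  qed
qed

lemma integrable_pot:
  assumes "t > 0 \<or> (t = 0 \<and> Z x < \<infinity>)"
  shows "integrable lborel (\<lambda>y. pot t (x - y) * h y)"
  using assms fin[of t x] by (intro integrableI_bounded) (auto simp: Z_def abs_mult ennreal_mult')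

lemma abs_U_le_Z: "ennreal \<bar>U 0 x\<bar> \<le> Z x"
proof (cases "integrable lborel (\<lambda>y. pot 0 (x - y) * h y)")
  case True
  then show ?thesis unfolding U_def Z_def
    using integral_norm_bound_ennreal[OF True] by (simp add: abs_mult ennreal_mult')
qed (simp add: U_def not_integrable_integral_eq)

lemma integrable_poisson_U:
  assumes s: "s > 0"
  shows "integrable lborel (\<lambda>y. poisson s (x - y) * U 0 y)"
proof (rule integrableI_bounded)
  have "(\<integral>\<^sup>+y. ennreal (norm (poisson s (x - y) * U 0 y)) \<partial>lborel) \<le> (\<integral>\<^sup>+y. ennreal (poisson s (x - y)) * Z y \<partial>lborel)"
    using s abs_U_le_Z by (intro nn_integral_mono) (auto simp: abs_mult ennreal_mult' intro!: mult_left_mono)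
  also have "\<dots> < \<infinity>" using fin[OF s, of x] by (simp add: poisson_Z[OF s])
  finally show "(\<integral>\<^sup>+y. ennreal (norm (poisson s (x - y) * U 0 y)) \<partial>lborel) < \<infinity>" .
qed measurable

text \<open>The interior potential is the harmonic extension of its boundary values. Fubini is
  justified by the Poisson mean of \<open>Z\<close>, which bounds the double integral of absolute
  values.\<close>

lemma U_eq_poisson:
  assumes s: "s > 0"
  shows "U s x = (\<integral>y. poisson s (x - y) * U 0 y \<partial>lborel)"
proof -
  have "integrable (lborel \<Otimes>\<^sub>M lborel) (\<lambda>(y, z). poisson s (x - y) * (pot 0 (y - z) * h z))"
  proof (rule integrableI_bounded)
    have "(\<integral>\<^sup>+p. ennreal (norm (case p of (y, z) \<Rightarrow> poisson s (x - y) * (pot 0 (y - z) * h z))) \<partial>(lborel \<Otimes>\<^sub>M lborel))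
       = (\<integral>\<^sup>+y. (\<integral>\<^sup>+z. ennreal (poisson s (x - y)) * (ennreal (pot 0 (y - z)) * ennreal \<bar>h z\<bar>) \<partial>lborel) \<partial>lborel)"
      using s by (subst lborel.nn_integral_fst[symmetric]) (auto simp: abs_mult ennreal_mult' split_beta')
    also have "\<dots> = (\<integral>\<^sup>+y. ennreal (poisson s (x - y)) * Z y \<partial>lborel)"
      unfolding Z_def by (simp add: nn_integral_cmult)
    also have "\<dots> < \<infinity>" using fin[OF s, of x] by (simp add: poisson_Z[OF s])
    finally show "(\<integral>\<^sup>+p. ennreal (norm (case p of (y, z) \<Rightarrow> poisson s (x - y) * (pot 0 (y - z) * h z))) \<partial>(lborel \<Otimes>\<^sub>M lborel)) < \<infinity>" .
  qed measurable
  then have "(\<integral>z. (\<integral>y. poisson s (x - y) * (pot 0 (y - z) * h z) \<partial>lborel) \<partial>lborel)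
    = (\<integral>y. (\<integral>z. poisson s (x - y) * (pot 0 (y - z) * h z) \<partial>lborel) \<partial>lborel)"
    by (rule lborel_pair.Fubini_integral)
  also have "\<dots> = (\<integral>y. poisson s (x - y) * U 0 y \<partial>lborel)"
    unfolding U_def by simp
  finally have swap: "(\<integral>z. (\<integral>y. poisson s (x - y) * (pot 0 (y - z) * h z) \<partial>lborel) \<partial>lborel)
    = (\<integral>y. poisson s (x - y) * U 0 y \<partial>lborel)" .
  have "(\<integral>y. poisson s (x - y) * (pot 0 (y - z) * h z) \<partial>lborel) = pot s (x - z) * h z" for z
  proof -
    have "(\<integral>y. poisson s (x - y) * pot 0 (y - z) \<partial>lborel) = pot s (x - z)"
      using s poisson_conv_pot_shift[OF dim s, of 0 x z]
      by (subst integral_eq_nn_integral) (auto simp: ennreal_mult')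
    then show ?thesis by (simp add: mult.assoc[symmetric])
  qed
  with swap show ?thesis by (simp add: U_def)
qed

section \<open>First-order expansion of the semigroup on potentials\<close>

definition defect :: "real \<Rightarrow> 'a \<Rightarrow> ennreal" where
  "defect s x = (\<integral>\<^sup>+y. ennreal (pot 0 (x - y) - pot s (x - y)) * ennreal \<bar>h y - h x\<bar> \<partial>lborel)"

lemma defect_meas [measurable]: "defect s \<in> borel_measurable borel"
  unfolding defect_def by measurable

lemma rate_pos: "pot_rate DIM('a) > 0"
  using pot_rate_pos[OF dim] .

lemma pot_diff_time_integral:
  fixes x :: 'a
  assumes s: "s > 0"
  shows "AE y in lborel. ennreal (pot 0 (x - y) - pot s (x - y))
     = (\<integral>\<^sup>+t. ennreal (pot_rate DIM('a)) * (ennreal (poisson t (x - y)) * indicator {0..s} t) \<partial>lborel)"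
  using AE_lborel_singleton[of x]
proof eventually_elim
  case (elim y)
  then have "ennreal (pot 0 (x - y) - pot s (x - y)) = (\<integral>\<^sup>+t. ennreal (pot_rate DIM('a) * poisson t (x - y)) * indicator {0..s} t \<partial>lborel)"
    using s by (intro nn_integral_poisson_time[OF dim, symmetric]) auto
  also have "\<dots> = (\<integral>\<^sup>+t. ennreal (pot_rate DIM('a)) * (ennreal (poisson t (x - y)) * indicator {0..s} t) \<partial>lborel)"
    using rate_pos by (intro nn_integral_cong) (simp add: ennreal_mult' mult.assoc)
  finally show ?case .
qed

lemma nn_integral_pot_diff:
  fixes x :: 'a
  assumes s: "s > 0"
  shows "(\<integral>\<^sup>+y. ennreal (pot 0 (x - y) - pot s (x - y)) \<partial>lborel) = ennreal (pot_rate DIM('a) * s)"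
proof -
  have "(\<integral>\<^sup>+y. ennreal (pot 0 (x - y) - pot s (x - y)) \<partial>lborel)
     = (\<integral>\<^sup>+y. (\<integral>\<^sup>+t. ennreal (pot_rate DIM('a)) * (ennreal (poisson t (x - y)) * indicator {0..s} t) \<partial>lborel) \<partial>lborel)"
    using pot_diff_time_integral[OF s] by (intro nn_integral_cong_AE)
  also have "\<dots> = (\<integral>\<^sup>+t. (\<integral>\<^sup>+y. ennreal (pot_rate DIM('a)) * (ennreal (poisson t (x - y)) * indicator {0..s} t) \<partial>lborel) \<partial>lborel)"
    by (intro lborel_pair.Fubini') measurable
  also have "\<dots> = (\<integral>\<^sup>+t. ennreal (pot_rate DIM('a)) * indicator {0..s} t \<partial>lborel)"
  proof (intro nn_integral_cong_AE)
    show "AE t in lborel. (\<integral>\<^sup>+y. ennreal (pot_rate DIM('a)) * (ennreal (poisson t (x - y)) * indicator {0..s} t) \<partial>lborel)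
        = ennreal (pot_rate DIM('a)) * indicator {0..s} t"
      \<comment> \<open>At \<open>t = 0\<close> the kernel \<open>poisson\<close> is identically 0
        and has no mass, so this single time is discarded as a null set.\<close>
      using AE_lborel_singleton[of "0::real"]
    proof eventually_elim
      case (elim t)
      show ?case
      proof (cases "t \<in> {0..s}")
        case True
        with elim have "t > 0" by simp
        with True show ?thesis by (simp add: nn_integral_cmult nn_integral_poisson_shift[OF dim])
      qed simp
    qed
  qed
  also have "\<dots> = ennreal (pot_rate DIM('a) * s)"
    using s rate_pos by (subst nn_integral_cmult_indicator) (auto simp: ennreal_mult')
  finally show ?thesis .
qed

text \<open>The kernel \<open>pot 0 - pot s\<close> is non-negative off the singularity with total
  mass \<open>pot_rate * s\<close>. Subtracting the same mass times \<open>h x\<close> leaves the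
  integral of this kernel against \<open>h y - h x\<close>.\<close>

lemma U_diff_le_defect:
  assumes s: "s > 0" and x: "Z x < \<infinity>"
  shows "ennreal \<bar>U 0 x - U s x - pot_rate DIM('a) * s * h x\<bar> \<le> defect s x"
proof -
  define k where "k y = pot 0 (x - y) - pot s (x - y)" for y
  have [measurable]: "k \<in> borel_measurable borel" unfolding k_def by measurable
  have k0: "AE y in lborel. k y \<ge> 0"
    using AE_lborel_singleton[of x]
    by eventually_elim (use s in \<open>auto simp: k_def intro!: pot_antimono\<close>)
  have ik: "integrable lborel k"
    unfolding integrable_iff_bounded
  proof
    have "(\<integral>\<^sup>+y. ennreal (norm (k y)) \<partial>lborel) = (\<integral>\<^sup>+y. ennreal (k y) \<partial>lborel)"
      using k0 by (intro nn_integral_cong_AE) auto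
    then show "(\<integral>\<^sup>+y. ennreal (norm (k y)) \<partial>lborel) < \<infinity>"
      by (simp add: k_def nn_integral_pot_diff[OF s])
  qed measurable
  have vk: "integral\<^sup>L lborel k = pot_rate DIM('a) * s"
    using nn_integral_pot_diff[OF s, of x] k0 s rate_pos
    by (subst integral_eq_nn_integral) (auto simp: k_def)
  have ikh: "integrable lborel (\<lambda>y. k y * h y)"
    using Bochner_Integration.integrable_diff[OF integrable_pot[of 0 x] integrable_pot[of s x]] s x
    by (auto simp: k_def left_diff_distrib)
  have "U 0 x - U s x = (\<integral>y. k y * h y \<partial>lborel)"
    unfolding U_def using integrable_pot[of 0 x] integrable_pot[of s x] s x
    by (subst Bochner_Integration.integral_diff[symmetric]) (auto simp: k_def left_diff_distrib)
  moreover have "pot_rate DIM('a) * s * h x = (\<integral>y. k y * h x \<partial>lborel)" using ik by (simp add: vk)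
  ultimately have e: "U 0 x - U s x - pot_rate DIM('a) * s * h x = (\<integral>y. k y * (h y - h x) \<partial>lborel)"
    using ik ikh by (simp add: right_diff_distrib)
  have "ennreal (norm (\<integral>y. k y * (h y - h x) \<partial>lborel)) \<le> (\<integral>\<^sup>+y. ennreal (norm (k y * (h y - h x))) \<partial>lborel)"
    using ik ikh by (intro integral_norm_bound_ennreal) (auto simp: right_diff_distrib)
  also have "\<dots> = defect s x"
    unfolding defect_def k_def[symmetric] using k0
    by (intro nn_integral_cong_AE) (auto simp: abs_mult ennreal_mult')
  finally show ?thesis unfolding e by simp
qed

text \<open>The kernel difference is a time integral of Poisson kernels, so by Tonelli the weighted
  mean of the error is the time integral of \<open>poisson_defect t h\<close>. Its integrand tends
  to 0 with \<open>t\<close>, whence the mean is \<open>o(s)\<close>.\<close>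

lemma nn_integral_defect:
  assumes s: "s > 0"
  shows "(\<integral>\<^sup>+x. ennreal (poisson 1 x) * defect s x \<partial>lborel)
     = (\<integral>\<^sup>+t. ennreal (pot_rate DIM('a)) * (poisson_defect t h * indicator {0..s} t) \<partial>lborel)"
proof -
  have d: "defect s x = (\<integral>\<^sup>+t. ennreal (pot_rate DIM('a)) * (indicator {0..s} t * (\<integral>\<^sup>+y. ennreal (poisson t (x - y)) * ennreal \<bar>h y - h x\<bar> \<partial>lborel)) \<partial>lborel)" for x
  proof -
    have "defect s x = (\<integral>\<^sup>+y. (\<integral>\<^sup>+t. ennreal (pot_rate DIM('a)) * (ennreal (poisson t (x - y)) * indicator {0..s} t) \<partial>lborel) * ennreal \<bar>h y - h x\<bar> \<partial>lborel)"
      unfolding defect_def using pot_diff_time_integral[OF s, of x]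
      by (intro nn_integral_cong_AE, eventually_elim) simp
    also have "\<dots> = (\<integral>\<^sup>+y. (\<integral>\<^sup>+t. ennreal (pot_rate DIM('a)) * (ennreal (poisson t (x - y)) * indicator {0..s} t) * ennreal \<bar>h y - h x\<bar> \<partial>lborel) \<partial>lborel)"
      by (simp add: nn_integral_multc)
    also have "\<dots> = (\<integral>\<^sup>+t. (\<integral>\<^sup>+y. ennreal (pot_rate DIM('a)) * (ennreal (poisson t (x - y)) * indicator {0..s} t) * ennreal \<bar>h y - h x\<bar> \<partial>lborel) \<partial>lborel)"
      by (intro lborel_pair.Fubini') measurable
    also have "\<dots> = (\<integral>\<^sup>+t. ennreal (pot_rate DIM('a)) * (indicator {0..s} t * (\<integral>\<^sup>+y. ennreal (poisson t (x - y)) * ennreal \<bar>h y - h x\<bar> \<partial>lborel)) \<partial>lborel)"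
      by (subst nn_integral_cmult[symmetric], measurable)+ (intro nn_integral_cong, simp add: mult_ac)
    finally show ?thesis .
  qed
  have "(\<integral>\<^sup>+x. ennreal (poisson 1 x) * defect s x \<partial>lborel)
    = (\<integral>\<^sup>+x. (\<integral>\<^sup>+t. ennreal (poisson 1 x) * (ennreal (pot_rate DIM('a)) * (indicator {0..s} t * (\<integral>\<^sup>+y. ennreal (poisson t (x - y)) * ennreal \<bar>h y - h x\<bar> \<partial>lborel))) \<partial>lborel) \<partial>lborel)"
    unfolding d by (intro nn_integral_cong nn_integral_cmult[symmetric]) measurable
  also have "\<dots> = (\<integral>\<^sup>+t. (\<integral>\<^sup>+x. ennreal (poisson 1 x) * (ennreal (pot_rate DIM('a)) * (indicator {0..s} t * (\<integral>\<^sup>+y. ennreal (poisson t (x - y)) * ennreal \<bar>h y - h x\<bar> \<partial>lborel))) \<partial>lborel) \<partial>lborel)"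
    by (intro lborel_pair.Fubini') measurable
  also have "\<dots> = (\<integral>\<^sup>+t. ennreal (pot_rate DIM('a)) * (poisson_defect t h * indicator {0..s} t) \<partial>lborel)"
  proof (intro nn_integral_cong)
    fix t :: real
    have "(\<integral>\<^sup>+x. ennreal (poisson 1 x) * (ennreal (pot_rate DIM('a)) * (indicator {0..s} t * (\<integral>\<^sup>+y. ennreal (poisson t (x - y)) * ennreal \<bar>h y - h x\<bar> \<partial>lborel))) \<partial>lborel)
      = (\<integral>\<^sup>+x. (ennreal (pot_rate DIM('a)) * indicator {0..s} t) * (ennreal (poisson 1 x) * (\<integral>\<^sup>+y. ennreal (poisson t (x - y)) * ennreal \<bar>h y - h x\<bar> \<partial>lborel)) \<partial>lborel)"
      by (intro nn_integral_cong) (simp add: mult_ac)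
    also have "\<dots> = (ennreal (pot_rate DIM('a)) * indicator {0..s} t) * poisson_defect t h"
      unfolding poisson_defect_def by (intro nn_integral_cmult) measurable
    finally show "(\<integral>\<^sup>+x. ennreal (poisson 1 x) * (ennreal (pot_rate DIM('a)) * (indicator {0..s} t * (\<integral>\<^sup>+y. ennreal (poisson t (x - y)) * ennreal \<bar>h y - h x\<bar> \<partial>lborel))) \<partial>lborel)
      = ennreal (pot_rate DIM('a)) * (poisson_defect t h * indicator {0..s} t)"
      by (simp add: mult_ac)
  qed
  finally show ?thesis .
qed

lemma defect_small:
  assumes e: "e > 0"
  obtains d where "d > 0" "\<And>s. 0 < s \<Longrightarrow> s < d \<Longrightarrow> (\<integral>\<^sup>+x. ennreal (poisson 1 x) * defect s x \<partial>lborel) \<le> ennreal (s * e)"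
proof -
  have "(\<integral>\<^sup>+x. ennreal (pot 1 x) * ennreal \<bar>h x\<bar> \<partial>lborel) < \<infinity>"
    using fin[of 1 0] by (simp add: pot_def)
  then obtain d where d: "d > 0" "\<And>t. 0 < t \<Longrightarrow> t < d \<Longrightarrow> poisson_defect t h \<le> ennreal (e / pot_rate DIM('a))"
    using poisson_defect_tendsto[OF dim h_meas _ divide_pos_pos[OF e rate_pos]] by blast
  have "(\<integral>\<^sup>+x. ennreal (poisson 1 x) * defect s x \<partial>lborel) \<le> ennreal (s * e)" if s: "0 < s" "s < d" for s
  proof -
    have "(\<integral>\<^sup>+x. ennreal (poisson 1 x) * defect s x \<partial>lborel) \<le> (\<integral>\<^sup>+t. ennreal e * indicator {0..s} t \<partial>lborel)"
      unfolding nn_integral_defect[OF s(1)]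
    proof (intro nn_integral_mono_AE)
      show "AE t in lborel. ennreal (pot_rate DIM('a)) * (poisson_defect t h * indicator {0..s} t) \<le> ennreal e * indicator {0..s} t"
        using AE_lborel_singleton[of "0::real"]
      proof eventually_elim
        case (elim t)
        show ?case
        proof (cases "t \<in> {0..s}")
          case True
          then have "ennreal (pot_rate DIM('a)) * poisson_defect t h \<le> ennreal (pot_rate DIM('a)) * ennreal (e / pot_rate DIM('a))"
            using elim s by (intro mult_left_mono d(2)) auto
          also have "\<dots> = ennreal e" using rate_pos e by (simp add: ennreal_mult'[symmetric])
          finally show ?thesis using True by simp
        qed simp
      qed
    qed
    also have "\<dots> = ennreal (s * e)"
      using s e by (subst nn_integral_cmult_indicator) (auto simp: ennreal_mult' mult.commute)
    finally show ?thesis .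
  qed
  with d(1) that show ?thesis by blast
qed

section \<open>Decay of the negative part\<close>

definition neg_part :: "'a \<Rightarrow> ennreal" where
  "neg_part x = ennreal (- U 0 x)"

lemma neg_part_meas [measurable]: "neg_part \<in> borel_measurable borel"
  unfolding neg_part_def by measurable

text \<open>Kato's inequality for the Poisson semigroup: the negative part of \<open>U 0\<close> is subharmonic up to
  an error that is \<open>o(s)\<close> in the mean.\<close>

lemma kato:
  assumes neg: "AE x in lborel. U 0 x < 0 \<longrightarrow> h x \<ge> 0" and s: "s > 0"
  shows "AE x in lborel. neg_part x \<le> (\<integral>\<^sup>+y. ennreal (poisson s (x - y)) * neg_part y \<partial>lborel) + defect s x"
  using neg Z_finite
proof eventually_elim
  case (elim x)
  show ?case
  proof (cases "U 0 x < 0")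
    case True
    then have "h x \<ge> 0" using elim by simp
    then have "pot_rate DIM('a) * s * h x \<ge> 0" using rate_pos s by simp
    \<comment> \<open>The sign condition enters here: where \<open>U 0\<close> is negative, the
      first-order term has the favourable sign and is dropped. Where \<open>U 0\<close> is
      non-negative, \<open>neg_part\<close> is 0.\<close>
    then have "- U 0 x \<le> - U s x + \<bar>U 0 x - U s x - pot_rate DIM('a) * s * h x\<bar>" by linarith
    then have "neg_part x \<le> ennreal (max 0 (- U s x) + \<bar>U 0 x - U s x - pot_rate DIM('a) * s * h x\<bar>)"
      unfolding neg_part_def by (intro ennreal_leI) linarith
    also have "\<dots> = ennreal (- U s x) + ennreal \<bar>U 0 x - U s x - pot_rate DIM('a) * s * h x\<bar>"
      by (subst ennreal_plus) (auto simp: max_def ennreal_neg)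
    also have "ennreal (- U s x) \<le> (\<integral>\<^sup>+y. ennreal (poisson s (x - y)) * neg_part y \<partial>lborel)"
    proof -
      have "ennreal (- U s x) = ennreal (\<integral>y. poisson s (x - y) * (- U 0 y) \<partial>lborel)"
        by (simp add: U_eq_poisson[OF s])
      also have "\<dots> \<le> (\<integral>\<^sup>+y. ennreal (poisson s (x - y) * (- U 0 y)) \<partial>lborel)"
        by (rule ennreal_integral_le_nn_integral)
      also have "\<dots> = (\<integral>\<^sup>+y. ennreal (poisson s (x - y)) * neg_part y \<partial>lborel)"
        unfolding neg_part_def using s by (intro nn_integral_cong ennreal_mult') auto
      finally show ?thesis .
    qed
    finally show ?thesis
      using U_diff_le_defect[OF s, of x] elim by (meson add_mono order_refl order_trans)
  qed (simp add: neg_part_def ennreal_neg)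
qed

text \<open>Kato's inequality integrated against \<open>pot_slab t\<close>; by symmetry
  \<open>P\<^sub>s\<close> passes to the weight and advances it to \<open>t + s\<close>. The error
  carries the weight \<open>pot_slab t\<close>, which exceeds \<open>poisson 1\<close> by a factor
  growing only linearly in \<open>t\<close>.\<close>

lemma neg_part_slab_step:
  assumes neg: "AE x in lborel. U 0 x < 0 \<longrightarrow> h x \<ge> 0" and s: "s > 0" and t: "t \<ge> 1"
  shows "(\<integral>\<^sup>+x. neg_part x * ennreal (pot_slab t x) \<partial>lborel)
    \<le> (\<integral>\<^sup>+x. neg_part x * ennreal (pot_slab (t + s) x) \<partial>lborel)
       + ennreal (2 * pot_rate DIM('a) * t) * (\<integral>\<^sup>+x. ennreal (poisson 1 x) * defect s x \<partial>lborel)"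
proof -
  have "(\<integral>\<^sup>+x. neg_part x * ennreal (pot_slab t x) \<partial>lborel)
    \<le> (\<integral>\<^sup>+x. ennreal (pot_slab t x) * (\<integral>\<^sup>+y. ennreal (poisson s (x - y)) * neg_part y \<partial>lborel)
        + ennreal (pot_slab t x) * defect s x \<partial>lborel)"
    using kato[OF neg s]
    by (intro nn_integral_mono_AE, eventually_elim)
       (simp only: distrib_left[symmetric] mult.commute[of "neg_part x" "ennreal (pot_slab t x)" for x], intro mult_left_mono, simp_all)
  also have "\<dots> = (\<integral>\<^sup>+x. ennreal (pot_slab t x) * (\<integral>\<^sup>+y. ennreal (poisson s (x - y)) * neg_part y \<partial>lborel) \<partial>lborel)
        + (\<integral>\<^sup>+x. ennreal (pot_slab t x) * defect s x \<partial>lborel)"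
    by (intro nn_integral_add) measurable
  also have "(\<integral>\<^sup>+x. ennreal (pot_slab t x) * (\<integral>\<^sup>+y. ennreal (poisson s (x - y)) * neg_part y \<partial>lborel) \<partial>lborel)
     = (\<integral>\<^sup>+y. neg_part y * (\<integral>\<^sup>+x. ennreal (poisson s (y - x)) * ennreal (pot_slab t x) \<partial>lborel) \<partial>lborel)"
    by (intro nn_integral_poisson_adjoint) measurable
  also have "\<dots> = (\<integral>\<^sup>+y. neg_part y * ennreal (pot_slab (t + s) y) \<partial>lborel)"
    using poisson_conv_pot_slab[OF dim s, of t] t s by (simp add: ennreal_mult' add.commute)
  also have "(\<integral>\<^sup>+x. ennreal (pot_slab t x) * defect s x \<partial>lborel)
     \<le> (\<integral>\<^sup>+x. ennreal (2 * pot_rate DIM('a) * t) * (ennreal (poisson 1 x) * defect s x) \<partial>lborel)"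
  proof (intro nn_integral_mono)
    fix x :: 'a
    have "pot_slab t x \<le> 2 * pot_rate DIM('a) * poisson t x" by (rule pot_slab_le_poisson[OF dim t])
    also have "\<dots> \<le> 2 * pot_rate DIM('a) * (t * poisson 1 x)"
      using rate_pos t poisson_le_poisson[of 1 t t x] by (intro mult_left_mono) auto
    finally have "ennreal (pot_slab t x) \<le> ennreal (2 * pot_rate DIM('a) * t) * ennreal (poisson 1 x)"
      using rate_pos t by (subst ennreal_mult'[symmetric]) (auto intro!: ennreal_leI simp: mult_ac)
    then show "ennreal (pot_slab t x) * defect s x \<le> ennreal (2 * pot_rate DIM('a) * t) * (ennreal (poisson 1 x) * defect s x)"
      by (simp add: mult.assoc[symmetric] mult_right_mono)
  qed
  also have "\<dots> = ennreal (2 * pot_rate DIM('a) * t) * (\<integral>\<^sup>+x. ennreal (poisson 1 x) * defect s x \<partial>lborel)"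
    by (intro nn_integral_cmult) measurable
  finally show ?thesis by (simp add: add_mono)
qed

lemma neg_part_slab_mono:
  assumes neg: "AE x in lborel. U 0 x < 0 \<longrightarrow> h x \<ge> 0" and T: "T > 0"
  shows "(\<integral>\<^sup>+x. neg_part x * ennreal (pot_slab 1 x) \<partial>lborel)
    \<le> (\<integral>\<^sup>+x. neg_part x * ennreal (pot_slab (1 + T) x) \<partial>lborel)"
proof (rule ennreal_le_epsilon)
  fix e :: real assume e: "e > 0"
  let ?I = "\<lambda>t. \<integral>\<^sup>+x. neg_part x * ennreal (pot_slab t x) \<partial>lborel"
  \<comment> \<open>\<open>c\<close> bounds the linear factor of a single step for all times up to
    \<open>1 + T\<close>. With mean error \<open>s * (e / (c * T))\<close> each step costs at most
    \<open>s * e / T\<close>, so the \<open>J\<close> steps of length \<open>s = T / J\<close> cost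
    \<open>e\<close> in total.\<close>
  define c where "c = 2 * pot_rate DIM('a) * (1 + T)"
  have c: "c > 0" using rate_pos T by (simp add: c_def)
  obtain d where d: "d > 0" "\<And>s. 0 < s \<Longrightarrow> s < d \<Longrightarrow> (\<integral>\<^sup>+x. ennreal (poisson 1 x) * defect s x \<partial>lborel) \<le> ennreal (s * (e / (c * T)))"
    using defect_small[of "e / (c * T)"] e c T by auto
  obtain J :: nat where J: "real J > T / d" "J > 0"
    by (metis reals_Archimedean2 gr_zeroI less_le_trans of_nat_0 of_nat_less_iff not_less T d(1) divide_pos_pos less_asym)
  define s where "s = T / J"
  have s: "s > 0" "s < d" "J * s = T" using J T d by (auto simp: s_def field_simps)
  have "?I 1 \<le> ?I (1 + j * s) + ennreal (j * (s * e / T))" if "j \<le> J" for j :: nat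
    using that
  proof (induction j)
    case 0
    then show ?case by simp
  next
    case (Suc j)
    have jT: "j * s \<le> T" using Suc.prems s(1) unfolding s(3)[symmetric] by (intro mult_right_mono) auto
    have "ennreal (2 * pot_rate DIM('a) * (1 + j * s)) * (\<integral>\<^sup>+x. ennreal (poisson 1 x) * defect s x \<partial>lborel)
       \<le> ennreal c * ennreal (s * (e / (c * T)))"
      unfolding c_def using jT rate_pos by (intro mult_mono ennreal_leI d(2)[unfolded c_def] s mult_left_mono) auto
    also have "\<dots> = ennreal (s * e / T)"
      using c s e T by (subst ennreal_mult'[symmetric]) auto
    finally have 1: "ennreal (2 * pot_rate DIM('a) * (1 + j * s)) * (\<integral>\<^sup>+x. ennreal (poisson 1 x) * defect s x \<partial>lborel) \<le> ennreal (s * e / T)" .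
    have "?I (1 + j * s) \<le> ?I (1 + j * s + s) + ennreal (s * e / T)"
      using neg_part_slab_step[OF neg s(1), of "1 + j * s"] 1 s(1) 
      by (meson add_left_mono le_add_same_cancel1 mult_nonneg_nonneg of_nat_0_le_iff less_imp_le order_trans)
    then have "?I 1 \<le> (?I (1 + j * s + s) + ennreal (s * e / T)) + ennreal (j * (s * e / T))"
      using Suc by (meson Suc_leD add_right_mono order_trans)
    also have "\<dots> = ?I (1 + Suc j * s) + ennreal (Suc j * (s * e / T))"
      using s e T by (simp add: add.assoc ennreal_plus[symmetric] algebra_simps add_divide_distrib del: ennreal_plus)
    finally show ?case .
  qed
  from this[of J] have "?I 1 \<le> ?I (1 + T) + ennreal (J * (s * e / T))" by (simp add: s(3))
  moreover have "J * (s * e / T) = e"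
    using s(3) T by (simp add: field_simps)
  ultimately show "?I 1 \<le> ?I (1 + T) + ennreal e" by simp
qed

text \<open>\<open>neg_part\<close> is at most \<open>Z\<close>, and the slab weight is bounded by a
  Poisson kernel, whose action on \<open>Z\<close> is an interior potential of \<open>|h|\<close> at
  height \<open>t\<close>. Such potentials vanish as \<open>t\<close> grows.\<close>

lemma neg_part_slab_bound:
  assumes t: "t \<ge> 1"
  shows "(\<integral>\<^sup>+x. neg_part x * ennreal (pot_slab t x) \<partial>lborel)
    \<le> ennreal (2 * pot_rate DIM('a)) * (\<integral>\<^sup>+y. ennreal (pot t y) * ennreal \<bar>h y\<bar> \<partial>lborel)"
proof -
  have "(\<integral>\<^sup>+x. neg_part x * ennreal (pot_slab t x) \<partial>lborel)
     \<le> (\<integral>\<^sup>+x. ennreal (2 * pot_rate DIM('a)) * (ennreal (poisson t (0 - x)) * Z x) \<partial>lborel)"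
  proof (intro nn_integral_mono)
    fix x :: 'a
    have "neg_part x \<le> Z x"
      unfolding neg_part_def by (rule order_trans[OF ennreal_leI abs_U_le_Z]) simp
    moreover have "ennreal (pot_slab t x) \<le> ennreal (2 * pot_rate DIM('a)) * ennreal (poisson t (0 - x))"
      using rate_pos t pot_slab_le_poisson[OF dim t, of x]
      by (subst ennreal_mult'[symmetric]) (auto intro!: ennreal_leI simp: poisson_even[of t 0 x, simplified])
    ultimately have "neg_part x * ennreal (pot_slab t x) \<le> Z x * (ennreal (2 * pot_rate DIM('a)) * ennreal (poisson t (0 - x)))"
      by (intro mult_mono) auto
    then show "neg_part x * ennreal (pot_slab t x) \<le> ennreal (2 * pot_rate DIM('a)) * (ennreal (poisson t (0 - x)) * Z x)"
      by (simp add: mult_ac)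
  qed
  also have "\<dots> = ennreal (2 * pot_rate DIM('a)) * (\<integral>\<^sup>+x. ennreal (poisson t (0 - x)) * Z x \<partial>lborel)"
    by (intro nn_integral_cmult) measurable
  also have "(\<integral>\<^sup>+x. ennreal (poisson t (0 - x)) * Z x \<partial>lborel) = (\<integral>\<^sup>+y. ennreal (pot t (0 - y)) * ennreal \<bar>h y\<bar> \<partial>lborel)"
    using t by (intro poisson_Z) auto
  finally show ?thesis by (simp add: pot_def)
qed

theorem domination:
  assumes neg: "AE x in lborel. U 0 x < 0 \<longrightarrow> h x \<ge> 0"
  shows "AE x in lborel. U 0 x \<ge> 0"
proof -
  let ?I = "\<lambda>t. \<integral>\<^sup>+x. neg_part x * ennreal (pot_slab t x) \<partial>lborel"
  have "(\<lambda>n. \<integral>\<^sup>+y. ennreal (pot (1 + real n) y) * ennreal \<bar>h y\<bar> \<partial>lborel) \<longlonglongrightarrow> (\<integral>\<^sup>+y. 0 \<partial>(lborel :: 'a measure))"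
  proof (rule nn_integral_dominated_convergence[where w = "\<lambda>y. ennreal (pot 1 y) * ennreal \<bar>h y\<bar>"])
    show "(\<integral>\<^sup>+y. ennreal (pot 1 y) * ennreal \<bar>h y\<bar> \<partial>lborel) < \<infinity>"
      using fin[of 1 0] by (simp add: pot_def)
    show "AE y in lborel. ennreal (pot (1 + real n) y) * ennreal \<bar>h y\<bar> \<le> ennreal (pot 1 y) * ennreal \<bar>h y\<bar>" for n
      by (intro AE_I2 mult_right_mono ennreal_leI pot_antimono) auto
    show "AE y in lborel. (\<lambda>n. ennreal (pot (1 + real n) y) * ennreal \<bar>h y\<bar>) \<longlonglongrightarrow> 0"
    proof (intro AE_I2)
      fix y :: 'a
      define a where "a = real (DIM('a) - 1) / 2"
      have a: "a > 0" using dim by (simp add: a_def)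
      define b where "b = (norm y)\<^sup>2"
      have b: "b \<ge> 0" by (simp add: b_def)
      have "(\<lambda>n. (b + (1 + real n)\<^sup>2) powr (- a)) \<longlonglongrightarrow> 0"
        using a b by real_asymp
      then have "(\<lambda>n. pot (1 + real n) y * \<bar>h y\<bar>) \<longlonglongrightarrow> 0 * \<bar>h y\<bar>"
        unfolding pot_def a_def b_def by (intro tendsto_intros)
      then show "(\<lambda>n. ennreal (pot (1 + real n) y) * ennreal \<bar>h y\<bar>) \<longlonglongrightarrow> 0"
        by (simp add: ennreal_mult'[symmetric] tendsto_ennrealI[where x=0, simplified])
    qed
  qed auto
  then have "(\<lambda>n. ennreal (2 * pot_rate DIM('a)) * (\<integral>\<^sup>+y. ennreal (pot (1 + real n) y) * ennreal \<bar>h y\<bar> \<partial>lborel)) \<longlonglongrightarrow> ennreal (2 * pot_rate DIM('a)) * 0"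
    by (intro tendsto_mult_ennreal) auto
  moreover have "?I 1 \<le> ennreal (2 * pot_rate DIM('a)) * (\<integral>\<^sup>+y. ennreal (pot (1 + real n) y) * ennreal \<bar>h y\<bar> \<partial>lborel)" if "n \<ge> 1" for n
  proof -
    have "?I 1 \<le> ?I (1 + real n)" using that by (intro neg_part_slab_mono[OF neg]) auto
    also have "\<dots> \<le> ennreal (2 * pot_rate DIM('a)) * (\<integral>\<^sup>+y. ennreal (pot (1 + real n) y) * ennreal \<bar>h y\<bar> \<partial>lborel)"
      by (intro neg_part_slab_bound) auto
    finally show ?thesis .
  qed
  ultimately have "?I 1 \<le> ennreal (2 * pot_rate DIM('a)) * 0"
    by (intro LIMSEQ_le_const) auto
  then have "?I 1 = 0" by simp
  then have "AE x in lborel. neg_part x * ennreal (pot_slab 1 x) = 0"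
    by (subst (asm) nn_integral_0_iff_AE) auto
  then show ?thesis
  proof eventually_elim
    case (elim x)
    then have "neg_part x = 0" using pot_slab_pos[OF dim, of 1 x] by simp
    then show ?case by (simp add: neg_part_def ennreal_eq_0_iff)
  qed
qed

text \<open>Strong maximum principle: at an interior point the value is an average of the boundary
  values with a strictly positive kernel, so one non-positive interior value forces the boundary
  values to vanish almost everywhere.\<close>

lemma U_positive:
  assumes nn: "AE x in lborel. U 0 x \<ge> 0" and t: "t > 0" and x: "U t x \<le> 0"
  shows "AE y in lborel. U 0 y = 0"
proof -
  have nn': "AE y in lborel. 0 \<le> poisson t (x - y) * U 0 y"
    using nn by eventually_elim (use t in auto)
  have "(\<integral>y. poisson t (x - y) * U 0 y \<partial>lborel) = 0"
    using x integral_nonneg_AE[OF nn'] unfolding U_eq_poisson[OF t] by linarith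
  then have "AE y in lborel. poisson t (x - y) * U 0 y = 0"
    using integral_nonneg_eq_0_iff_AE[OF integrable_poisson_U[OF t] nn'] by simp
  then show ?thesis
  proof eventually_elim
    case (elim y)
    then show ?case using poisson_pos[OF t, of "x - y"] by simp
  qed
qed

end

section \<open>Mild solutions\<close>

lemma orthogonal_transformation_continuous:
  fixes T :: "'a::euclidean_space \<Rightarrow> 'a"
  assumes "orthogonal_transformation T"
  shows "continuous_on S T"
  using assms linear_continuous_on linear_conv_bounded_linear orthogonal_transformation_linear by blast

text \<open>By Vitali's covering theorem an open set is, up to a null set, a disjoint union of balls, and
  these are mapped to balls of the same volume.\<close>

lemma emeasure_orthogonal_vimage_ge:
  fixes T :: "'a::euclidean_space \<Rightarrow> 'a"
  assumes T: "orthogonal_transformation T" and S: "open S"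
  shows "emeasure lborel S \<le> emeasure lborel (T -` S)"
proof -
  have ball: "T -` ball a r = ball (inv T a) r" for a r
  proof -
    have "dist a (T x) = dist (inv T a) x" for x
    proof -
      have "dist (T (inv T a)) (T x) = dist (inv T a) x"
        using T unfolding orthogonal_transformation_isometry by blast
      then show ?thesis by (simp add: surj_f_inv_f orthogonal_transformation_surj[OF T])
    qed
    then show ?thesis by auto
  qed
  have TS: "open (T -` S)"
    using S orthogonal_transformation_continuous[OF T] by (intro open_vimage) auto
  define K where "K = {p :: 'a \<times> real. ball (fst p) (snd p) \<subseteq> S}"
  have "\<exists>i. i \<in> K \<and> x \<in> ball (fst i) (snd i) \<and> snd i < d" if xd: "x \<in> S" "d > 0" for x d
  proof -
    obtain e where e: "e > 0" "ball x e \<subseteq> S" using S xd by (meson open_contains_ball)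
    then have "ball x (min e (d/2)) \<subseteq> S" using subset_ball[of "min e (d/2)" e x] by auto
    then show ?thesis using e xd by (intro exI[of _ "(x, min e (d/2))"]) (auto simp: K_def)
  qed
  then obtain C where C: "countable C" "C \<subseteq> K"
     "pairwise (\<lambda>i j. disjnt (ball (fst i) (snd i)) (ball (fst j) (snd j))) C"
     "negligible (S - (\<Union>i\<in>C. ball (fst i) (snd i)))"
    by (rule Vitali_covering_theorem_balls)
  define B where "B = (\<lambda>i :: 'a \<times> real. ball (fst i) (snd i))"
  have disj: "disjoint_family_on B C"
    using C(3) by (auto simp: disjoint_family_on_def pairwise_def disjnt_def B_def)
  then have disj': "disjoint_family_on (\<lambda>i. T -` B i) C"
    unfolding disjoint_family_on_def by blast
  have meas: "B i \<in> sets borel" "T -` B i \<in> sets borel" for i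
    by (auto simp: B_def ball)
  have nul: "S - (\<Union>i\<in>C. B i) \<in> null_sets lborel"
  proof -
    have "S - (\<Union>i\<in>C. B i) \<in> sets borel" using S C(1) meas by (intro sets.Diff sets.countable_UN') auto
    then show ?thesis using C(4)
      by (simp add: negligible_iff_null_sets null_sets_completion_iff B_def)
  qed
  have "emeasure lborel S \<le> emeasure lborel ((\<Union>i\<in>C. B i) \<union> (S - (\<Union>i\<in>C. B i)))"
    using S C(1) meas by (intro emeasure_mono sets.Un sets.Diff sets.countable_UN') auto
  also have "\<dots> = emeasure lborel (\<Union>i\<in>C. B i)"
    using C(1) meas nul by (intro emeasure_Un_null_set sets.countable_UN') auto
  also have "\<dots> = (\<integral>\<^sup>+i. emeasure lborel (B i) \<partial>count_space C)"
    using C(1) meas disj by (intro emeasure_UN_countable) auto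
  also have "\<dots> = (\<integral>\<^sup>+i. emeasure lborel (T -` B i) \<partial>count_space C)"
  proof (intro nn_integral_cong)
    fix i :: "'a \<times> real"
    show "emeasure lborel (B i) = emeasure lborel (T -` B i)"
      unfolding B_def ball by (cases "snd i \<ge> 0") (simp_all add: emeasure_ball ball_empty)
  qed
  also have "\<dots> = emeasure lborel (\<Union>i\<in>C. T -` B i)"
    using C(1) meas disj' by (intro emeasure_UN_countable[symmetric]) auto
  also have "\<dots> \<le> emeasure lborel (T -` S)"
    using C(2) TS by (intro emeasure_mono) (auto simp: B_def K_def)
  finally show ?thesis .
qed

lemma lborel_distr_orthogonal:
  fixes T :: "'a::euclidean_space \<Rightarrow> 'a"
  assumes T: "orthogonal_transformation T"
  shows "distr lborel borel T = lborel"
proof (rule lborel_eqI[symmetric])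
  have [measurable]: "T \<in> borel_measurable borel"
    by (intro borel_measurable_continuous_onI orthogonal_transformation_continuous T)
  fix l u :: 'a assume lu: "\<And>b. b \<in> Basis \<Longrightarrow> l \<bullet> b \<le> u \<bullet> b"
  have T': "orthogonal_transformation (inv T)" using T by (rule orthogonal_transformation_inv)
  have "T \<circ> inv T = id" using orthogonal_transformation_surj[OF T] surj_iff by blast
  then have "inv T -` (T -` box l u) = box l u"
    by (metis vimage_comp vimage_id id_apply)
  moreover have "open (T -` box l u)"
    using orthogonal_transformation_continuous[OF T] by (intro open_vimage) auto
  \<comment> \<open>The one-sided estimate is used twice: for \<open>T\<close> and the box, and for
    \<open>inv T\<close> and the preimage of the box, whose preimage under \<open>inv T\<close> is
    the box again.\<close>
  ultimately have "emeasure lborel (T -` box l u) = emeasure lborel (box l u)"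
    using emeasure_orthogonal_vimage_ge[OF T open_box, of l u] emeasure_orthogonal_vimage_ge[OF T', of "T -` box l u"]
    by (intro antisym) auto
  then show "emeasure (distr lborel borel T) (box l u) = (\<Prod>b\<in>Basis. (u - l) \<bullet> b)"
    using lu by (simp add: emeasure_distr)
qed simp

lemma lebesgue_distr_orthogonal:
  fixes T :: "'a::euclidean_space \<Rightarrow> 'a"
  assumes T: "orthogonal_transformation T"
  shows "T \<in> lebesgue \<rightarrow>\<^sub>M lebesgue" "distr lebesgue lebesgue T = lebesgue"
proof -
  have Tb [measurable]: "T \<in> borel_measurable borel"
    by (intro borel_measurable_continuous_onI orthogonal_transformation_continuous T)
  then have Tl: "T \<in> lebesgue \<rightarrow>\<^sub>M lborel" by (simp add: measurable_completion)
  have d: "distr lebesgue lborel T = lborel"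
  proof -
    have "distr lebesgue lborel T = distr lborel lborel T"
      using Tb by (intro distr_completion) auto
    also have "\<dots> = lborel"
      using lborel_distr_orthogonal[OF T] by (metis distr_cong sets_lborel)
    finally show ?thesis .
  qed
  show "T \<in> lebesgue \<rightarrow>\<^sub>M lebesgue"
    using completion.measurable_completion2[OF Tl] d by simp
  show "distr lebesgue lebesgue T = lebesgue"
    using completion.completion_distr_eq[OF Tl] d by simp
qed

section \<open>The boundary operator as a potential of a Borel density\<close>

lemma N_kernel_eq_pot:
  fixes x :: "(real^'m) \<times> real"
  shows "N_kernel C x y = C * pot (snd x) (fst x - y)"
proof -
  have "real (CARD('m) - 1) = real CARD('m) - 1" by (simp add: of_nat_diff Suc_leI)
  \<comment> \<open>The identity includes the singular point, where both sides are 0 by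
    \<open>0 powr a = 0\<close> and division by zero.\<close>
  then show ?thesis unfolding N_kernel_def pot_def powr_minus divide_inverse[of C] by simp
qed

text \<open>The data are Lebesgue measurable, whereas the kernel calculus lives on
  \<open>lborel\<close> with its product measures. Changing the density on a null set leaves every
  value of the operator intact, including boundary values.\<close>

lemma N_op_borel_version:
  fixes g g' :: "real^'m \<Rightarrow> real"
  assumes g: "g \<in> borel_measurable lebesgue" "g' \<in> borel_measurable borel" "AE y in lborel. g y = g' y"
  shows "N_op C g x = C * (\<integral>y. pot (snd x) (fst x - y) * g' y \<partial>lborel)"
    and "C \<noteq> 0 \<Longrightarrow> N_integrable C g x \<longleftrightarrow> integrable lborel (\<lambda>y. pot (snd x) (fst x - y) * g' y)"
proof -
  have [measurable]: "g' \<in> borel_measurable borel" by fact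
  have m [measurable]: "(\<lambda>y. pot (snd x) (fst x - y)) \<in> borel_measurable lebesgue"
    by (intro measurable_completion) measurable
  have [measurable]: "g' \<in> borel_measurable lebesgue" "g \<in> borel_measurable lebesgue"
    using g by (auto intro!: measurable_completion)
  have ae: "AE y in lebesgue. N_kernel C x y * g y = C * (pot (snd x) (fst x - y) * g' y)"
    using AE_completion[OF g(3)] by eventually_elim (simp add: N_kernel_eq_pot)
  have "N_op C g x = (\<integral>y. C * (pot (snd x) (fst x - y) * g' y) \<partial>lebesgue)"
    unfolding N_op_def using ae by (intro integral_cong_AE) (auto simp: N_kernel_eq_pot)
  then show "N_op C g x = C * (\<integral>y. pot (snd x) (fst x - y) * g' y \<partial>lborel)"
    by (simp add: integral_completion)
  have "N_integrable C g x \<longleftrightarrow> integrable lebesgue (\<lambda>y. C * (pot (snd x) (fst x - y) * g' y))"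
    unfolding N_integrable_def using ae by (intro integrable_cong_AE) (auto simp: N_kernel_eq_pot)
  also have "\<dots> \<longleftrightarrow> integrable lborel (\<lambda>y. C * (pot (snd x) (fst x - y) * g' y))"
    by (intro integrable_completion) measurable
  finally show "N_integrable C g x \<longleftrightarrow> integrable lborel (\<lambda>y. pot (snd x) (fst x - y) * g' y)" if "C \<noteq> 0"
    using that by simp
qed

lemma lebesgue_borel_version:
  fixes g :: "'a::euclidean_space \<Rightarrow> real"
  assumes "g \<in> borel_measurable lebesgue"
  obtains g' where "g' \<in> borel_measurable borel" "AE y in lborel. g y = g' y"
  using completion_ex_borel_measurable_real[OF assms] by auto

text \<open>Where the boundary integral diverges, the Bochner integral has the value 0, and the
  dependence on \<open>x\<close> stays measurable. This covers Picard iterates, whose convergence at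
  boundary points is not known.\<close>

lemma trace_N_op_measurable:
  fixes g :: "real^'m \<Rightarrow> real"
  assumes g: "g \<in> borel_measurable lebesgue"
  shows "trace0 (N_op C g) \<in> borel_measurable lebesgue"
proof -
  obtain g' where g' [measurable]: "g' \<in> borel_measurable borel" and ae: "AE y in lborel. g y = g' y"
    using lebesgue_borel_version[OF g] .
  have "trace0 (N_op C g) = (\<lambda>x. C * (\<integral>y. pot 0 (x - y) * g' y \<partial>lborel))"
    using N_op_borel_version(1)[OF g g' ae] by (auto simp: trace0_def fun_eq_iff)
  also have "\<dots> \<in> borel_measurable lebesgue"
    by (intro measurable_completion) measurable
  finally show ?thesis .
qed

lemma trace_picard_measurable:
  fixes f V b :: "real^'m \<Rightarrow> real"
  assumes [measurable]: "f \<in> borel_measurable lebesgue" "V \<in> borel_measurable lebesgue" "b \<in> borel_measurable lebesgue"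
  shows "trace0 (picard C \<rho> f V b k) \<in> borel_measurable lebesgue"
proof (induction k)
  case 0
  then show ?case by (simp add: trace_N_op_measurable)
next
  case (Suc k)
  note [measurable] = Suc.IH
  have "trace0 (picard C \<rho> f V b (Suc k)) = (\<lambda>x. trace0 (N_op C f) x
     + trace0 (N_op C (\<lambda>y. V y * trace0 (picard C \<rho> f V b k) y)) x
     + trace0 (N_op C (nonlin \<rho> b (trace0 (picard C \<rho> f V b k)))) x)"
    by (simp add: fun_eq_iff trace0_def mild_rhs_def)
  moreover have [measurable]: "nonlin \<rho> b (trace0 (picard C \<rho> f V b k)) \<in> borel_measurable lebesgue"
    unfolding nonlin_def[abs_def] by measurable
  ultimately show ?case
    by (simp only:) (intro borel_measurable_add trace_N_op_measurable; measurable)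
qed

section \<open>Sign and symmetry under the operator and along the Picard iteration\<close>

lemma N_op_nonneg:
  assumes "C \<ge> 0" "AE y in lebesgue. g y \<ge> 0"
  shows "N_op C g x \<ge> 0"
  unfolding N_op_def
proof (rule integral_nonneg_AE)
  show "AE y in lebesgue. 0 \<le> N_kernel C x y * g y"
    using assms(2) by eventually_elim (use assms(1) in \<open>simp add: N_kernel_eq_pot\<close>)
qed

lemma N_op_pos:
  fixes g :: "real^'m \<Rightarrow> real"
  assumes C: "C > 0" and nn: "\<And>y. g y \<ge> 0" and int: "N_integrable C g x" and x: "x \<in> half_space"
    and D: "D \<in> sets lebesgue" "emeasure lebesgue D > 0" "\<And>y. y \<in> D \<Longrightarrow> g y > 0"
  shows "N_op C g x > 0"
proof (rule ccontr)
  have k: "N_kernel C x y > 0" for y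
    using C x pot_pos[of "snd x" "fst x - y"] by (simp add: N_kernel_eq_pot half_space_def)
  assume "\<not> N_op C g x > 0"
  with N_op_nonneg[of C g x] C nn have "N_op C g x = 0" by simp
  then have "AE y in lebesgue. N_kernel C x y * g y = 0"
    using int k nn unfolding N_op_def N_integrable_def
    by (subst (asm) integral_nonneg_eq_0_iff_AE) (auto simp: less_imp_le)
  then have "AE y in lebesgue. y \<notin> D"
    by eventually_elim (use k D(3) in \<open>fastforce dest: less_imp_neq\<close>)
  then have "D \<in> null_sets lebesgue" using D(1) by (subst AE_iff_null_sets) auto
  with D(2) show False by auto
qed

text \<open>Non-negativity passes through every integral, and a divergent one contributes its
  default value 0, so the induction covers all points, boundary included.\<close>

lemma picard_nonneg:
  assumes "C \<ge> 0" "\<And>y. f y \<ge> 0" "\<And>y. V y \<ge> 0" "\<And>y. b y \<ge> 0"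
  shows "picard C \<rho> f V b k x \<ge> 0"
proof (induction k arbitrary: x)
  case 0
  then show ?case using assms by (simp add: N_op_nonneg)
next
  case (Suc k)
  then have "nonlin \<rho> b (trace0 (picard C \<rho> f V b k)) y \<ge> 0" for y
    using assms by (simp add: nonlin_def trace0_def)
  then show ?case using assms Suc
    by (simp add: mild_rhs_def) (intro add_nonneg_nonneg N_op_nonneg; simp add: trace0_def)
qed

lemma N_op_rotate:
  fixes g :: "real^'m \<Rightarrow> real" and T :: "real^'m \<Rightarrow> real^'m"
  assumes T: "orthogonal_transformation T" and g: "g \<in> borel_measurable lebesgue"
  shows "N_op C g (T x', t) = N_op C (\<lambda>y. g (T y)) (x', t)"
proof -
  note [measurable] = lebesgue_distr_orthogonal(1)[OF T] g
  have [measurable]: "(\<lambda>y. pot t (T x' - y)) \<in> borel_measurable lebesgue"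
    by (intro measurable_completion) measurable
  have "N_op C g (T x', t) = (\<integral>y. C * pot t (T x' - y) * g y \<partial>distr lebesgue lebesgue T)"
    by (simp add: N_op_def N_kernel_eq_pot lebesgue_distr_orthogonal(2)[OF T])
  also have "\<dots> = (\<integral>y. C * pot t (T x' - T y) * g (T y) \<partial>lebesgue)"
    by (intro integral_distr) measurable
  also have "\<dots> = N_op C (\<lambda>y. g (T y)) (x', t)"
  proof -
    have "T x' - T y = T (x' - y)" for y
      using T by (simp add: linear_diff orthogonal_transformation_linear)
    then have "pot t (T x' - T y) = pot t (x' - y)" for y
      using T by (simp add: pot_def orthogonal_transformation_norm)
    then show ?thesis by (simp add: N_op_def N_kernel_eq_pot)
  qed
  finally show ?thesis .
qed

lemma N_op_cmult: "N_op C (\<lambda>y. s * g y) x = s * N_op C g x"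
proof -
  have "N_kernel C x y * (s * g y) = s * (N_kernel C x y * g y)" for y by simp
  then show ?thesis unfolding N_op_def by (simp only: integral_mult_right_zero)
qed

lemma N_op_cong_AE:
  assumes "g \<in> borel_measurable lebesgue" "h \<in> borel_measurable lebesgue" "AE y in lebesgue. g y = h y"
  shows "N_op C g x = N_op C h (x :: (real^'m) \<times> real)"
proof -
  have [measurable]: "(\<lambda>y. pot (snd x) (fst x - y)) \<in> borel_measurable lebesgue"
    by (intro measurable_completion) measurable
  have [measurable]: "g \<in> borel_measurable lebesgue" "h \<in> borel_measurable lebesgue" by fact+
  show ?thesis unfolding N_op_def N_kernel_eq_pot
  proof (rule integral_cong_AE)
    show "AE y in lebesgue. C * pot (snd x) (fst x - y) * g y = C * pot (snd x) (fst x - y) * h y"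
      using assms(3) by eventually_elim simp
  qed measurable
qed

text \<open>The power nonlinearity is odd in \<open>w\<close>; this is what lets antisymmetry, the
  case \<open>s = - 1\<close>, survive an iteration step.\<close>

lemma nonlin_sign:
  assumes "s = 1 \<or> s = - 1" "b y = b' y'" "w y = s * w' y'"
  shows "nonlin \<rho> b w y = s * nonlin \<rho> b' w' y'"
  using assms by (auto simp: nonlin_def)

text \<open>The symmetry of the trace is assumed only almost everywhere, which is all that a limit
  in measure yields, yet the conclusion holds at every point because the operator ignores null sets.
  It thus serves both the iterates and the solution.\<close>

lemma mild_rhs_rotate:
  fixes f V b :: "real^'m \<Rightarrow> real" and T :: "real^'m \<Rightarrow> real^'m"
  assumes T: "orthogonal_transformation T" and s: "s = 1 \<or> s = - 1"
    and [measurable]: "f \<in> borel_measurable lebesgue" "V \<in> borel_measurable lebesgue" "b \<in> borel_measurable lebesgue"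
      "trace0 w \<in> borel_measurable lebesgue"
    and rad: "radial V" "radial b" and f: "\<And>y. f (T y) = s * f y"
    and w: "AE y in lebesgue. trace0 w (T y) = s * trace0 w y"
  shows "mild_rhs C \<rho> f V b w (T x', t) = s * mild_rhs C \<rho> f V b w (x', t)"
proof -
  note [measurable] = lebesgue_distr_orthogonal(1)[OF T]
  have Vb: "V (T y) = V y" "b (T y) = b y" for y
    using rad orthogonal_transformation_norm[OF T, of y] unfolding radial_def by blast+
  have [measurable]: "nonlin \<rho> b (trace0 w) \<in> borel_measurable lebesgue"
    unfolding nonlin_def[abs_def] by measurable
  have "N_op C f (T x', t) = s * N_op C f (x', t)"
    by (simp add: N_op_rotate[OF T] f N_op_cmult)
  moreover have "N_op C (\<lambda>y. V y * trace0 w y) (T x', t) = s * N_op C (\<lambda>y. V y * trace0 w y) (x', t)"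
  proof -
    have "N_op C (\<lambda>y. V y * trace0 w y) (T x', t) = N_op C (\<lambda>y. V (T y) * trace0 w (T y)) (x', t)"
      by (rule N_op_rotate[OF T]) measurable
    also have "\<dots> = N_op C (\<lambda>y. s * (V y * trace0 w y)) (x', t)"
    proof (rule N_op_cong_AE)
      show "AE y in lebesgue. V (T y) * trace0 w (T y) = s * (V y * trace0 w y)"
        using w by eventually_elim (simp add: Vb)
    qed measurable
    finally show ?thesis by (simp add: N_op_cmult)
  qed
  moreover have "N_op C (nonlin \<rho> b (trace0 w)) (T x', t) = s * N_op C (nonlin \<rho> b (trace0 w)) (x', t)"
  proof -
    have "N_op C (nonlin \<rho> b (trace0 w)) (T x', t) = N_op C (\<lambda>y. nonlin \<rho> b (trace0 w) (T y)) (x', t)"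
      by (rule N_op_rotate[OF T]) measurable
    also have "\<dots> = N_op C (\<lambda>y. s * nonlin \<rho> b (trace0 w) y) (x', t)"
    proof (rule N_op_cong_AE)
      show "AE y in lebesgue. nonlin \<rho> b (trace0 w) (T y) = s * nonlin \<rho> b (trace0 w) y"
        using w by eventually_elim (rule nonlin_sign[OF s], simp_all add: Vb)
    qed measurable
    finally show ?thesis by (simp add: N_op_cmult)
  qed
  ultimately show ?thesis by (simp add: mild_rhs_def distrib_left)
qed

lemma picard_rotate:
  fixes f V b :: "real^'m \<Rightarrow> real" and T :: "real^'m \<Rightarrow> real^'m"
  assumes T: "orthogonal_transformation T" and s: "s = 1 \<or> s = - 1"
    and m [measurable]: "f \<in> borel_measurable lebesgue" "V \<in> borel_measurable lebesgue" "b \<in> borel_measurable lebesgue"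
    and rad: "radial V" "radial b" and f: "\<And>y. f (T y) = s * f y"
  shows "picard C \<rho> f V b k (T x', t) = s * picard C \<rho> f V b k (x', t)"
proof (induction k arbitrary: x' t)
  case 0
  show ?case by (simp add: N_op_rotate[OF T] f N_op_cmult)
next
  case (Suc k)
  then show ?case
    by (simp only: picard.simps) (intro mild_rhs_rotate[OF T s] m rad f trace_picard_measurable AE_I2, simp add: trace0_def)
qed

section \<open>From convergence in the weak Morrey norm to convergence in measure\<close>

lemma sets_lebesgue_ball_superlevel:
  fixes e :: "'a::euclidean_space \<Rightarrow> real"
  assumes [measurable]: "e \<in> borel_measurable lebesgue"
  shows "{y \<in> ball z R. e y > s} \<in> sets lebesgue"
proof -
  have "{y \<in> ball z R. e y > s} = ball z R \<inter> {y \<in> space lebesgue. e y > s}" by auto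
  also have "\<dots> \<in> sets lebesgue"
  proof (rule sets.Int)
    show "{y \<in> space lebesgue. e y > s} \<in> sets lebesgue" by measurable
  qed simp
  finally show ?thesis .
qed

text \<open>A weak-type Chebyshev inequality on one ball: if the superlevel set at height
  \<open>s\<close> has measure above \<open>t\<close>, then no height below \<open>s\<close> is
  admissible in the infimum defining the rearrangement at \<open>t\<close>.\<close>

lemma weak_morrey_norm_ge:
  fixes d :: "'a::euclidean_space \<Rightarrow> real"
  assumes [measurable]: "d \<in> borel_measurable lebesgue"
    and R: "R > 0" and s: "s \<ge> 0" and t: "t > 0"
    and gt: "emeasure lebesgue {y \<in> ball z R. \<bar>d y\<bar> > s} > ennreal t"
  shows "weak_morrey_norm lam q d UNIV
    \<ge> ennreal (measure lebesgue (ball z R) powr (1/lam - 1/q)) * (ennreal (t powr (1/q)) * ennreal s)"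
proof -
  have "ennreal s \<le> decr_rearr d (ball z R) t"
    unfolding decr_rearr_def
  proof (rule Inf_greatest, safe)
    fix s' assume s': "s' \<ge> 0" "emeasure lebesgue {x \<in> ball z R. s' < \<bar>d x\<bar>} \<le> ennreal t"
    show "ennreal s \<le> ennreal s'"
    proof (rule ccontr)
      assume "\<not> ennreal s \<le> ennreal s'"
      then have "s' < s" using s' s by (metis ennreal_leI not_le)
      then have "emeasure lebesgue {x \<in> ball z R. s < \<bar>d x\<bar>} \<le> emeasure lebesgue {x \<in> ball z R. s' < \<bar>d x\<bar>}"
        by (intro emeasure_mono sets_lebesgue_ball_superlevel) auto
      with gt s'(2) show False by (meson leD less_le_trans order_trans)
    qed
  qed
  then have "ennreal (t powr (1/q)) * ennreal s \<le> weak_L_norm q d (ball z R)"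
    unfolding weak_L_norm_def using t by (intro SUP_upper2[of t] mult_left_mono) auto
  then show ?thesis
    unfolding weak_morrey_norm_def using R
    by (intro SUP_upper2[of z] SUP_upper2[of R]) (auto intro!: mult_left_mono)
qed

lemma A_norm_tendsto_trace_measure:
  fixes u :: "(real^'m) \<times> real \<Rightarrow> real"
  assumes lim: "(\<lambda>k. A_norm mu lam r q (\<lambda>x. p k x - u x)) \<longlonglongrightarrow> 0"
    and m: "\<And>k. trace0 (p k) \<in> borel_measurable lebesgue" "trace0 u \<in> borel_measurable lebesgue"
    and R: "R > 0" and s: "s > 0" and t: "t > 0"
  obtains k where "emeasure lebesgue {y \<in> ball 0 R. \<bar>trace0 (p k) y - trace0 u y\<bar> > s} \<le> ennreal t"
proof -
  \<comment> \<open>\<open>c\<close> is the lower bound that \<open>weak_morrey_norm_ge\<close>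
    gives if the superlevel set were too large. It is positive since the ball has positive volume,
    whatever the sign of the exponent.\<close>
  define c where "c = measure lebesgue (ball (0::real^'m) R) powr (1/lam - 1/q) * (t powr (1/q) * s)"
  have "measure lebesgue (ball (0::real^'m) R) > 0" using content_ball_pos[OF R] by (simp add: measure_completion)
  then have c: "c > 0" using s t by (simp add: c_def)
  then have "\<forall>\<^sub>F k in sequentially. A_norm mu lam r q (\<lambda>x. p k x - u x) < ennreal c"
    by (intro order_tendstoD(2)[OF lim]) auto
  then obtain k where k: "A_norm mu lam r q (\<lambda>x. p k x - u x) < ennreal c"
    by (auto simp: eventually_sequentially)
  have tr: "trace0 (\<lambda>x. p k x - u x) = (\<lambda>y. trace0 (p k) y - trace0 u y)"
    by (simp add: trace0_def fun_eq_iff)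
  have "weak_morrey_norm lam q (\<lambda>y. trace0 (p k) y - trace0 u y) UNIV \<le> A_norm mu lam r q (\<lambda>x. p k x - u x)"
    unfolding A_norm_def tr by simp
  with k have lt: "weak_morrey_norm lam q (\<lambda>y. trace0 (p k) y - trace0 u y) UNIV < ennreal c" by simp
  show ?thesis
  proof (rule that[of k], rule ccontr)
    assume "\<not> emeasure lebesgue {y \<in> ball 0 R. \<bar>trace0 (p k) y - trace0 u y\<bar> > s} \<le> ennreal t"
    then have "ennreal (measure lebesgue (ball (0::real^'m) R) powr (1/lam - 1/q)) * (ennreal (t powr (1/q)) * ennreal s)
        \<le> weak_morrey_norm lam q (\<lambda>y. trace0 (p k) y - trace0 u y) UNIV"
      using R s t m by (intro weak_morrey_norm_ge) auto
    then have "ennreal c \<le> weak_morrey_norm lam q (\<lambda>y. trace0 (p k) y - trace0 u y) UNIV"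
      unfolding c_def using s by (simp add: ennreal_mult')
    with lt show False by simp
  qed
qed

lemma AE_nonpos_if_small_measure:
  fixes e :: "'a::euclidean_space \<Rightarrow> real"
  assumes [measurable]: "e \<in> borel_measurable lebesgue"
    and small: "\<And>R s t. R > 0 \<Longrightarrow> s > 0 \<Longrightarrow> t > 0 \<Longrightarrow> emeasure lebesgue {y \<in> ball 0 R. e y > s} \<le> ennreal t"
  shows "AE y in lebesgue. e y \<le> 0"
proof -
  have *: "AE y in lebesgue. \<not> (y \<in> ball 0 R \<and> e y > s)" if "R > 0" "s > 0" for R s
  proof (rule AE_I')
    have "emeasure lebesgue {y \<in> ball 0 R. e y > s} \<le> 0"
      by (rule ennreal_le_epsilon) (simp only: add_0, rule small, use that in auto)
    then show "{y \<in> ball 0 R. e y > s} \<in> null_sets lebesgue"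
      using sets_lebesgue_ball_superlevel[OF assms(1)] by (intro null_setsI) (simp_all only: le_zero_eq)
  qed auto
  have "AE y in lebesgue. \<not> (y \<in> ball 0 (Suc n) \<and> e y > 1 / Suc n)" for n :: nat
    by (rule *[of "real (Suc n)" "1 / real (Suc n)"]; simp)
  then have "AE y in lebesgue. \<forall>n. \<not> (y \<in> ball 0 (Suc n) \<and> e y > 1 / Suc n)"
    by (simp add: AE_all_countable)
  then show ?thesis
  proof eventually_elim
    case (elim y)
    show ?case
    proof (rule ccontr)
      assume e: "\<not> e y \<le> 0"
      obtain n :: nat where n: "real n > max (norm y) (1 / e y)" using reals_Archimedean2 by blast
      then have "y \<in> ball 0 (Suc n)" by simp
      moreover have "1 / Suc n < e y"
      proof -
        have "1 < e y * real (Suc n)" using n e by (simp add: field_simps)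
        then show ?thesis by (simp add: field_simps)
      qed
      ultimately show False using elim by blast
    qed
  qed
qed

text \<open>Wherever the limit lies below \<open>- s\<close>, a non-negative iterate differs from it
  by more than \<open>s\<close>, so these points lie in a set of small measure.\<close>

lemma trace_nonneg_limit:
  fixes u :: "(real^'m) \<times> real \<Rightarrow> real"
  assumes lim: "(\<lambda>k. A_norm mu lam r q (\<lambda>x. p k x - u x)) \<longlonglongrightarrow> 0"
    and m: "\<And>k. trace0 (p k) \<in> borel_measurable lebesgue" "trace0 u \<in> borel_measurable lebesgue"
    and nn: "\<And>k x. p k x \<ge> 0"
  shows "AE y in lebesgue. trace0 u y \<ge> 0"
proof -
  note [measurable] = m
  have "AE y in lebesgue. - trace0 u y \<le> 0"
  proof (rule AE_nonpos_if_small_measure)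
    fix R s t :: real assume "R > 0" "s > 0" "t > 0"
    then obtain k where k: "emeasure lebesgue {y \<in> ball 0 R. \<bar>trace0 (p k) y - trace0 u y\<bar> > s} \<le> ennreal t"
      using A_norm_tendsto_trace_measure[OF lim m] by blast
    have "emeasure lebesgue {y \<in> ball 0 R. - trace0 u y > s} \<le> emeasure lebesgue {y \<in> ball 0 R. \<bar>trace0 (p k) y - trace0 u y\<bar> > s}"
    proof (rule emeasure_mono)
      show "{y \<in> ball 0 R. \<bar>trace0 (p k) y - trace0 u y\<bar> > s} \<in> sets lebesgue"
        by (rule sets_lebesgue_ball_superlevel) measurable
      have "trace0 (p k) y \<ge> 0" for y using nn by (simp add: trace0_def)
      then show "{y \<in> ball 0 R. - trace0 u y > s} \<subseteq> {y \<in> ball 0 R. \<bar>trace0 (p k) y - trace0 u y\<bar> > s}"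
        by (smt (verit) Collect_mono)
    qed
    with k show "emeasure lebesgue {y \<in> ball 0 R. - trace0 u y > s} \<le> ennreal t" by simp
  qed measurable
  then show ?thesis by simp
qed

text \<open>The defect of symmetry at \<open>y\<close> is controlled by the approximation errors at
  \<open>y\<close> and at \<open>T y\<close>, hence half of \<open>s\<close> and half of
  \<open>t\<close> for each. The second exceptional set is a preimage under \<open>T\<close>, which
  preserves measure and centred balls.\<close>

lemma trace_rotate_limit:
  fixes u :: "(real^'m) \<times> real \<Rightarrow> real" and T :: "real^'m \<Rightarrow> real^'m"
  assumes lim: "(\<lambda>k. A_norm mu lam r q (\<lambda>x. p k x - u x)) \<longlonglongrightarrow> 0"
    and m: "\<And>k. trace0 (p k) \<in> borel_measurable lebesgue" "trace0 u \<in> borel_measurable lebesgue"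
    and T: "orthogonal_transformation T" and c: "c = 1 \<or> c = - 1"
    and pT: "\<And>k x' t. p k (T x', t) = c * p k (x', t)"
  shows "AE y in lebesgue. trace0 u (T y) = c * trace0 u y"
proof -
  note [measurable] = m lebesgue_distr_orthogonal(1)[OF T]
  have "AE y in lebesgue. \<bar>trace0 u (T y) - c * trace0 u y\<bar> \<le> 0"
  proof (rule AE_nonpos_if_small_measure)
    fix R s t :: real assume Rst: "R > 0" "s > 0" "t > 0"
    define s' where "s' = s / 2"
    obtain k where k: "emeasure lebesgue {y \<in> ball 0 R. \<bar>trace0 (p k) y - trace0 u y\<bar> > s'} \<le> ennreal (t / 2)"
      using A_norm_tendsto_trace_measure[OF lim m, of R s' "t / 2"] Rst unfolding s'_def
      by (meson half_gt_zero)
    let ?E = "{y \<in> ball 0 R. \<bar>trace0 (p k) y - trace0 u y\<bar> > s'}"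
    have E: "?E \<in> sets lebesgue"
      by (rule sets_lebesgue_ball_superlevel) measurable
    have TE: "T -` ?E \<in> sets lebesgue"
      using measurable_sets[OF lebesgue_distr_orthogonal(1)[OF T] E] by simp
    have "emeasure lebesgue ?E = emeasure (distr lebesgue lebesgue T) ?E"
      by (simp add: lebesgue_distr_orthogonal(2)[OF T])
    also have "\<dots> = emeasure lebesgue (T -` ?E)"
      using E by (subst emeasure_distr) (auto simp: lebesgue_distr_orthogonal(1)[OF T])
    finally have eT: "emeasure lebesgue (T -` ?E) = emeasure lebesgue ?E" by simp
    have "{y \<in> ball 0 R. \<bar>trace0 u (T y) - c * trace0 u y\<bar> > s} \<subseteq> ?E \<union> T -` ?E"
    proof
      fix y assume y: "y \<in> {y \<in> ball 0 R. \<bar>trace0 u (T y) - c * trace0 u y\<bar> > s}"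
      have "s' < \<bar>trace0 (p k) y - trace0 u y\<bar> \<or> s' < \<bar>trace0 (p k) (T y) - trace0 u (T y)\<bar>"
      proof -
        have "trace0 u (T y) - c * trace0 u y
            = c * (trace0 (p k) y - trace0 u y) - (trace0 (p k) (T y) - trace0 u (T y))"
          using pT[of k y 0] by (simp add: trace0_def algebra_simps)
        moreover have "\<bar>c * (trace0 (p k) y - trace0 u y)\<bar> = \<bar>trace0 (p k) y - trace0 u y\<bar>"
          using c by (auto simp: abs_mult)
        ultimately show ?thesis using y unfolding s'_def mem_Collect_eq by linarith
      qed
      then show "y \<in> ?E \<union> T -` ?E"
        using y by (auto simp: orthogonal_transformation_norm[OF T])
    qed
    then have "emeasure lebesgue {y \<in> ball 0 R. \<bar>trace0 u (T y) - c * trace0 u y\<bar> > s} \<le> emeasure lebesgue (?E \<union> T -` ?E)"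
      by (rule emeasure_mono[OF _ sets.Un[OF E TE]])
    also have "\<dots> \<le> emeasure lebesgue ?E + emeasure lebesgue (T -` ?E)"
      using E TE by (rule emeasure_subadditive)
    also have "\<dots> \<le> ennreal (t/2) + ennreal (t/2)"
      unfolding eT using k by (intro add_mono)
    also have "\<dots> = ennreal t" using Rst by (simp add: ennreal_plus[symmetric] del: ennreal_plus)
    finally show "emeasure lebesgue {y \<in> ball 0 R. \<bar>trace0 u (T y) - c * trace0 u y\<bar> > s} \<le> ennreal t" .
  qed measurable
  then show ?thesis by simp
qed

section \<open>Sign and symmetry of mild solutions\<close>

lemma N_integrable_finite_potential:
  fixes g :: "real^'m \<Rightarrow> real"
  assumes dim: "CARD('m) \<ge> 2" and C: "C > 0" and g: "g \<in> borel_measurable lebesgue"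
    and int: "\<And>x. x \<in> half_space \<Longrightarrow> N_integrable C g x"
  obtains g' where "finite_potential g'" "AE y in lborel. g y = g' y"
    "\<And>x t. N_op C g (x, t) = C * finite_potential.U g' t x"
proof -
  obtain g' where g' [measurable]: "g' \<in> borel_measurable borel" and ae: "AE y in lborel. g y = g' y"
    using lebesgue_borel_version[OF g] .
  have fp: "finite_potential g'"
  proof
    show "DIM(real^'m) \<ge> 2" using dim by simp
    show "g' \<in> borel_measurable borel" by fact
    fix x :: "real^'m" and t :: real assume "t > 0"
    then have "integrable lborel (\<lambda>y. pot t (x - y) * g' y)"
      using int[of "(x, t)"] C by (simp add: half_space_def N_op_borel_version(2)[OF g g' ae])
    then have "(\<integral>\<^sup>+y. ennreal (norm (pot t (x - y) * g' y)) \<partial>lborel) < \<infinity>"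
      by (simp add: integrable_iff_bounded)
    then show "(\<integral>\<^sup>+y. ennreal (pot t (x - y)) * ennreal \<bar>g' y\<bar> \<partial>lborel) < \<infinity>"
      by (simp add: abs_mult ennreal_mult')
  qed
  show ?thesis
    by (rule that[OF fp ae]) (simp add: N_op_borel_version(1)[OF g g' ae] finite_potential.U_def[OF fp])
qed

text \<open>Additivity needs convergence of both integrals: this holds at every point for
  \<open>t > 0\<close>, but on the boundary only where both absolute potentials are finite, that is
  almost everywhere.\<close>

lemma finite_potential_add:
  assumes "finite_potential f" "finite_potential g"
  shows "finite_potential (\<lambda>y. f y + g y)"
    and "t > 0 \<Longrightarrow> finite_potential.U (\<lambda>y. f y + g y) t x = finite_potential.U f t x + finite_potential.U g t x"
    and "AE x in lborel. finite_potential.U (\<lambda>y. f y + g y) 0 x = finite_potential.U f 0 x + finite_potential.U g 0 x"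
proof -
  interpret f: finite_potential f by fact
  interpret g: finite_potential g by fact
  show fg: "finite_potential (\<lambda>y. f y + g y)"
  proof
    show "DIM('a) \<ge> 2" by (rule f.dim)
    fix x :: 'a and t :: real assume t: "t > 0"
    have "(\<integral>\<^sup>+y. ennreal (pot t (x - y)) * ennreal \<bar>f y + g y\<bar> \<partial>lborel)
       \<le> (\<integral>\<^sup>+y. ennreal (pot t (x - y)) * ennreal \<bar>f y\<bar> + ennreal (pot t (x - y)) * ennreal \<bar>g y\<bar> \<partial>lborel)"
      by (intro nn_integral_mono)
         (auto simp: distrib_left[symmetric] ennreal_plus[symmetric] simp del: ennreal_plus intro!: mult_left_mono ennreal_leI)
    also have "\<dots> < \<infinity>"
      using f.fin[OF t, of x] g.fin[OF t, of x] by (subst nn_integral_add) auto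
    finally show "(\<integral>\<^sup>+y. ennreal (pot t (x - y)) * ennreal \<bar>f y + g y\<bar> \<partial>lborel) < \<infinity>" .
  qed measurable
  have add: "finite_potential.U (\<lambda>y. f y + g y) t x = f.U t x + g.U t x"
    if "t > 0 \<or> (t = 0 \<and> f.Z x < \<infinity> \<and> g.Z x < \<infinity>)" for t x
    unfolding finite_potential.U_def[OF fg] f.U_def g.U_def distrib_left
    using that by (intro Bochner_Integration.integral_add f.integrable_pot g.integrable_pot) auto
  show "t > 0 \<Longrightarrow> finite_potential.U (\<lambda>y. f y + g y) t x = f.U t x + g.U t x"
    by (rule add) simp
  show "AE x in lborel. finite_potential.U (\<lambda>y. f y + g y) 0 x = f.U 0 x + g.U 0 x"
    using f.Z_finite g.Z_finite by eventually_elim (rule add, simp)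
qed

lemma finite_potential_uminus:
  assumes "finite_potential f"
  shows "finite_potential (\<lambda>y. - f y)" "finite_potential.U (\<lambda>y. - f y) t x = - finite_potential.U f t x"
proof -
  interpret f: finite_potential f by fact
  show m: "finite_potential (\<lambda>y. - f y)"
    by standard (use f.dim f.fin in auto)
  show "finite_potential.U (\<lambda>y. - f y) t x = - f.U t x"
    unfolding finite_potential.U_def[OF m] f.U_def by simp
qed

text \<open>With \<open>h\<close> the negated sum of the three densities,
  \<open>u = - C * U\<close>, and the domination principle makes the boundary potential
  non-negative. Strictness is by contradiction: one interior point with \<open>u \<ge> 0\<close>
  would annihilate the trace of \<open>u\<close>, and then \<open>u\<close> would be the strictly
  negative \<open>N f\<close>.\<close>

lemma mild_solution_negative:
  fixes f V b :: "real^'m \<Rightarrow> real"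
  assumes dim: "CARD('m) \<ge> 2" and C: "C > 0"
    and [measurable]: "f \<in> borel_measurable lebesgue" "V \<in> borel_measurable lebesgue" "b \<in> borel_measurable lebesgue"
    and sol: "mild_solution mu lam r q C \<rho> f V b u"
    and np: "\<And>y. f y \<le> 0" "\<And>y. V y \<le> 0" "\<And>y. b y \<le> 0"
    and D: "D \<in> sets lebesgue" "emeasure lebesgue D > 0" "\<And>y. y \<in> D \<Longrightarrow> f y < 0"
    and x: "x \<in> half_space"
  shows "u x < 0"
proof (rule ccontr)
  assume ux: "\<not> u x < 0"
  define w where "w = trace0 u"
  have [measurable]: "w \<in> borel_measurable lebesgue"
    using sol by (simp add: mild_solution_def in_A_def w_def)
  have [measurable]: "nonlin \<rho> b w \<in> borel_measurable lebesgue"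
    unfolding nonlin_def[abs_def] by measurable
  have int: "N_integrable C f x" "N_integrable C (\<lambda>y. V y * w y) x" "N_integrable C (nonlin \<rho> b w) x"
    and ueq: "u x = mild_rhs C \<rho> f V b u x" if "x \<in> half_space" for x
    using sol that by (auto simp: mild_solution_def w_def)
  obtain f1 where f1: "finite_potential f1" "AE y in lborel. f y = f1 y"
      "\<And>x t. N_op C f (x, t) = C * finite_potential.U f1 t x"
    using N_integrable_finite_potential[OF dim C, of f] int by auto
  obtain f2 where f2: "finite_potential f2" "AE y in lborel. V y * w y = f2 y"
      "\<And>x t. N_op C (\<lambda>y. V y * w y) (x, t) = C * finite_potential.U f2 t x"
    using N_integrable_finite_potential[OF dim C, of "\<lambda>y. V y * w y"] int by auto
  obtain f3 where f3: "finite_potential f3" "AE y in lborel. nonlin \<rho> b w y = f3 y"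
      "\<And>x t. N_op C (nonlin \<rho> b w) (x, t) = C * finite_potential.U f3 t x"
    using N_integrable_finite_potential[OF dim C, of "nonlin \<rho> b w"] int by auto
  define h where "h y = - (f1 y + f2 y + f3 y)" for y
  note f12 = finite_potential_add[OF f1(1) f2(1)]
  note f123 = finite_potential_add[OF f12(1) f3(1)]
  note hm = finite_potential_uminus[OF f123(1), folded h_def]
  interpret h: finite_potential h by (rule hm(1))
  interpret f1: finite_potential f1 by fact
  have Ut: "u (z, t) = - C * h.U t z" if "t > 0" for z t
    using that ueq[of "(z, t)"] unfolding hm(2) f123(2)[OF that] f12(2)[OF that]
    by (simp add: half_space_def mild_rhs_def f1(3) f2(3) f3(3) w_def[symmetric] algebra_simps)
  have U0: "AE z in lborel. w z = - C * h.U 0 z"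
  proof -
    have "AE z in lebesgue. w z = mild_rhs C \<rho> f V b u (z, 0)"
      using sol by (simp add: mild_solution_def w_def trace0_def)
    then have "AE z in lborel. w z = mild_rhs C \<rho> f V b u (z, 0)" by (simp add: AE_completion_iff)
    then show ?thesis using f12(3) f123(3)
      by eventually_elim (simp add: hm(2) mild_rhs_def f1(3) f2(3) f3(3) w_def[symmetric] algebra_simps)
  qed
  have "AE y in lborel. h.U 0 y < 0 \<longrightarrow> h y \<ge> 0"
    using U0 f1(2) f2(2) f3(2)
  proof eventually_elim
    case (elim y)
    show ?case
    proof
      assume "h.U 0 y < 0"
      \<comment> \<open>A negative potential means a positive trace; with non-positive coefficients
        each of the three densities is then at most 0, which is the hypothesis of the domination
        principle.\<close>
      then have "w y > 0" using elim(1) C by (simp add: mult_pos_neg)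
      then have "V y * w y \<le> 0" "nonlin \<rho> b w y \<le> 0"
        using np by (auto simp: nonlin_def mult_nonpos_nonneg)
      then show "h y \<ge> 0" using elim np(1)[of y] by (simp add: h_def)
    qed
  qed
  then have nn: "AE y in lborel. h.U 0 y \<ge> 0" by (rule h.domination)
  obtain z t where zt: "x = (z, t)" "t > 0" using x by (cases x) (auto simp: half_space_def)
  have "h.U t z \<le> 0" using ux Ut[OF zt(2), of z] C by (simp add: zt not_less mult_le_0_iff zero_le_mult_iff)
  then have "AE y in lborel. h.U 0 y = 0" by (rule h.U_positive[OF nn zt(2)])
  with U0 have w0: "AE y in lborel. w y = 0" by eventually_elim simp
  \<comment> \<open>With zero trace the linear and the nonlinear densities both vanish, leaving
    \<open>- f\<close> alone.\<close>
  have hf: "AE y in lborel. h y = - f1 y"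
    using w0 f2(2) f3(2) by eventually_elim (simp add: h_def nonlin_def)
  have "h.U t z = - f1.U t z"
  proof -
    have "h.U t z = (\<integral>y. pot t (z - y) * (- f1 y) \<partial>lborel)"
      unfolding h.U_def using hf by (intro integral_cong_AE) auto
    then show ?thesis by (simp add: f1.U_def)
  qed
  moreover have "N_op C (\<lambda>y. - f y) x > 0"
    using np D int(1)[OF x] by (intro N_op_pos[OF C _ _ x, of _ D]) (auto simp: N_integrable_def)
  then have "f1.U t z < 0"
    using f1(3)[of z t] C N_op_cmult[of C "-1" f x] by (simp add: zt mult_less_0_iff)
  ultimately show False using \<open>h.U t z \<le> 0\<close> by simp
qed

text \<open>Once the trace is non-negative almost everywhere, the two integrals containing it are
  non-negative; strict positivity is supplied by \<open>N f\<close> and the set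
  \<open>D\<close>.\<close>

lemma mild_solution_positive:
  fixes f V b :: "real^'m \<Rightarrow> real"
  assumes C: "C > 0"
    and [measurable]: "f \<in> borel_measurable lebesgue" "V \<in> borel_measurable lebesgue" "b \<in> borel_measurable lebesgue"
    and sol: "mild_solution mu lam r q C \<rho> f V b u"
    and lim: "(\<lambda>k. A_norm mu lam r q (\<lambda>x. picard C \<rho> f V b k x - u x)) \<longlonglongrightarrow> 0"
    and nn: "\<And>y. f y \<ge> 0" "\<And>y. V y \<ge> 0" "\<And>y. b y \<ge> 0"
    and D: "D \<in> sets lebesgue" "emeasure lebesgue D > 0" "\<And>y. y \<in> D \<Longrightarrow> f y > 0"
    and x: "x \<in> half_space"
  shows "u x > 0"
proof -
  have m: "trace0 u \<in> borel_measurable lebesgue"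
    using sol by (simp add: mild_solution_def in_A_def)
  have w: "AE y in lebesgue. trace0 u y \<ge> 0"
    using C nn by (intro trace_nonneg_limit[OF lim _ m] trace_picard_measurable picard_nonneg) auto
  have "N_op C f x > 0"
    using sol nn D x by (intro N_op_pos[OF C _ _ x, of _ D]) (auto simp: mild_solution_def)
  moreover have "N_op C (\<lambda>y. V y * trace0 u y) x \<ge> 0"
  proof (rule N_op_nonneg)
    show "AE y in lebesgue. 0 \<le> V y * trace0 u y" using w by eventually_elim (simp add: nn)
  qed (use C in simp)
  moreover have "N_op C (nonlin \<rho> b (trace0 u)) x \<ge> 0"
  proof (rule N_op_nonneg)
    show "AE y in lebesgue. 0 \<le> nonlin \<rho> b (trace0 u) y" using w by eventually_elim (simp add: nn nonlin_def)
  qed (use C in simp)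
  ultimately show ?thesis using sol x by (auto simp: mild_solution_def mild_rhs_def)
qed

text \<open>The factor \<open>c\<close> treats symmetry and antisymmetry together. The limit gives
  the trace relation only almost everywhere; the mild equation, valid at each interior point,
  upgrades it to a pointwise identity there.\<close>

lemma mild_solution_rotate:
  fixes f V b :: "real^'m \<Rightarrow> real" and T :: "real^'m \<Rightarrow> real^'m"
  assumes m: "f \<in> borel_measurable lebesgue" "V \<in> borel_measurable lebesgue" "b \<in> borel_measurable lebesgue"
    and sol: "mild_solution mu lam r q C \<rho> f V b u"
    and lim: "(\<lambda>k. A_norm mu lam r q (\<lambda>x. picard C \<rho> f V b k x - u x)) \<longlonglongrightarrow> 0"
    and T: "orthogonal_transformation T" and c: "c = 1 \<or> c = - 1"
    and rad: "radial V" "radial b" and f: "\<And>y. f (T y) = c * f y" and t: "t > 0"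
  shows "u (T x', t) = c * u (x', t)"
proof -
  have mu: "trace0 u \<in> borel_measurable lebesgue"
    using sol by (simp add: mild_solution_def in_A_def)
  have "AE y in lebesgue. trace0 u (T y) = c * trace0 u y"
    by (rule trace_rotate_limit[OF lim _ mu T c]) (intro trace_picard_measurable m picard_rotate[OF T c] rad f)+
  then have "mild_rhs C \<rho> f V b u (T x', t) = c * mild_rhs C \<rho> f V b u (x', t)"
    by (intro mild_rhs_rotate[OF T c] m mu rad f)
  moreover have "u y = mild_rhs C \<rho> f V b u y" if "snd y = t" for y
    using sol that t by (cases y) (auto simp: mild_solution_def half_space_def)
  ultimately show ?thesis by simp
qed

theorem theorem3p10:
  fixes \<rho> \<omega> p lam r mu q l1 l2 C :: real
    and \<A> :: "(real^'m \<Rightarrow> real^'m) set"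
  defines "n \<equiv> real CARD('m) + 1"
  assumes n3: "CARD('m) \<ge> 2"
    and rho: "(n - 1) / (n - 2) < \<rho>"
    and omega: "\<omega> = (n - 1) * (\<rho> - 1) / \<rho>"
    and p: "1 < p" "p < \<omega>"
    and lam: "lam = (n - 1) * (\<rho> - 1)"
    and rmu: "1 < r" "r < mu"
    and q: "1 < q" "q < lam"
    and ratios: "r / mu = q / lam" "q / lam = p / \<omega>"
    and rexp: "1 / r = (n - 1) / \<omega> - (n - 1) / mu"
    and mulam: "mu < lam"
    and l1: "1 < l1" "l1 \<le> n - 1"
    and l2: "1 < l2" "l2 \<le> n - 1"
    and Cpos: "C > 0"
    and A: "rot_family \<A>"
  shows "\<exists>\<epsilon>>0. \<exists>\<delta>>0. \<forall>V b f u.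
     V \<in> borel_measurable lebesgue \<and> b \<in> borel_measurable lebesgue \<and>
     f \<in> borel_measurable lebesgue \<and>
     weak_morrey_norm (n - 1) l1 V UNIV < ennreal \<epsilon> \<and>
     weak_morrey_norm (n - 1) l2 b UNIV < ennreal \<epsilon> \<and>
     weak_morrey_norm \<omega> p f UNIV < ennreal \<delta> \<and>
     mild_solution mu lam r q C \<rho> f V b u \<and>
     (\<lambda>k. A_norm mu lam r q (\<lambda>x. picard C \<rho> f V b k x - u x)) \<longlonglongrightarrow> 0
     \<longrightarrow>
     (\<forall>D. D \<in> sets lebesgue \<and> emeasure lebesgue D > 0 \<longrightarrow>
        (((\<forall>y. f y \<ge> 0 \<and> V y \<ge> 0 \<and> b y \<ge> 0) \<and> (\<forall>y\<in>D. f y > 0))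
           \<longrightarrow> (\<forall>x\<in>half_space. u x > 0)) \<and>
        (((\<forall>y. f y \<le> 0 \<and> V y \<le> 0 \<and> b y \<le> 0) \<and> (\<forall>y\<in>D. f y < 0))
           \<longrightarrow> (\<forall>x\<in>half_space. u x < 0))) \<and>
     ((radial V \<and> radial b \<and> (\<forall>T\<in>\<A>. \<forall>y. f (T y) = f y))
        \<longrightarrow> (\<forall>T\<in>\<A>. \<forall>x' t. t > 0 \<longrightarrow> u (T x', t) = u (x', t))) \<and>
     ((radial V \<and> radial b \<and> (\<forall>T\<in>\<A>. \<forall>y. f (T y) = - f y))
        \<longrightarrow> (\<forall>T\<in>\<A>. \<forall>x' t. t > 0 \<longrightarrow> u (T x', t) = - u (x', t)))"
proof (intro exI[of _ "1::real"] conjI zero_less_one allI impI ballI; elim conjE)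
  fix V b f :: "real^'m \<Rightarrow> real" and u :: "(real^'m) \<times> real \<Rightarrow> real"
  assume m: "V \<in> borel_measurable lebesgue" "b \<in> borel_measurable lebesgue" "f \<in> borel_measurable lebesgue"
    and sol: "mild_solution mu lam r q C \<rho> f V b u"
    and lim: "(\<lambda>k. A_norm mu lam r q (\<lambda>x. picard C \<rho> f V b k x - u x)) \<longlonglongrightarrow> 0"
  show "u x > 0" if "D \<in> sets lebesgue" "emeasure lebesgue D > 0" "\<forall>y\<in>D. f y > 0"
    "\<forall>y. f y \<ge> 0 \<and> V y \<ge> 0 \<and> b y \<ge> 0" "x \<in> half_space" for D x
    using that by (intro mild_solution_positive[OF Cpos m(3,1,2) sol lim, of D]) auto
  show "u x < 0" if "D \<in> sets lebesgue" "emeasure lebesgue D > 0" "\<forall>y\<in>D. f y < 0"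
    "\<forall>y. f y \<le> 0 \<and> V y \<le> 0 \<and> b y \<le> 0" "x \<in> half_space" for D x
    using that by (intro mild_solution_negative[OF n3 Cpos m(3,1,2) sol, of D]) auto
  have T: "orthogonal_transformation T" if "T \<in> \<A>" for T
    using A that by (simp add: rot_family_def)
  show "u (T x', t) = u (x', t)" if "radial V" "radial b" "\<forall>T\<in>\<A>. \<forall>y. f (T y) = f y" "T \<in> \<A>" "t > 0" for T x' t
    using mild_solution_rotate[OF m(3,1,2) sol lim T, of T 1] that by simp
  show "u (T x', t) = - u (x', t)" if "radial V" "radial b" "\<forall>T\<in>\<A>. \<forall>y. f (T y) = - f y" "T \<in> \<A>" "t > 0" for T x' t
    using mild_solution_rotate[OF m(3,1,2) sol lim T, of T "- 1"] that by simp
qed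

end
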